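(* Suppose $(g_1, g_2, g_3, \dots)$ is a sequence of positive numbers such that $g_n \to \infty$ as $n \to \infty$. Then there exists a real-valued strictly stationary, countable-state, irreducible, aperiodic Markov chain $X := (X_k, k \in \mathbb{Z})$ which is reversible and has the following properties: (i) There exists a positive constant $C$ such that $P(|X_0| \leq C) = 1$. (ii) $\alpha_X(n) \leq \beta_X(n)$ for all $n\in\mathbb{N}$, and $\beta_X(n) = O(g_n \cdot n^{-1})$ as $n \to \infty$. (iii) $E[X_0^2] < \infty$ and $E[X_0] = 0$; $\lim_{n \to \infty} n^{-1}\,\mathrm{Var}\bigl(\sum_{k=1}^n X_k\bigr) = \infty$; for every $c > 0$, $$\lim_{n \to \infty} \Bigl[\, \sup_{r \in \mathbb{R}} P\Bigl(r - c < n^{-1/2} \sum_{k=1}^n X_k < r + c\Bigr)\Bigr] = 0;$$ and there exist a strictly increasing sequence $(J(1), J(2), J(3), \dots)$ of positive integers and a sequence $(b_1, b_2, b_3, \dots)$ of positive constants satisfying $b_n \to \infty$ as $n \to \infty$, such that $$b_n^{-1} \sum_{k=1}^{J(n)} X_k \to \mu_{\mathrm{P1sL}} \quad \text{in distribution as } n \to \infty.$$ (iv) Defining $\mathbf{h}(n) := n^{-1}\,\mathrm{Var}\bigl(\sum_{k=1}^n X_k\bigr)$ for every $n \in \mathbb{N}$, one has that $$\mathbf{h}(n) \leq g_n \ \text{ for every } n \in \mathbb{N}, \qquad \text{and for every } N \in \mathbb{N}, \quad \limsup_{n \to \infty} \frac{\mathbf{h}(Nn)}{\mathbf{h}(n)}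 = N.$$
   Context: $\mathbb{N}$ is the set of positive integers. Markov chains are indexed by the set $\mathbb{Z}$ of all integers; "countable-state" means that the state space is a finite or countably infinite subset of $\mathbb{R}$. Reversible: a strictly stationary Markov chain $(X_k, k \in \mathbb{Z})$ is reversible if the time-reversed sequence $(X_{-k}, k \in \mathbb{Z})$ has the same distribution on $\mathbb{R}^{\mathbb{Z}}$ as $(X_k, k\in\mathbb{Z})$ (equivalently, $(X_1, X_0)$ has the same distribution as $(X_0, X_1)$). Dependence coefficients: for $\sigma$-fields $\mathcal{A}, \mathcal{B}$ on the probability space, $\alpha(\mathcal{A},\mathcal{B}) := \sup_{A \in \mathcal{A}, B \in \mathcal{B}} |P(A \cap B) - P(A)P(B)|$ and $\beta(\mathcal{A}, \mathcal{B}) := \sup \frac12 \sum_{i=1}^I \sum_{j=1}^J |P(A_i \cap B_j) - P(A_i)P(B_j)|$, the latter supremum being over all pairs of finite partitions $\{A_1,\dots,A_I\}$, $\{B_1,\dots,B_J\}$ of $\Omega$ with $A_i \in \mathcal{A}$, $B_j \in \mathcal{B}$. For a strictly stationary sequence $X$ and $n \in \mathbb{N}$, $\alpha_X(n) := \alpha(\sigma(X_k, k \le 0), \sigma(X_k, k \ge n))$ and $\beta_X(n) := \beta(\sigma(X_k, k \le 0), \sigma(X_k, k \ge n))$. The distribution $\mu_{\mathrm{P1sL}}$: the distribution of the random variable $Y := \sum_{k=1}^{N} \eta_k$ (with empty sum equal to $0$), where $\eta_1, \eta_2, \dots$ are i.i.d. with the Laplace density $\frac12 e^{-|x|}$, $x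 \in \mathbb{R}$, and $N$ is a Poisson random variable with mean $1$, independent of $(\eta_1, \eta_2, \dots)$. *)

theory Defs
  imports "HOL-Probability.Probability" "HOL-Library.Landau_Symbols"
begin

section \<open>Real-valued processes indexed by the integers\<close>

definition real_process :: "'a measure \<Rightarrow> (int \<Rightarrow> 'a \<Rightarrow> real) \<Rightarrow> bool" where
  "real_process M X \<longleftrightarrow> prob_space M \<and> (\<forall>k. X k \<in> borel_measurable M)"

definition strictly_stationary :: "'a measure \<Rightarrow> (int \<Rightarrow> 'a \<Rightarrow> real) \<Rightarrow> bool" where
  "strictly_stationary M X \<longleftrightarrow> real_process M X \<and>
     (\<forall>m::int. distr M (\<Pi>\<^sub>M k\<in>UNIV. borel) (\<lambda>\<omega> k. X (k + m) \<omega>) =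
               distr M (\<Pi>\<^sub>M k\<in>UNIV. borel) (\<lambda>\<omega> k. X k \<omega>))"

definition reversible_process :: "'a measure \<Rightarrow> (int \<Rightarrow> 'a \<Rightarrow> real) \<Rightarrow> bool" where
  "reversible_process M X \<longleftrightarrow>
     distr M (\<Pi>\<^sub>M k\<in>UNIV. borel) (\<lambda>\<omega> k. X (- k) \<omega>) =
     distr M (\<Pi>\<^sub>M k\<in>UNIV. borel) (\<lambda>\<omega> k. X k \<omega>)"

section \<open>Countable-state Markov chains\<close>

text \<open>
  The past \<open>X (k - m), \<dots>, X k\<close> is prescribed by \<open>x m, \<dots>, x 0\<close>.  The condition is imposed
  only when the conditioning event has positive probability, as \<^const>\<open>cond_prob\<close> is a quotient.
\<close>

definition markov_property :: "'a measure \<Rightarrow> (int \<Rightarrow> 'a \<Rightarrow> real) \<Rightarrow> bool" where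
  "markov_property M X \<longleftrightarrow>
     (\<forall>(k::int) (m::nat) (x::nat \<Rightarrow> real) (y::real).
        measure M {\<omega> \<in> space M. \<forall>i\<le>m. X (k - int i) \<omega> = x i} > 0 \<longrightarrow>
        cond_prob M (\<lambda>\<omega>. X (k + 1) \<omega> = y) (\<lambda>\<omega>. \<forall>i\<le>m. X (k - int i) \<omega> = x i) =
        cond_prob M (\<lambda>\<omega>. X (k + 1) \<omega> = y) (\<lambda>\<omega>. X k \<omega> = x 0))"

text \<open>
  States of probability zero are excluded from the state space \<open>S\<close>, so that all transition
  probabilities \<open>P(X\<^sub>n = j | X\<^sub>0 = i)\<close> are elementary conditional probabilities.  For a stationary
  irreducible chain this is no restriction.
\<close>

definition stationary_markov_chain :: "'a measure \<Rightarrow> (int \<Rightarrow> 'a \<Rightarrow> real) \<Rightarrow> real set \<Rightarrow> bool" where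
  "stationary_markov_chain M X S \<longleftrightarrow>
     strictly_stationary M X \<and> markov_property M X \<and>
     countable S \<and> (\<forall>k. \<forall>\<omega>\<in>space M. X k \<omega> \<in> S) \<and>
     (\<forall>i\<in>S. measure M {\<omega> \<in> space M. X 0 \<omega> = i} > 0)"

definition trans_prob :: "'a measure \<Rightarrow> (int \<Rightarrow> 'a \<Rightarrow> real) \<Rightarrow> nat \<Rightarrow> real \<Rightarrow> real \<Rightarrow> real" where
  "trans_prob M X n i j = cond_prob M (\<lambda>\<omega>. X (int n) \<omega> = j) (\<lambda>\<omega>. X 0 \<omega> = i)"

definition irreducible_chain :: "'a measure \<Rightarrow> (int \<Rightarrow> 'a \<Rightarrow> real) \<Rightarrow> real set \<Rightarrow> bool" where
  "irreducible_chain M X S \<longleftrightarrow> (\<forall>i\<in>S. \<forall>j\<in>S. \<exists>n\<ge>1. trans_prob M X n i j > 0)"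

definition aperiodic_chain :: "'a measure \<Rightarrow> (int \<Rightarrow> 'a \<Rightarrow> real) \<Rightarrow> real set \<Rightarrow> bool" where
  "aperiodic_chain M X S \<longleftrightarrow> (\<forall>i\<in>S. Gcd {n::nat. n \<ge> 1 \<and> trans_prob M X n i i > 0} = 1)"

section \<open>Dependence coefficients\<close>

definition alpha_coeff :: "'a measure \<Rightarrow> 'a set set \<Rightarrow> 'a set set \<Rightarrow> real" where
  "alpha_coeff M \<A> \<B> =
     (SUP (A, B) \<in> \<A> \<times> \<B>. \<bar>measure M (A \<inter> B) - measure M A * measure M B\<bar>)"

text \<open>
  \<^const>\<open>partition_on\<close> requires nonempty blocks; empty ones would contribute nothing to the sum.
\<close>

definition finite_partitions :: "'a measure \<Rightarrow> 'a set set \<Rightarrow> 'a set set set" where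
  "finite_partitions M \<A> = {P. finite P \<and> partition_on (space M) P \<and> P \<subseteq> \<A>}"

definition beta_coeff :: "'a measure \<Rightarrow> 'a set set \<Rightarrow> 'a set set \<Rightarrow> real" where
  "beta_coeff M \<A> \<B> =
     (SUP (P, Q) \<in> finite_partitions M \<A> \<times> finite_partitions M \<B>.
        1 / 2 * (\<Sum>A\<in>P. \<Sum>B\<in>Q. \<bar>measure M (A \<inter> B) - measure M A * measure M B\<bar>))"

definition sigma_field :: "'a measure \<Rightarrow> (int \<Rightarrow> 'a \<Rightarrow> real) \<Rightarrow> int set \<Rightarrow> 'a set set" where
  "sigma_field M X I =
     sigma_sets (space M) {X k -` B \<inter> space M | k B. k \<in> I \<and> B \<in> sets borel}"

definition alpha_mixing :: "'a measure \<Rightarrow> (int \<Rightarrow> 'a \<Rightarrow> real) \<Rightarrow> nat \<Rightarrow> real" where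
  "alpha_mixing M X n = alpha_coeff M (sigma_field M X {..0}) (sigma_field M X {int n..})"

definition beta_mixing :: "'a measure \<Rightarrow> (int \<Rightarrow> 'a \<Rightarrow> real) \<Rightarrow> nat \<Rightarrow> real" where
  "beta_mixing M X n = beta_coeff M (sigma_field M X {..0}) (sigma_field M X {int n..})"

section \<open>Partial sums\<close>

definition partial_sum :: "(int \<Rightarrow> 'a \<Rightarrow> real) \<Rightarrow> nat \<Rightarrow> 'a \<Rightarrow> real" where
  "partial_sum X n \<omega> = (\<Sum>k=1..n. X (int k) \<omega>)"

definition normalized_variance :: "'a measure \<Rightarrow> (int \<Rightarrow> 'a \<Rightarrow> real) \<Rightarrow> nat \<Rightarrow> real" where
  "normalized_variance M X n = prob_space.variance M (partial_sum X n) / real n"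

section \<open>The Poisson mixture of sums of Laplace variables\<close>

definition laplace_measure :: "real measure" where
  "laplace_measure = density lborel (\<lambda>x. ennreal (1 / 2 * exp (- \<bar>x\<bar>)))"

text \<open>
  The law of \<open>\<Sum>k=1..N. \<eta> k\<close>; the product measure makes \<open>N\<close> and all \<open>\<eta> k\<close> independent.
\<close>

definition mu_P1sL :: "real measure" where
  "mu_P1sL =
     distr (measure_pmf (poisson_pmf 1) \<Otimes>\<^sub>M (\<Pi>\<^sub>M k\<in>(UNIV :: nat set). laplace_measure)) borel
       (\<lambda>(N, \<eta>). \<Sum>k=1..N. \<eta> k)"

end

theory Submission
  imports Defs "HOL-Real_Asymp.Real_Asymp"
begin

text \<open>
  The chain is a coded superposition \<open>X k = (\<Sum>j. Z j k / 4 ^ j)\<close> of independent three-state chains.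
  At each step \<open>Z j\<close> keeps its value with probability \<open>1 - \<theta> j\<close> and otherwise takes a fresh value,
  which is \<open>1\<close> or \<open>-1\<close> with probability \<open>p j / 2\<close> each and \<open>0\<close> else; such a chain is reversible, has
  covariances \<open>p j * (1 - \<theta> j) ^ n\<close> and beta-mixing coefficients of order \<open>p j * (1 - \<theta> j) ^ n\<close>.
  Both the variance per unit time and \<open>n\<close> times the mixing coefficient are thus controlled by
  \<open>\<Sum>j. min (n * p j) (p j / \<theta> j)\<close>, which stays below \<open>g n\<close> if the \<open>p j\<close> decrease fast enough while the
  \<open>p j / \<theta> j\<close> increase to infinity.  With widely separated scales there are times at which a single
  component dominates: up to \<open>1 / \<theta> j\<close> its variance grows quadratically, which gives the limit
  superior, and at \<open>1 / (\<theta> j * p j)\<close> it has made a Poisson(1) number of excursions of exponential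
  length and random sign, which gives the limit law.  The normalized sums spread out because
  each component on its own obeys the central limit theorem with a variance that grows with \<open>j\<close>.
\<close>

section \<open>Functions of few coordinates of an independent family\<close>

text \<open>The parameters are fixed in a definite order. The saturation levels
  \<open>weight j\<close> come first and depend on nothing. A slowly growing \<open>g\<close> only
  affects \<open>p j\<close>: for large \<open>n\<close> the required bound holds because
  \<open>g n\<close> exceeds a multiple of the level, and the finitely many smaller \<open>n\<close>
  are served by making \<open>p j\<close> small, which delays component \<open>j\<close>. Then
  \<open>\<theta> j\<close> is determined by \<open>p j\<close> and the level. The tail condition is
  quadratic in \<open>p J\<close> because the Poisson limit is read at time
  \<open>1 / (\<theta> J * p J)\<close>; there a later component, bounded by its quadratic phase,
  must be small against one squared block length. The analytic obstacle is that one component has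
  two limits, Gaussian for fixed \<open>j\<close> and compound Poisson along growing
  \<open>J\<close>. Both come from one non-asymptotic estimate, \<open>comp_char_approx\<close>: a
  factor for the unfinished current block makes the recursion for the characteristic function almost
  scalar, with explicit error. Moments and transforms are obtained from the single-step identity
  \<open>one_step\<close>, without conditioning.\<close>

definition depends_on :: "'i set \<Rightarrow> (('i \<Rightarrow> 'b) \<Rightarrow> 'c) \<Rightarrow> bool" where
  "depends_on A f \<longleftrightarrow> (\<forall>\<omega> \<omega>'. (\<forall>i\<in>A. \<omega> i = \<omega>' i) \<longrightarrow> f \<omega> = f \<omega>')"

lemma depends_onI:
  fixes f :: "('i \<Rightarrow> 'b) \<Rightarrow> 'c"
  assumes eq: "\<And>\<omega> \<omega>'. (\<And>i. i \<in> A \<Longrightarrow> \<omega> i = \<omega>' i) \<Longrightarrow> f \<omega> = f \<omega>'"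
  shows "depends_on A f"
  unfolding depends_on_def
proof (intro allI impI)
  fix \<omega> \<omega>' :: "'i \<Rightarrow> 'b" assume h: "\<forall>i\<in>A. \<omega> i = \<omega>' i"
  show "f \<omega> = f \<omega>'" by (rule eq) (rule bspec[OF h])
qed

lemma depends_onD:
  assumes f: "depends_on A f" and eq: "\<And>i. i \<in> A \<Longrightarrow> \<omega> i = \<omega>' i"
  shows "f \<omega> = f \<omega>'"
proof -
  have "\<forall>i\<in>A. \<omega> i = \<omega>' i" by (rule ballI) (rule eq)
  with f show ?thesis unfolding depends_on_def by blast
qed

lemma depends_on_compose:
  fixes f :: "('i \<Rightarrow> 'b) \<Rightarrow> 'c"
  assumes f: "depends_on A f"
  shows "depends_on A (\<lambda>\<omega>. h (f \<omega>))"
proof (rule depends_onI)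
  fix \<omega> \<omega>' :: "'i \<Rightarrow> 'b" assume eq: "\<And>i. i \<in> A \<Longrightarrow> \<omega> i = \<omega>' i"
  have "f \<omega> = f \<omega>'" by (rule depends_onD[OF f]) (rule eq)
  then show "h (f \<omega>) = h (f \<omega>')" by simp
qed

lemma depends_on_compose2:
  fixes g :: "('i \<Rightarrow> 'b) \<Rightarrow> 'd" and f :: "('i \<Rightarrow> 'b) \<Rightarrow> 'c"
  assumes f: "depends_on A f" and g: "depends_on A g"
  shows "depends_on A (\<lambda>\<omega>. h (f \<omega>) (g \<omega>))"
proof (rule depends_onI)
  fix \<omega> \<omega>' :: "'i \<Rightarrow> 'b" assume eq: "\<And>i. i \<in> A \<Longrightarrow> \<omega> i = \<omega>' i"
  have "f \<omega> = f \<omega>'" by (rule depends_onD[OF f]) (rule eq)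
  moreover have "g \<omega> = g \<omega>'" by (rule depends_onD[OF g]) (rule eq)
  ultimately show "h (f \<omega>) (g \<omega>) = h (f \<omega>') (g \<omega>')" by simp
qed

lemma depends_on_mono:
  fixes f :: "('i \<Rightarrow> 'b) \<Rightarrow> 'c"
  assumes f: "depends_on A f" and AB: "A \<subseteq> B"
  shows "depends_on B f"
proof (rule depends_onI)
  fix \<omega> \<omega>' :: "'i \<Rightarrow> 'b" assume eq: "\<And>i. i \<in> B \<Longrightarrow> \<omega> i = \<omega>' i"
  show "f \<omega> = f \<omega>'" by (rule depends_onD[OF f], rule eq) (use AB in blast)
qed

text \<open>The factors may have different laws; only independence is built in.\<close>

abbreviation iid_space :: "('i \<Rightarrow> 'b pmf) \<Rightarrow> ('i \<Rightarrow> 'b) measure" where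
  "iid_space D \<equiv> \<Pi>\<^sub>M i\<in>UNIV. measure_pmf (D i)"

lemma prob_space_iid: "prob_space (iid_space D)"
  by (intro prob_space_PiM measure_pmf.prob_space_axioms)

lemma space_iid [simp]: "space (iid_space D) = UNIV"
  by (simp add: space_PiM)

text \<open>Independence amounts to the joint law being the product of the marginals, and the joint
  law of the coordinates is the product measure itself. The factors are arbitrary probability spaces
  so that the Laplace variables of the limit law are covered as well.\<close>

lemma indep_vars_PiM_coordinates:
  assumes N: "\<And>i. prob_space (N i)"
  shows "prob_space.indep_vars (PiM UNIV N) N (\<lambda>i \<omega>. \<omega> i) (UNIV :: 'i set)"
proof -
  interpret prob_space "PiM UNIV N" by (rule prob_space_PiM) (rule N)
  interpret P: product_prob_space N "UNIV :: 'i set"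
    by (rule product_prob_spaceI) (rule N)
  show ?thesis
  proof (subst indep_vars_iff_distr_eq_PiM)
    have "distr (PiM UNIV N) (PiM UNIV N) (\<lambda>x. \<lambda>i\<in>UNIV. x i) = distr (PiM UNIV N) (PiM UNIV N) (\<lambda>x. x)"
      by (rule distr_cong) (simp_all add: fun_eq_iff)
    also have "\<dots> = (\<Pi>\<^sub>M i\<in>UNIV. distr (PiM UNIV N) (N i) (\<lambda>\<omega>. \<omega> i))"
      by (subst P.PiM_component) (simp_all add: distr_id)
    finally show "distr (PiM UNIV N) (PiM UNIV N) (\<lambda>x. \<lambda>i\<in>UNIV. x i) =
      (\<Pi>\<^sub>M i\<in>UNIV. distr (PiM UNIV N) (N i) (\<lambda>\<omega>. \<omega> i))" .
    show "UNIV \<noteq> ({} :: 'i set)" by (rule UNIV_not_empty)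
    show "random_variable (N i) (\<lambda>\<omega>. \<omega> i)" for i
      by (rule measurable_component_singleton) simp
  qed
qed

lemma indep_vars_coordinates:
  "prob_space.indep_vars (iid_space D) (\<lambda>i. measure_pmf (D i)) (\<lambda>i \<omega>. \<omega> i) UNIV"
  by (rule indep_vars_PiM_coordinates) (rule measure_pmf.prob_space_axioms)

text \<open>A function that depends on \<open>A\<close> only factors through the restriction to
  \<open>A\<close>: the restricted point is refilled with \<open>undefined\<close> outside
  \<open>A\<close>, which is a measurable operation. Independence of the two blocks of coordinates
  then passes to \<open>f\<close> and \<open>g\<close>.\<close>

lemma indep_var_depends_on:
  assumes f[measurable]: "f \<in> iid_space D \<rightarrow>\<^sub>M N1" and g[measurable]: "g \<in> iid_space D \<rightarrow>\<^sub>M N2"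
    and A: "depends_on A f" and B: "depends_on B g" and AB: "A \<inter> B = {}"
  shows "prob_space.indep_var (iid_space D) N1 f N2 g"
proof -
  interpret prob_space "iid_space D" by (rule prob_space_iid)
  let ?M = "\<lambda>i. measure_pmf (D i)"
  let ?ext = "\<lambda>A x i. if i \<in> A then x i else undefined"
  have ext: "?ext A \<in> (\<Pi>\<^sub>M i\<in>A. ?M i) \<rightarrow>\<^sub>M iid_space D" for A
  proof (rule measurable_PiM_single')
    fix i show "(\<lambda>\<omega>. if i \<in> A then \<omega> i else undefined) \<in> (\<Pi>\<^sub>M i\<in>A. ?M i) \<rightarrow>\<^sub>M ?M i"
      by (cases "i \<in> A") (simp_all add: measurable_component_singleton del: measurable_pmf_measure2)
  qed auto
  let ?K = "\<lambda>b::bool. if b then A else B"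
  have "indep_vars (\<lambda>b. \<Pi>\<^sub>M i\<in>?K b. ?M i) (\<lambda>b \<omega>. restrict (\<lambda>i. \<omega> i) (?K b)) UNIV"
    by (rule indep_vars_restrict[OF indep_vars_coordinates])
       (use AB in \<open>auto simp: disjoint_family_on_def\<close>)
  then have "indep_vars (case_bool N1 N2) (\<lambda>b \<omega>. (case_bool (\<lambda>x. f (?ext A x)) (\<lambda>x. g (?ext B x)) b) (restrict (\<lambda>i. \<omega> i) (?K b))) UNIV"
  proof (rule indep_vars_compose2)
    fix b show "case_bool (\<lambda>x. f (?ext A x)) (\<lambda>x. g (?ext B x)) b \<in> (\<Pi>\<^sub>M i\<in>?K b. ?M i) \<rightarrow>\<^sub>M case_bool N1 N2 b"
      using measurable_compose[OF ext f, of A] measurable_compose[OF ext g, of B] by (cases b) simp_all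
  qed
  also have "(\<lambda>b \<omega>. (case_bool (\<lambda>x. f (?ext A x)) (\<lambda>x. g (?ext B x)) b) (restrict (\<lambda>i. \<omega> i) (?K b))) = case_bool f g"
  proof -
    have "f (?ext A (restrict \<omega> A)) = f \<omega>" "g (?ext B (restrict \<omega> B)) = g \<omega>" for \<omega>
      by (rule depends_onD[OF A], simp) (rule depends_onD[OF B], simp)
    then show ?thesis by (simp add: fun_eq_iff split: bool.split)
  qed
  finally show ?thesis
    by (simp add: indep_var_def)
qed

lemma prob_Int_depends_on:
  assumes E: "{\<omega>. P \<omega>} \<in> sets (iid_space D)" and F: "{\<omega>. Q \<omega>} \<in> sets (iid_space D)"
    and A: "depends_on A P" and B: "depends_on B Q" and AB: "A \<inter> B = {}"
  shows "measure (iid_space D) {\<omega>. P \<omega> \<and> Q \<omega>} = measure (iid_space D) {\<omega>. P \<omega>} * measure (iid_space D) {\<omega>. Q \<omega>}"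
proof -
  interpret prob_space "iid_space D" by (rule prob_space_iid)
  have [measurable]: "Measurable.pred (iid_space D) P" "Measurable.pred (iid_space D) Q"
    using E F by (simp_all add: pred_def)
  have "indep_var (count_space UNIV) P (count_space UNIV) Q"
    by (rule indep_var_depends_on[OF _ _ A B AB]) measurable
  from indep_varD[OF this, of "{True}" "{True}"] show ?thesis
    by (simp add: vimage_def)
qed

text \<open>Injectivity keeps the relabelled coordinates independent, and the second assumption
  keeps their laws. The time shift and the swap of the two copies are both instances.\<close>

lemma distr_reindex_iid:
  assumes "inj \<tau>" "\<And>i. D (\<tau> i) = D i"
  shows "distr (iid_space D) (iid_space D) (\<lambda>\<omega> i. \<omega> (\<tau> i)) = iid_space D"
  using distr_PiM_reindex[of UNIV "\<lambda>i. measure_pmf (D i)" \<tau> UNIV] assms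
  by (simp add: measure_pmf.prob_space_axioms restrict_def)

lemma measurable_reindex_iid:
  assumes "\<And>i. D (\<tau> i) = D i"
  shows "(\<lambda>\<omega> i. \<omega> (\<tau> i)) \<in> iid_space D \<rightarrow>\<^sub>M iid_space D"
proof (rule measurable_PiM_single')
  fix i
  have "(\<lambda>\<omega>. \<omega> (\<tau> i)) \<in> iid_space D \<rightarrow>\<^sub>M measure_pmf (D (\<tau> i))"
    by (rule measurable_component_singleton) simp
  then show "(\<lambda>\<omega>. \<omega> (\<tau> i)) \<in> iid_space D \<rightarrow>\<^sub>M measure_pmf (D i)"
    by (simp only: assms)
qed simp

section \<open>Hold-or-resample chains\<close>

text \<open>Sample points are arbitrary real functions, so innovations outside the four intended
  values do occur, on a null set. Clipping keeps the component chains in {-1, 0, 1} at every sample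
  point, as the pointwise state space condition of the theorem demands.\<close>

definition clip :: "real \<Rightarrow> real" where
  "clip x = (if x = 1 \<or> x = -1 then x else 0)"

lemma clip_cases: "clip x = 0 \<or> clip x = 1 \<or> clip x = -1"
  by (auto simp: clip_def)

text \<open>
  Innovations are indexed by a copy flag, the number of the component chain and the time; they are
  coded by integers because the probability space has to live on \<^typ>\<open>int \<Rightarrow> real\<close>.  The chain uses
  the copy \<^const>\<open>False\<close>; the copy \<^const>\<open>True\<close> supplies an independent past for the coupling.
\<close>

definition index_code :: "bool \<times> nat \<times> int \<Rightarrow> int" where
  "index_code x = int_decode (to_nat_on UNIV x)"

definition index_decode :: "int \<Rightarrow> bool \<times> nat \<times> int" where
  "index_decode = inv index_code"

lemma bij_index_code: "bij index_code"
proof -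
  have "infinite (UNIV :: (bool \<times> nat \<times> int) set)"
    by (simp add: finite_prod)
  then have "bij_betw (to_nat_on (UNIV :: (bool \<times> nat \<times> int) set)) UNIV UNIV"
    by (intro to_nat_on_infinite) auto
  then have "bij_betw (int_decode \<circ> to_nat_on (UNIV :: (bool \<times> nat \<times> int) set)) UNIV UNIV"
    by (rule bij_betw_trans) (rule bij_int_decode)
  then show ?thesis by (simp add: index_code_def[abs_def] comp_def)
qed

lemma index_decode_code [simp]: "index_decode (index_code x) = x"
  using bij_index_code by (simp add: index_decode_def bij_is_inj)

lemma index_code_decode [simp]: "index_code (index_decode i) = i"
  using bij_index_code by (simp add: index_decode_def bij_is_surj surj_f_inv_f)

lemma index_code_eq_iff [simp]: "index_code x = index_code y \<longleftrightarrow> x = y"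
  using bij_index_code by (auto dest: bij_is_inj injD)

lemma inj_conj_index_code: "inj f \<Longrightarrow> inj (\<lambda>i. index_code (f (index_decode i)))"
proof (rule injI)
  fix x y assume "inj f" "index_code (f (index_decode x)) = index_code (f (index_decode y))"
  then have "index_decode x = index_decode y" by (simp add: inj_eq)
  then have "index_code (index_decode x) = index_code (index_decode y)" by simp
  then show "x = y" by simp
qed

text \<open>The geometric bound makes \<open>p\<close> summable with sum at most
  \<open>1 / 3\<close>: summability leaves only finitely many nonzero digits almost surely, and the
  value \<open>1 / 3\<close> keeps a union bound over two time points below
  \<open>1\<close>.\<close>

locale hold_resample =
  fixes p \<theta> :: "nat \<Rightarrow> real"
  assumes p_pos: "0 < p j" and p_le: "p j \<le> 1 / 4 ^ (j + 1)"
    and \<theta>_pos: "0 < \<theta> j" and \<theta>_less: "\<theta> j < 1"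
begin

lemma p_le_quarter: "p j \<le> 1 / 4"
proof -
  have "p j \<le> 1 / 4 ^ (j+1)" by (rule p_le)
  also have "\<dots> \<le> 1 / 4 ^ 1" by (intro divide_left_mono power_increasing) auto
  finally show ?thesis by simp
qed

text \<open>
  The innovation \<open>2\<close> means that component \<open>j\<close> keeps its value; the innovations \<open>0, 1, -1\<close> are
  the new value.
\<close>

definition step_pmf :: "nat \<Rightarrow> real pmf" where
  "step_pmf j = pmf_of_list [(2, 1 - \<theta> j), (0, \<theta> j * (1 - p j)), (1, \<theta> j * (p j / 2)), (-1, \<theta> j * (p j / 2))]"

lemma pmf_step: "pmf (step_pmf j) x =
    (if x = 2 then 1 - \<theta> j else if x = 0 then \<theta> j * (1 - p j)
     else if x = 1 \<or> x = -1 then \<theta> j * (p j / 2) else 0)"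
proof -
  have "0 \<le> \<theta> j * p j" "0 \<le> \<theta> j * (1 - p j)"
    using p_pos[of j] p_le_quarter[of j] \<theta>_pos[of j] by simp_all
  then have "pmf_of_list_wf [(2::real, 1 - \<theta> j), (0, \<theta> j * (1 - p j)), (1, \<theta> j * (p j / 2)), (-1, \<theta> j * (p j / 2))]"
    using \<theta>_less[of j] unfolding pmf_of_list_wf_def by (simp add: algebra_simps)
  then show ?thesis by (auto simp: step_pmf_def pmf_pmf_of_list)
qed

lemma integral_step:
  fixes f :: "real \<Rightarrow> 'c::{banach, second_countable_topology}"
  shows "(\<integral>x. f x \<partial>measure_pmf (step_pmf j)) =
    (1 - \<theta> j) *\<^sub>R f 2 + \<theta> j *\<^sub>R ((1 - p j) *\<^sub>R f 0 + (p j / 2) *\<^sub>R (f 1 + f (-1)))"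
proof -
  have "set_pmf (step_pmf j) \<subseteq> {2, 0, 1, -1}"
    by (auto simp: set_pmf_iff pmf_step split: if_splits)
  then show ?thesis
    by (subst integral_measure_pmf[of "{2, 0, 1, -1}"]) (auto simp: pmf_step scaleR_add_right)
qed

text \<open>The law of an innovation ignores the copy flag and the time; this makes the time shift
  and the swap of copies measure preserving.\<close>

abbreviation coord_pmf :: "int \<Rightarrow> real pmf" where
  "coord_pmf i \<equiv> step_pmf (fst (snd (index_decode i)))"

definition \<Omega> :: "(int \<Rightarrow> real) measure" where "\<Omega> = iid_space coord_pmf"

sublocale prob_space \<Omega>
  unfolding \<Omega>_def by (rule prob_space_iid)

lemma space_\<Omega> [simp]: "space \<Omega> = UNIV"
  by (simp add: \<Omega>_def)

definition \<xi> :: "nat \<Rightarrow> int \<Rightarrow> (int \<Rightarrow> real) \<Rightarrow> real" where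
  "\<xi> j k \<omega> = \<omega> (index_code (False, j, k))"

lemma prob_UNIV [simp]: "prob UNIV = 1"
  using prob_space by simp

lemma measurable_coord: "(\<lambda>\<omega>. \<omega> i) \<in> \<Omega> \<rightarrow>\<^sub>M count_space UNIV"
  unfolding \<Omega>_def
  using measurable_component_singleton[of i UNIV "\<lambda>i. measure_pmf (coord_pmf i)"]
  by (simp add: measurable_cong_sets[OF refl sets_measure_pmf_count_space])

lemma measurable_\<xi> [measurable]: "\<xi> j k \<in> \<Omega> \<rightarrow>\<^sub>M count_space UNIV"
  unfolding \<xi>_def by (rule measurable_coord)

lemma distr_\<xi>: "distr \<Omega> (count_space UNIV) (\<xi> j k) = measure_pmf (step_pmf j)"
proof -
  interpret P: product_prob_space "\<lambda>i. measure_pmf (coord_pmf i)" "UNIV :: int set" ..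
  have "distr \<Omega> (count_space UNIV) (\<xi> j k) = distr \<Omega> (measure_pmf (coord_pmf (index_code (False, j, k)))) (\<lambda>\<omega>. \<omega> (index_code (False, j, k)))"
    by (rule distr_cong) (auto simp: \<xi>_def)
  also have "\<dots> = measure_pmf (step_pmf j)"
    unfolding \<Omega>_def by (subst P.PiM_component) simp_all
  finally show ?thesis .
qed

lemma integral_\<xi>:
  fixes f :: "real \<Rightarrow> 'c::{banach, second_countable_topology}"
  shows "(\<integral>\<omega>. f (\<xi> j k \<omega>) \<partial>\<Omega>) =
    (1 - \<theta> j) *\<^sub>R f 2 + \<theta> j *\<^sub>R ((1 - p j) *\<^sub>R f 0 + (p j / 2) *\<^sub>R (f 1 + f (-1)))"
proof -
  have "(\<integral>\<omega>. f (\<xi> j k \<omega>) \<partial>\<Omega>) = (\<integral>x. f x \<partial>distr \<Omega> (count_space UNIV) (\<xi> j k))"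
    by (subst integral_distr) auto
  then show ?thesis by (simp add: distr_\<xi> integral_step)
qed

text \<open>
  The value at the last time at which component \<open>j\<close> was resampled, with the junk value \<open>0\<close> on the
  null set where there is no such time.
\<close>

definition Z :: "nat \<Rightarrow> int \<Rightarrow> (int \<Rightarrow> real) \<Rightarrow> real" where
  "Z j k \<omega> = (if \<exists>i. \<xi> j (k - int i) \<omega> \<noteq> 2
     then clip (\<xi> j (k - int (LEAST i. \<xi> j (k - int i) \<omega> \<noteq> 2)) \<omega>) else 0)"

lemma Z_cases: "Z j k \<omega> = 0 \<or> Z j k \<omega> = 1 \<or> Z j k \<omega> = -1"
  using clip_cases by (auto simp: Z_def)

lemma abs_Z_le: "\<bar>Z j k \<omega>\<bar> \<le> 1"
  using Z_cases[of j k \<omega>] by auto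

lemma measurable_Z [measurable]: "Z j k \<in> \<Omega> \<rightarrow>\<^sub>M count_space UNIV"
  unfolding Z_def[abs_def]
proof (rule measurable_If)
  show "(\<lambda>\<omega>. clip (\<xi> j (k - int (LEAST i. \<xi> j (k - int i) \<omega> \<noteq> 2)) \<omega>)) \<in> \<Omega> \<rightarrow>\<^sub>M count_space UNIV"
    by (rule measurable_compose_countable[where g="\<lambda>\<omega>. LEAST i. \<xi> j (k - int i) \<omega> \<noteq> 2"
          and f="\<lambda>n \<omega>. clip (\<xi> j (k - int n) \<omega>)"])
       (rule measurable_compose[OF measurable_\<xi>], simp, measurable)
qed measurable

lemma measurable_Z_borel [measurable]: "Z j k \<in> borel_measurable \<Omega>"
  by (rule measurable_compose[OF measurable_Z]) simp

text \<open>After a hold the search for the last resampling starts one step further back, which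
  shifts the least index by one. If there is no resampling at all, both sides take the default value
  \<open>0\<close>, so the recursion holds at every sample point and not only almost surely.\<close>

lemma Z_Suc: "Z j (k + 1) \<omega> = (if \<xi> j (k + 1) \<omega> = 2 then Z j k \<omega> else clip (\<xi> j (k + 1) \<omega>))"
proof (cases "\<xi> j (k + 1) \<omega> = 2")
  case False
  then have "(LEAST i. \<xi> j (k + 1 - int i) \<omega> \<noteq> 2) = 0"
    by (intro Least_equality) auto
  moreover have "\<exists>i. \<xi> j (k + 1 - int i) \<omega> \<noteq> 2" using False by (intro exI[of _ 0]) auto
  ultimately show ?thesis using False by (simp add: Z_def)
next
  case True
  have sh: "k + 1 - int (Suc i) = k - int i" for i by simp
  show ?thesis
  proof (cases "\<exists>i. \<xi> j (k - int i) \<omega> \<noteq> 2")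
    case ex: True
    then obtain i where i: "\<xi> j (k - int i) \<omega> \<noteq> 2" by auto
    then have i': "\<xi> j (k + 1 - int (Suc i)) \<omega> \<noteq> 2" unfolding sh .
    have "(LEAST i. \<xi> j (k + 1 - int i) \<omega> \<noteq> 2) = Suc (LEAST i. \<xi> j (k + 1 - int (Suc i)) \<omega> \<noteq> 2)"
      by (rule Least_Suc[where P="\<lambda>i. \<xi> j (k + 1 - int i) \<omega> \<noteq> 2", OF i']) (simp add: True)
    then have "(LEAST i. \<xi> j (k + 1 - int i) \<omega> \<noteq> 2) = Suc (LEAST i. \<xi> j (k - int i) \<omega> \<noteq> 2)"
      unfolding sh .
    moreover have "\<exists>i. \<xi> j (k + 1 - int i) \<omega> \<noteq> 2" using i' by blast
    ultimately show ?thesis using True ex by (simp add: Z_def)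
  next
    case nex: False
    have "\<xi> j (k + 1 - int i) \<omega> = 2" for i
      using nex True by (cases i) auto
    then show ?thesis using nex True by (auto simp: Z_def)
  qed
qed

definition coords :: "nat set \<Rightarrow> int set \<Rightarrow> int set" where
  "coords J I = index_code ` ({False} \<times> J \<times> I)"

lemma coords_disjoint: "J \<inter> J' = {} \<or> I \<inter> I' = {} \<Longrightarrow> coords J I \<inter> coords J' I' = {}"
  by (auto simp: coords_def)

lemma depends_on_\<xi>: "depends_on (coords {j} {k}) (\<xi> j k)"
  by (rule depends_onI) (auto simp: \<xi>_def coords_def)

lemma depends_on_Z: "depends_on (coords {j} {..k}) (Z j k)"
proof (rule depends_onI)
  fix \<omega> \<omega>' :: "int \<Rightarrow> real" assume eq: "\<And>i. i \<in> coords {j} {..k} \<Longrightarrow> \<omega> i = \<omega>' i"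
  have "\<xi> j (k - int i) \<omega> = \<xi> j (k - int i) \<omega>'" for i
    by (auto simp: \<xi>_def coords_def intro!: eq)
  then show "Z j k \<omega> = Z j k \<omega>'" by (simp add: Z_def)
qed

lemma indep_var_coords:
  assumes "f \<in> \<Omega> \<rightarrow>\<^sub>M N1" "g \<in> \<Omega> \<rightarrow>\<^sub>M N2" "depends_on A f" "depends_on B g" "A \<inter> B = {}"
  shows "indep_var N1 f N2 g"
  using indep_var_depends_on[of f coord_pmf N1 g N2 A B] assms by (simp add: \<Omega>_def)

lemma events_Collect: "Measurable.pred \<Omega> P \<Longrightarrow> {\<omega>. P \<omega>} \<in> sets \<Omega>"
  by (simp add: pred_def)

lemma prob_Int_coords:
  assumes "Measurable.pred \<Omega> P" "Measurable.pred \<Omega> Q" "depends_on A P" "depends_on B Q" "A \<inter> B = {}"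
  shows "prob {\<omega>. P \<omega> \<and> Q \<omega>} = prob {\<omega>. P \<omega>} * prob {\<omega>. Q \<omega>}"
  using prob_Int_depends_on[of P coord_pmf Q A B] assms by (simp add: \<Omega>_def pred_def)

section \<open>Time shift, transition identity and stationary law of one component\<close>

definition shift :: "int \<Rightarrow> (int \<Rightarrow> real) \<Rightarrow> int \<Rightarrow> real" where
  "shift m \<omega> i = \<omega> (index_code (case index_decode i of (b, j, t) \<Rightarrow> (b, j, t + m)))"

lemma distr_shift: "distr \<Omega> \<Omega> (shift m) = \<Omega>"
  unfolding \<Omega>_def shift_def[abs_def]
proof (rule distr_reindex_iid)
  show "inj (\<lambda>i. index_code (case index_decode i of (b, j, t) \<Rightarrow> (b, j, t + m)))"
    by (rule inj_conj_index_code) (auto simp: inj_def)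
qed (auto split: prod.splits)

lemma measurable_shift [measurable]: "shift m \<in> \<Omega> \<rightarrow>\<^sub>M \<Omega>"
  unfolding \<Omega>_def shift_def[abs_def]
  by (rule measurable_reindex_iid) (auto split: prod.splits)

lemma Z_shift: "Z j k (shift m \<omega>) = Z j (k + m) \<omega>"
proof -
  have "\<xi> j k (shift m \<omega>) = \<xi> j (k + m) \<omega>" for k
    by (simp add: \<xi>_def shift_def)
  then show ?thesis by (simp add: Z_def algebra_simps)
qed

text \<open>The mean of \<open>\<psi>\<close> under the law of a fresh value, which turns out to be
  the stationary law as well (\<open>integral_Z\<close>).\<close>

definition resample_mean :: "nat \<Rightarrow> (real \<Rightarrow> 'c::real_normed_vector) \<Rightarrow> 'c" where
  "resample_mean j \<psi> = (1 - p j) *\<^sub>R \<psi> 0 + (p j / 2) *\<^sub>R (\<psi> 1 + \<psi> (-1))"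

lemma bounded_Z: 
  fixes \<psi> :: "real \<Rightarrow> 'c::real_normed_vector"
  shows "norm (\<psi> (Z j k \<omega>)) \<le> norm (\<psi> 0) + norm (\<psi> 1) + norm (\<psi> (-1))"
  using Z_cases[of j k \<omega>] by auto

lemma measurable_fun_Z [measurable]:
  fixes \<psi> :: "real \<Rightarrow> 'c::topological_space"
  shows "(\<lambda>\<omega>. \<psi> (Z j k \<omega>)) \<in> borel_measurable \<Omega>"
  by (rule measurable_compose[OF measurable_Z]) simp

lemma integrable_mult_Z:
  fixes \<psi> :: "real \<Rightarrow> 'c::{real_normed_field, banach, second_countable_topology}"
  assumes "integrable \<Omega> Y"
  shows "integrable \<Omega> (\<lambda>\<omega>. Y \<omega> * \<psi> (Z j k \<omega>))"
proof (rule Bochner_Integration.integrable_bound)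
  show "integrable \<Omega> (\<lambda>\<omega>. (norm (\<psi> 0) + norm (\<psi> 1) + norm (\<psi> (-1))) * norm (Y \<omega>))"
    using assms by simp
  show "AE \<omega> in \<Omega>. norm (Y \<omega> * \<psi> (Z j k \<omega>)) \<le> norm ((norm (\<psi> 0) + norm (\<psi> 1) + norm (\<psi> (-1))) * norm (Y \<omega>))"
    using bounded_Z[of \<psi> j k] by (auto simp: norm_mult mult.commute[of "norm (Y _)"] intro!: mult_right_mono AE_I2)
qed (use assms in measurable)

text \<open>The innovation at time \<open>k + 1\<close> is independent of everything up to time
  \<open>k\<close>; splitting on whether it is a hold gives the two terms. This is the transition
  operator of the chain tested against a past variable \<open>Y\<close>; covariances, two-time laws
  and characteristic functions are all obtained by choosing \<open>Y\<close> and
  \<open>\<psi>\<close>.\<close>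

lemma one_step:
  fixes \<psi> :: "real \<Rightarrow> 'c::{real_normed_field, banach, second_countable_topology}"
  assumes Y: "integrable \<Omega> Y" and dep: "depends_on (coords UNIV {..k}) Y"
  shows "(\<integral>\<omega>. Y \<omega> * \<psi> (Z j (k + 1) \<omega>) \<partial>\<Omega>) =
    (1 - \<theta> j) *\<^sub>R (\<integral>\<omega>. Y \<omega> * \<psi> (Z j k \<omega>) \<partial>\<Omega>) + \<theta> j *\<^sub>R ((\<integral>\<omega>. Y \<omega> \<partial>\<Omega>) * resample_mean j \<psi>)"
proof -
  \<comment> \<open>\<open>?h\<close> marks a hold and \<open>?r\<close> is the contribution of a
    fresh value, so that \<open>\<psi> (Z j (k + 1) \<omega>)\<close> is
    \<open>\<psi> (Z j k \<omega>)\<close> times the first plus the second.\<close>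
  let ?h = "\<lambda>x::real. if x = 2 then 1 else (0::'c)" and ?r = "\<lambda>x::real. if x = 2 then 0 else \<psi> (clip x)"
  have [measurable]: "Y \<in> borel_measurable \<Omega>" using Y by auto
  have \<xi>_fun: "(\<lambda>\<omega>. f (\<xi> j (k + 1) \<omega>)) \<in> borel_measurable \<Omega>" for f :: "real \<Rightarrow> 'c"
    by (rule measurable_compose[OF measurable_\<xi>]) simp
  have dep_\<xi>: "depends_on (coords {j} {k + 1}) (\<lambda>\<omega>. f (\<xi> j (k + 1) \<omega>))" for f :: "real \<Rightarrow> 'c"
    by (rule depends_on_compose[OF depends_on_\<xi>])
  have ind: "indep_var borel U borel (\<lambda>\<omega>. f (\<xi> j (k + 1) \<omega>))"
    if "U \<in> borel_measurable \<Omega>" "depends_on (coords UNIV {..k}) U" for U and f :: "real \<Rightarrow> 'c"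
    by (rule indep_var_coords[OF that(1) \<xi>_fun that(2) dep_\<xi>]) (auto simp: coords_def)
  have int_\<xi>: "integrable \<Omega> (\<lambda>\<omega>. f (\<xi> j (k + 1) \<omega>))" for f :: "real \<Rightarrow> 'c"
  proof -
    have "integrable (distr \<Omega> (count_space UNIV) (\<xi> j (k + 1))) f"
      unfolding distr_\<xi> 
      by (rule integrable_measure_pmf_finite, rule finite_subset[of _ "{2, 0, 1, -1}"]) 
         (auto simp: set_pmf_iff pmf_step split: if_splits)
    then show ?thesis by (subst (asm) integrable_distr_eq) auto
  qed
  have dep2: "depends_on (coords UNIV {..k}) (\<lambda>\<omega>. Y \<omega> * \<psi> (Z j k \<omega>))"
    by (rule depends_on_compose2[OF dep depends_on_compose[OF depends_on_mono[OF depends_on_Z]]])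
       (auto simp: coords_def)
  note int2 = integrable_mult_Z[OF Y, of \<psi> j k]
  have "(\<integral>\<omega>. Y \<omega> * \<psi> (Z j (k + 1) \<omega>) \<partial>\<Omega>) =
    (\<integral>\<omega>. (Y \<omega> * \<psi> (Z j k \<omega>)) * ?h (\<xi> j (k + 1) \<omega>) + Y \<omega> * ?r (\<xi> j (k + 1) \<omega>) \<partial>\<Omega>)"
    by (rule Bochner_Integration.integral_cong) (auto simp: Z_Suc)
  also have "\<dots> = (\<integral>\<omega>. (Y \<omega> * \<psi> (Z j k \<omega>)) * ?h (\<xi> j (k + 1) \<omega>) \<partial>\<Omega>) + (\<integral>\<omega>. Y \<omega> * ?r (\<xi> j (k + 1) \<omega>) \<partial>\<Omega>)"
    by (intro Bochner_Integration.integral_add indep_var_integrable ind int2 int_\<xi> dep dep2 Y) auto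
  also have "\<dots> = (\<integral>\<omega>. Y \<omega> * \<psi> (Z j k \<omega>) \<partial>\<Omega>) * (\<integral>\<omega>. ?h (\<xi> j (k + 1) \<omega>) \<partial>\<Omega>) + (\<integral>\<omega>. Y \<omega> \<partial>\<Omega>) * (\<integral>\<omega>. ?r (\<xi> j (k + 1) \<omega>) \<partial>\<Omega>)"
    by (intro arg_cong2[where f="(+)"] indep_var_lebesgue_integral ind int2 int_\<xi> dep dep2 Y) auto
  also have "\<dots> = (1 - \<theta> j) *\<^sub>R (\<integral>\<omega>. Y \<omega> * \<psi> (Z j k \<omega>) \<partial>\<Omega>) + \<theta> j *\<^sub>R ((\<integral>\<omega>. Y \<omega> \<partial>\<Omega>) * resample_mean j \<psi>)"
    using integral_\<xi>[of ?h j "k + 1"] integral_\<xi>[of ?r j "k + 1"]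
    by (simp add: resample_mean_def clip_def)
  finally show ?thesis .
qed

lemma integral_shift:
  fixes f :: "_ \<Rightarrow> 'c::{banach, second_countable_topology}"
  assumes [measurable]: "f \<in> borel_measurable \<Omega>"
  shows "(\<integral>\<omega>. f (shift m \<omega>) \<partial>\<Omega>) = (\<integral>\<omega>. f \<omega> \<partial>\<Omega>)"
  using integral_distr[of "shift m" \<Omega> \<Omega> f] by (simp add: distr_shift)

text \<open>By shift invariance the mean is the same at times \<open>k\<close> and
  \<open>k + 1\<close>, so \<open>one_step\<close> with \<open>Y = 1\<close> is a linear equation
  for it, solvable because \<open>\<theta> j > 0\<close>. The random index in the definition of
  \<open>Z\<close> never has to be analysed.\<close>

lemma integral_Z:
  fixes \<psi> :: "real \<Rightarrow> 'c::{real_normed_field, banach, second_countable_topology}"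
  shows "(\<integral>\<omega>. \<psi> (Z j k \<omega>) \<partial>\<Omega>) = resample_mean j \<psi>"
proof -
  have "(\<integral>\<omega>. \<psi> (Z j (k + 1) \<omega>) \<partial>\<Omega>) = (\<integral>\<omega>. \<psi> (Z j k \<omega>) \<partial>\<Omega>)"
    using integral_shift[OF measurable_fun_Z[of \<psi> j k], of 1] unfolding Z_shift .
  moreover have "(\<integral>\<omega>. \<psi> (Z j (k + 1) \<omega>) \<partial>\<Omega>) = (1 - \<theta> j) *\<^sub>R (\<integral>\<omega>. \<psi> (Z j k \<omega>) \<partial>\<Omega>) + \<theta> j *\<^sub>R resample_mean j \<psi>"
    using one_step[of "\<lambda>_. 1" k \<psi> j] by (simp add: depends_onI)
  ultimately have "\<theta> j *\<^sub>R (\<integral>\<omega>. \<psi> (Z j k \<omega>) \<partial>\<Omega>) = \<theta> j *\<^sub>R resample_mean j \<psi>"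
    by (simp add: algebra_simps)
  then show ?thesis using \<theta>_pos[of j] by simp
qed

end

section \<open>The countable-state chain\<close>

definition fin_states :: "(nat \<Rightarrow> real) set" where
  "fin_states = {z. (\<forall>j. z j = 0 \<or> z j = 1 \<or> z j = -1) \<and> finite {j. z j \<noteq> 0}}"

text \<open>
  Base 4 leaves enough room for the digits \<open>-1, 0, 1\<close> to be read off the sum.  The value \<open>0\<close> for
  infinitely many nonzero digits is taken with probability zero only.
\<close>

definition code :: "(nat \<Rightarrow> real) \<Rightarrow> real" where
  "code z = (if finite {j. z j \<noteq> 0} then (\<Sum>j. z j / 4 ^ j) else 0)"

definition state_space :: "real set" where
  "state_space = code ` fin_states"

lemma zero_in_fin_states: "(\<lambda>_. 0) \<in> fin_states"
  by (simp add: fin_states_def)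

lemma countable_fin_states: "countable fin_states"
proof (rule countable_subset)
  let ?f = "\<lambda>l::real list. \<lambda>j. if j < length l then l ! j else 0"
  show "fin_states \<subseteq> ?f ` lists {0, 1, -1}"
  proof
    fix z :: "nat \<Rightarrow> real" assume z: "z \<in> fin_states"
    then have "finite {j. z j \<noteq> 0}" by (simp add: fin_states_def)
    then obtain N where N: "\<And>j. z j \<noteq> 0 \<Longrightarrow> j < N"
      using finite_nat_set_iff_bounded[of "{j. z j \<noteq> 0}"] by auto
    then have "z = ?f (map z [0..<N])" by (auto simp: fun_eq_iff)
    moreover have "map z [0..<N] \<in> lists {0, 1, -1}"
      using z by (auto simp: fin_states_def)
    ultimately show "z \<in> ?f ` lists {0, 1, -1}" by blast
  qed
  show "countable (?f ` lists {0, 1, -1})" by (intro countable_image countable_lists) auto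
qed

lemma countable_state_space: "countable state_space"
  unfolding state_space_def by (intro countable_image countable_fin_states)

lemma summable_ternary:
  assumes "\<And>j. \<bar>z j\<bar> \<le> c"
  shows "summable (\<lambda>j. z j / 4 ^ j :: real)"
proof (rule summable_comparison_test'[of "\<lambda>j. c * (1/4) ^ j" 0])
  show "summable (\<lambda>j. c * (1/4) ^ j :: real)" by (intro summable_mult summable_geometric) simp
  show "norm (z n / 4 ^ n) \<le> c * (1/4) ^ n" for n
    using assms[of n] by (simp add: power_divide divide_right_mono)
qed

text \<open>At the first differing digit \<open>m\<close> the two sums are at least
  \<open>1 / 4 ^ m\<close> apart, while all later digits together can compensate at most twice the
  geometric tail, that is \<open>(2/3) / 4 ^ m\<close>.\<close>

lemma ternary_unique:
  assumes z: "\<And>j. z j = 0 \<or> z j = 1 \<or> z j = (-1::real)"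
    and y: "\<And>j. y j = 0 \<or> y j = 1 \<or> y j = (-1::real)"
    and eq: "(\<Sum>j. z j / 4 ^ j) = (\<Sum>j. y j / 4 ^ j)"
  shows "z = y"
proof (rule ccontr)
  assume "z \<noteq> y"
  then have ex: "\<exists>j. z j \<noteq> y j" by auto
  define d where "d j = z j - y j" for j
  define m where "m = (LEAST j. z j \<noteq> y j)"
  have m: "d m \<noteq> 0" using LeastI_ex[OF ex] by (simp add: d_def m_def)
  have below: "d j = 0" if "j < m" for j using not_less_Least[of j "\<lambda>j. z j \<noteq> y j"] that by (auto simp: d_def m_def)
  have dle: "\<bar>d j\<bar> \<le> 2" for j using z[of j] y[of j] by (auto simp: d_def)
  have dm: "\<bar>d m\<bar> \<ge> 1" using z[of m] y[of m] m by (auto simp: d_def)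
  have sz: "summable (\<lambda>j. z j / 4 ^ j)" "summable (\<lambda>j. y j / 4 ^ j)" "summable (\<lambda>j. d j / 4 ^ j)"
    using z y dle by (auto intro!: summable_ternary[of _ 2]) (metis abs_0 abs_1 abs_minus abs_numeral one_le_numeral zero_le_numeral)+
  have "0 = (\<Sum>j. d j / 4 ^ j)"
    using eq suminf_diff[OF sz(1,2)] by (simp add: d_def diff_divide_distrib)
  also have "\<dots> = (\<Sum>j. d (j + Suc m) / 4 ^ (j + Suc m)) + (\<Sum>j<Suc m. d j / 4 ^ j)"
    by (rule suminf_split_initial_segment[OF sz(3)])
  also have "(\<Sum>j<Suc m. d j / 4 ^ j) = d m / 4 ^ m" using below by simp
  finally have "\<bar>d m / 4 ^ m\<bar> = \<bar>\<Sum>j. d (j + Suc m) / 4 ^ (j + Suc m)\<bar>" by linarith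
  also have "\<dots> \<le> (\<Sum>j. 2 * (1/4) ^ Suc m * (1/4) ^ j)"
  proof (rule order_trans[OF summable_rabs[THEN order_trans[OF _ order_refl]] suminf_le])
    have b: "\<bar>d (j + Suc m) / 4 ^ (j + Suc m)\<bar> \<le> 2 * (1/4) ^ Suc m * (1/4) ^ j" for j
      using dle[of "j + Suc m"] by (simp add: power_add power_divide field_simps)
    show "summable (\<lambda>j. 2 * (1/4) ^ Suc m * (1/4) ^ j :: real)"
      by (intro summable_mult summable_geometric) simp
    then show "summable (\<lambda>j. \<bar>d (j + Suc m) / 4 ^ (j + Suc m)\<bar>)"
      by (rule summable_comparison_test'[of _ 0]) (use b in simp)
    then show "summable (\<lambda>j. \<bar>d (j + Suc m) / 4 ^ (j + Suc m)\<bar>)" .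
    show "\<bar>d (n + Suc m) / 4 ^ (n + Suc m)\<bar> \<le> 2 * (1/4) ^ Suc m * (1/4) ^ n" for n by (rule b)
  qed
  also have "\<dots> = (2/3) / 4 ^ m"
    by (subst suminf_mult) (simp_all add: summable_geometric suminf_geometric power_divide field_simps)
  finally have "\<bar>d m\<bar> * 3 * 4 ^ m \<le> 2 * 4 ^ m" by (simp add: abs_divide field_simps)
  then have "\<bar>d m\<bar> \<le> 2/3" by simp
  with dm show False by simp
qed

lemma inj_on_code: "inj_on code fin_states"
  by (rule inj_onI) (auto simp: fin_states_def code_def intro!: ternary_unique)

lemma abs_code_le:
  assumes z: "\<And>j. \<bar>z j\<bar> \<le> 1"
  shows "\<bar>code z\<bar> \<le> 2"
proof -
  have s: "summable (\<lambda>j. (1/4) ^ j :: real)" by (rule summable_geometric) simp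
  have b: "\<bar>z j / 4 ^ j\<bar> \<le> (1/4) ^ j" for j
    using z[of j] by (simp add: power_divide divide_right_mono)
  have s': "summable (\<lambda>j. \<bar>z j / 4 ^ j\<bar>)"
    by (rule summable_comparison_test'[OF s, of 0]) (use b in simp)
  have "\<bar>\<Sum>j. z j / 4 ^ j\<bar> \<le> (\<Sum>j. \<bar>z j / 4 ^ j\<bar>)" by (rule summable_rabs[OF s'])
  also have "\<dots> \<le> (\<Sum>j. (1/4) ^ j :: real)" by (rule suminf_le[OF b s' s])
  also have "\<dots> \<le> 2" by (simp add: suminf_geometric)
  finally show ?thesis by (simp add: code_def)
qed

context hold_resample
begin

lemma summable_p: "summable p"
proof (rule summable_comparison_test'[of "\<lambda>j. (1/4) * (1/4) ^ j" 0])
  show "summable (\<lambda>j. (1/4) * (1/4) ^ j :: real)" by (intro summable_mult summable_geometric) simp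
  show "norm (p n) \<le> (1/4) * (1/4) ^ n" for n
    using p_le[of n] p_pos[of n] by (simp add: power_divide)
qed

lemma suminf_p_le: "suminf p \<le> 1 / 3"
proof -
  have "suminf p \<le> (\<Sum>j. (1/4) * (1/4) ^ j)"
    using p_le by (intro suminf_le summable_p summable_mult summable_geometric) (simp_all add: power_divide)
  also have "\<dots> = 1 / 3" by (subst suminf_mult) (simp_all add: summable_geometric suminf_geometric)
  finally show ?thesis .
qed

lemma prob_Z: "prob {\<omega>. Z j k \<omega> \<noteq> 0} = p j"
proof -
  have "prob {\<omega>. Z j k \<omega> \<noteq> 0} = (\<integral>\<omega>. indicator {\<omega>. Z j k \<omega> \<noteq> 0} \<omega> \<partial>\<Omega>)"
    by simp
  also have "\<dots> = (\<integral>\<omega>. (if Z j k \<omega> = 0 then 0 else 1) \<partial>\<Omega>)"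
    by (rule Bochner_Integration.integral_cong) (auto simp: indicator_def)
  also have "\<dots> = p j"
    using integral_Z[of "\<lambda>x. if x = 0 then 0 else 1 :: real" j k] by (simp add: resample_mean_def mult.commute)
  finally show ?thesis .
qed

text \<open>Borel-Cantelli with the summable probabilities \<open>p j\<close>. Hence the countable
  set of finitely supported states carries the whole mass although there are infinitely many
  components.\<close>

lemma AE_finite_Z: "AE \<omega> in \<Omega>. finite {j. Z j k \<omega> \<noteq> 0}"
proof -
  have "AE \<omega> in \<Omega>. eventually (\<lambda>j. \<omega> \<in> space \<Omega> - {\<omega>. Z j k \<omega> \<noteq> 0}) sequentially"
  proof (rule borel_cantelli_AE1)
    show "{\<omega>. Z j k \<omega> \<noteq> 0} \<in> sets \<Omega>" for j
      using measurable_sets[OF measurable_Z, of "- {0}" j k] by (simp add: vimage_def)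
    show "summable (\<lambda>j. prob {\<omega>. Z j k \<omega> \<noteq> 0})" using summable_p by (simp add: prob_Z)
  qed (simp add: emeasure_eq_measure)
  then show ?thesis
    by eventually_elim (auto simp: eventually_sequentially finite_nat_set_iff_bounded_le not_le dest: leI intro: less_imp_le)
qed

definition X :: "int \<Rightarrow> (int \<Rightarrow> real) \<Rightarrow> real" where
  "X k \<omega> = code (\<lambda>j. Z j k \<omega>)"

lemma X_in_state_space: "X k \<omega> \<in> state_space"
proof (cases "finite {j. Z j k \<omega> \<noteq> 0}")
  case True
  then show ?thesis using Z_cases by (auto simp: X_def state_space_def fin_states_def)
next
  case False
  then have "X k \<omega> = code (\<lambda>_. 0)" by (simp add: X_def code_def)
  then show ?thesis using zero_in_fin_states by (auto simp: state_space_def)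
qed

lemma abs_X_le: "\<bar>X k \<omega>\<bar> \<le> 2"
  unfolding X_def by (rule abs_code_le) (rule abs_Z_le)

lemma AE_X: "AE \<omega> in \<Omega>. X k \<omega> = (\<Sum>j. Z j k \<omega> / 4 ^ j)"
  using AE_finite_Z[of k] by eventually_elim (simp add: X_def code_def)

lemma measurable_code:
  assumes [measurable]: "\<And>j. f j \<in> borel_measurable \<Omega>"
  shows "(\<lambda>\<omega>. code (\<lambda>j. f j \<omega>)) \<in> borel_measurable \<Omega>"
proof -
  \<comment> \<open>Finiteness of the support is eventual vanishing, a countable condition and
    therefore measurable.\<close>
  have "finite {j. f j \<omega> \<noteq> 0} \<longleftrightarrow> (\<exists>N. \<forall>j. N \<le> j \<longrightarrow> f j \<omega> = 0)" for \<omega>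
    by (auto simp: finite_nat_set_iff_bounded not_less) (meson not_le)+
  then show ?thesis unfolding code_def by simp
qed

lemma measurable_X [measurable]: "X k \<in> borel_measurable \<Omega>"
  unfolding X_def by (rule measurable_code) measurable

lemma measurable_X_process: "(\<lambda>\<omega> k. X (f k) \<omega>) \<in> \<Omega> \<rightarrow>\<^sub>M (\<Pi>\<^sub>M k\<in>UNIV. borel)"
  by (rule measurable_PiM_single') auto

lemma X_shift: "X k (shift m \<omega>) = X (k + m) \<omega>"
  by (simp add: X_def Z_shift)

section \<open>Stationarity and Markov step of the coded chain\<close>

lemma stationary_X: "strictly_stationary \<Omega> X"
  unfolding strictly_stationary_def real_process_def
proof (intro conjI allI)
  fix m
  have "distr \<Omega> (\<Pi>\<^sub>M k\<in>UNIV. borel) (\<lambda>\<omega> k. X k \<omega>) = distr (distr \<Omega> \<Omega> (shift m)) (\<Pi>\<^sub>M k\<in>UNIV. borel) (\<lambda>\<omega> k. X k \<omega>)"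
    by (simp add: distr_shift)
  also have "\<dots> = distr \<Omega> (\<Pi>\<^sub>M k\<in>UNIV. borel) ((\<lambda>\<omega> k. X k \<omega>) \<circ> shift m)"
    by (intro distr_distr measurable_shift measurable_X_process[of "\<lambda>k. k"])
  also have "(\<lambda>\<omega> k. X k \<omega>) \<circ> shift m = (\<lambda>\<omega> k. X (k + m) \<omega>)"
    by (simp add: fun_eq_iff X_shift)
  finally show "distr \<Omega> (\<Pi>\<^sub>M k\<in>UNIV. borel) (\<lambda>\<omega> k. X (k + m) \<omega>) = distr \<Omega> (\<Pi>\<^sub>M k\<in>UNIV. borel) (\<lambda>\<omega> k. X k \<omega>)"
    by simp
qed (simp_all add: prob_space_axioms)

lemma prob_shift:
  assumes "Measurable.pred \<Omega> P"
  shows "prob {\<omega>. P (shift m \<omega>)} = prob {\<omega>. P \<omega>}"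
proof -
  have "prob {\<omega>. P \<omega>} = measure (distr \<Omega> \<Omega> (shift m)) {\<omega>. P \<omega>}" by (simp add: distr_shift)
  also have "\<dots> = prob {\<omega>. P (shift m \<omega>)}"
    using assms by (subst measure_distr) (simp_all add: vimage_def events_Collect)
  finally show ?thesis by simp
qed

definition stat_prob :: "real \<Rightarrow> real" where "stat_prob x = prob {\<omega>. X 0 \<omega> = x}"

definition pair_prob :: "real \<Rightarrow> real \<Rightarrow> real" where
  "pair_prob x y = prob {\<omega>. X 0 \<omega> = x \<and> X 1 \<omega> = y}"

lemma prob_X_eq: "prob {\<omega>. X k \<omega> = x} = stat_prob x"
  using prob_shift[of "\<lambda>\<omega>. X 0 \<omega> = x" k] by (simp add: stat_prob_def X_shift)

lemma prob_X_pair: "prob {\<omega>. X k \<omega> = x \<and> X (k + 1) \<omega> = y} = pair_prob x y"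
  using prob_shift[of "\<lambda>\<omega>. X 0 \<omega> = x \<and> X 1 \<omega> = y" k] by (simp add: pair_prob_def X_shift add.commute)

lemma depends_on_X: "depends_on (coords UNIV {..k}) (X k)"
  unfolding X_def
proof (rule depends_onI)
  fix \<omega> \<omega>' :: "int \<Rightarrow> real" assume eq: "\<And>i. i \<in> coords UNIV {..k} \<Longrightarrow> \<omega> i = \<omega>' i"
  have "Z j k \<omega> = Z j k \<omega>'" for j
    by (rule depends_onD[OF depends_on_Z], rule eq) (auto simp: coords_def)
  then show "code (\<lambda>j. Z j k \<omega>) = code (\<lambda>j. Z j k \<omega>')" by simp
qed

text \<open>From a known state the next one is a function of the innovations at time
  \<open>k + 1\<close>, which are independent of the past event \<open>E\<close>. The product form
  avoids division by a possibly vanishing \<open>stat_prob x\<close>.\<close>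

lemma markov_step:
  assumes E[measurable]: "Measurable.pred \<Omega> E" and dep: "depends_on (coords UNIV {..k}) E"
    and EX: "\<And>\<omega>. E \<omega> \<Longrightarrow> X k \<omega> = x"
  shows "prob {\<omega>. E \<omega> \<and> X (k + 1) \<omega> = y} * stat_prob x = prob {\<omega>. E \<omega>} * pair_prob x y"
proof (cases "x \<in> state_space")
  case False
  then have "X k \<omega> \<noteq> x" for k \<omega> using X_in_state_space[of k \<omega>] by metis
  then have "E \<omega> \<longleftrightarrow> False" "X k \<omega> = x \<longleftrightarrow> False" for \<omega> k using EX[of \<omega>] by auto
  then show ?thesis by (simp add: pair_prob_def stat_prob_def)
next
  case True
  then obtain z where z: "z \<in> fin_states" "x = code z" by (auto simp: state_space_def)
  \<comment> \<open>The successor of the state coded by \<open>z\<close>, driven only by the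
    innovations at time \<open>k + 1\<close>. It agrees with \<open>X (k + 1)\<close> almost surely
    on the event, because \<open>code\<close> is injective on finitely supported states.\<close>
  define N where "N = (\<lambda>\<omega>. code (\<lambda>j. if \<xi> j (k + 1) \<omega> = 2 then z j else clip (\<xi> j (k + 1) \<omega>)))"
  have clip_m: "(\<lambda>\<omega>. if \<xi> j (k + 1) \<omega> = 2 then z j else clip (\<xi> j (k + 1) \<omega>)) \<in> borel_measurable \<Omega>" for j
    by (rule measurable_compose[OF measurable_\<xi>, of "\<lambda>u. if u = 2 then z j else clip u"]) simp
  have Nm [measurable]: "N \<in> borel_measurable \<Omega>" unfolding N_def by (rule measurable_code) (rule clip_m)
  have depN: "depends_on (coords UNIV {k + 1}) N"
    unfolding N_def
  proof (rule depends_onI)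
    fix \<omega> \<omega>' :: "int \<Rightarrow> real" assume eq: "\<And>i. i \<in> coords UNIV {k + 1} \<Longrightarrow> \<omega> i = \<omega>' i"
    have "\<xi> j (k + 1) \<omega> = \<xi> j (k + 1) \<omega>'" for j
      by (rule depends_onD[OF depends_on_\<xi>], rule eq) (auto simp: coords_def)
    then show "code (\<lambda>j. if \<xi> j (k + 1) \<omega> = 2 then z j else clip (\<xi> j (k + 1) \<omega>)) =
      code (\<lambda>j. if \<xi> j (k + 1) \<omega>' = 2 then z j else clip (\<xi> j (k + 1) \<omega>'))" by (simp only:)
  qed
  have key: "prob {\<omega>. F \<omega> \<and> X (k + 1) \<omega> = y} = prob {\<omega>. F \<omega>} * prob {\<omega>. N \<omega> = y}"
    if F[measurable]: "Measurable.pred \<Omega> F" and depF: "depends_on (coords UNIV {..k}) F" and FX: "\<And>\<omega>. F \<omega> \<Longrightarrow> X k \<omega> = x" for F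
  proof -
    have "prob {\<omega>. F \<omega> \<and> X (k + 1) \<omega> = y} = prob {\<omega>. F \<omega> \<and> N \<omega> = y}"
    proof (rule finite_measure_eq_AE)
      show "AE \<omega> in \<Omega>. (\<omega> \<in> {\<omega>. F \<omega> \<and> X (k + 1) \<omega> = y}) = (\<omega> \<in> {\<omega>. F \<omega> \<and> N \<omega> = y})"
        using AE_finite_Z[of k]
      proof eventually_elim
        fix \<omega> assume fin: "finite {j. Z j k \<omega> \<noteq> 0}"
        have "X (k + 1) \<omega> = N \<omega>" if "F \<omega>"
        proof -
          have "(\<lambda>j. Z j k \<omega>) \<in> fin_states" using fin Z_cases by (auto simp: fin_states_def)
          moreover have "code (\<lambda>j. Z j k \<omega>) = code z" using FX[OF that] z by (simp add: X_def)
          ultimately have "(\<lambda>j. Z j k \<omega>) = z" using inj_on_code z by (auto dest: inj_onD)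
          then have "Z j k \<omega> = z j" for j by (simp add: fun_eq_iff)
          then show ?thesis by (simp only: X_def N_def Z_Suc)
        qed
        then show "(\<omega> \<in> {\<omega>. F \<omega> \<and> X (k + 1) \<omega> = y}) = (\<omega> \<in> {\<omega>. F \<omega> \<and> N \<omega> = y})" by auto
      qed
    qed (rule events_Collect, measurable)+
    also have "prob {\<omega>. F \<omega> \<and> N \<omega> = y} = prob {\<omega>. F \<omega>} * prob {\<omega>. N \<omega> = y}"
    proof (rule prob_Int_coords[OF _ _ depF])
      show "depends_on (coords UNIV {k + 1}) (\<lambda>\<omega>. N \<omega> = y)"
        by (rule depends_on_compose[OF depN])
      show "coords UNIV {..k} \<inter> coords UNIV {k + 1} = {}" by (rule coords_disjoint) auto
    qed measurable
    finally show ?thesis .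
  qed
  have "prob {\<omega>. E \<omega> \<and> X (k + 1) \<omega> = y} * stat_prob x = prob {\<omega>. E \<omega>} * (prob {\<omega>. N \<omega> = y} * stat_prob x)"
    by (subst key[OF E dep EX]) simp_all
  \<comment> \<open>The factorization \<open>key\<close> is used a second time, for the bare event
    that \<open>X k\<close> equals \<open>x\<close>, which identifies the law of
    \<open>N\<close>.\<close>
  also have "prob {\<omega>. N \<omega> = y} * stat_prob x = pair_prob x y"
    using key[of "\<lambda>\<omega>. X k \<omega> = x"] depends_on_compose[OF depends_on_X[of k], of "\<lambda>u. u = x"]
    by (simp add: prob_X_eq prob_X_pair mult.commute)
  finally show ?thesis .
qed

end

section \<open>Reversibility and irreducibility\<close>

lemma restrict_eq_iff:
  assumes "f \<in> I \<rightarrow>\<^sub>E S"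
  shows "restrict u I = f \<longleftrightarrow> (\<forall>k\<in>I. u k = f k)"
proof
  assume "\<forall>k\<in>I. u k = f k"
  then show "restrict u I = f"
    by (intro extensionalityI[of _ I]) (use assms in \<open>simp_all add: PiE_iff\<close>)
qed auto

text \<open>Cylinders over finite index sets determine a law on the product space, and each finite
  index set lies in a window from \<open>- m\<close> to \<open>m\<close>. On a window there are only
  countably many paths, so the point masses of the paths suffice.\<close>

lemma distr_process_eqI:
  fixes X Y :: "int \<Rightarrow> 'a \<Rightarrow> real"
  assumes "prob_space M"
    and X[measurable]: "\<And>k. X k \<in> borel_measurable M" and Y[measurable]: "\<And>k. Y k \<in> borel_measurable M"
    and S: "countable S" "\<And>k \<omega>. \<omega> \<in> space M \<Longrightarrow> X k \<omega> \<in> S" "\<And>k \<omega>. \<omega> \<in> space M \<Longrightarrow> Y k \<omega> \<in> S"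
    and eq: "\<And>(m::nat) x. measure M {\<omega>\<in>space M. \<forall>k\<in>{- int m..int m}. X k \<omega> = x k} =
      measure M {\<omega>\<in>space M. \<forall>k\<in>{- int m..int m}. Y k \<omega> = x k}"
  shows "distr M (\<Pi>\<^sub>M k\<in>UNIV. borel) (\<lambda>\<omega> k. X k \<omega>) = distr M (\<Pi>\<^sub>M k\<in>UNIV. borel) (\<lambda>\<omega> k. Y k \<omega>)"
proof (rule measure_eqI_PiM_infinite)
  interpret prob_space M by fact
  let ?B = "\<Pi>\<^sub>M k\<in>(UNIV::int set). (borel :: real measure)"
  have meas: "(\<lambda>\<omega> k. U k \<omega>) \<in> M \<rightarrow>\<^sub>M ?B" if "\<And>k. U k \<in> borel_measurable M" for U
    by (rule measurable_PiM_single') (use that in auto)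
  show "finite_measure (distr M ?B (\<lambda>\<omega> k. X k \<omega>))"
    by (intro finite_measure_distr meas X)
  fix A :: "int \<Rightarrow> real set" and J :: "int set"
  assume J: "finite J" and A: "\<And>k. k \<in> J \<Longrightarrow> A k \<in> sets borel"
  obtain m :: nat where m: "J \<subseteq> {- int m..int m}"
  proof -
    have "k \<in> {- int (nat (\<Sum>k\<in>J. \<bar>k\<bar>))..int (nat (\<Sum>k\<in>J. \<bar>k\<bar>))}" if "k \<in> J" for k
    proof -
      have "\<bar>k\<bar> \<le> (\<Sum>k\<in>J. \<bar>k\<bar>)" by (rule member_le_sum[OF that]) (use J in auto)
      then show ?thesis by auto
    qed
    then show ?thesis using that[of "nat (\<Sum>k\<in>J. \<bar>k\<bar>)"] by blast
  qed
  let ?I = "{- int m..int m}"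
  let ?S = "?I \<rightarrow>\<^sub>E S"
  let ?E = "{f \<in> ?S. \<forall>k\<in>J. f k \<in> A k}"
  have cS: "countable ?S" by (rule countable_PiE) (use S in auto)
  have restr: "(\<lambda>\<omega>. \<lambda>k\<in>?I. U k \<omega>) \<in> M \<rightarrow>\<^sub>M count_space ?S"
    if U[measurable]: "\<And>k. U k \<in> borel_measurable M" and US: "\<And>k \<omega>. \<omega> \<in> space M \<Longrightarrow> U k \<omega> \<in> S" for U :: "int \<Rightarrow> 'a \<Rightarrow> real"
  proof (rule measurable_count_space_eq_countable[THEN iffD2, OF cS], intro conjI ballI)
    show "(\<lambda>\<omega>. \<lambda>k\<in>?I. U k \<omega>) \<in> space M \<rightarrow> ?S" using US by auto
    fix f assume f: "f \<in> ?S"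
    have "(\<lambda>\<omega>. \<lambda>k\<in>?I. U k \<omega>) -` {f} \<inter> space M = {\<omega>\<in>space M. \<forall>k\<in>?I. U k \<omega> = f k}"
      by (intro set_eqI) (simp only: vimage_eq Int_iff singleton_iff restrict_eq_iff[OF f] mem_Collect_eq conj_commute)
    also have "\<dots> \<in> sets M" by measurable
    finally show "(\<lambda>\<omega>. \<lambda>k\<in>?I. U k \<omega>) -` {f} \<inter> space M \<in> sets M" .
  qed
  have emb: "emeasure (distr M ?B (\<lambda>\<omega> k. U k \<omega>)) (prod_emb UNIV (\<lambda>k. borel) J (Pi\<^sub>E J A)) =
      emeasure (distr M (count_space ?S) (\<lambda>\<omega>. \<lambda>k\<in>?I. U k \<omega>)) ?E"
    if U: "\<And>k. U k \<in> borel_measurable M" and US: "\<And>k \<omega>. \<omega> \<in> space M \<Longrightarrow> U k \<omega> \<in> S" for U :: "int \<Rightarrow> 'a \<Rightarrow> real"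
  proof -
    have "prod_emb UNIV (\<lambda>k. borel) J (Pi\<^sub>E J A) \<in> sets ?B"
      by (rule sets_PiM_I) (use J A in auto)
    then have "emeasure (distr M ?B (\<lambda>\<omega> k. U k \<omega>)) (prod_emb UNIV (\<lambda>k. borel) J (Pi\<^sub>E J A)) =
        emeasure M ((\<lambda>\<omega> k. U k \<omega>) -` prod_emb UNIV (\<lambda>k. borel) J (Pi\<^sub>E J A) \<inter> space M)"
      by (rule emeasure_distr[OF meas[OF U]])
    also have "(\<lambda>\<omega> k. U k \<omega>) -` prod_emb UNIV (\<lambda>k. borel) J (Pi\<^sub>E J A) \<inter> space M =
        (\<lambda>\<omega>. \<lambda>k\<in>?I. U k \<omega>) -` ?E \<inter> space M"
    proof (intro set_eqI)
      fix \<omega>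
      have 1: "\<omega> \<in> space M \<Longrightarrow> (\<lambda>k\<in>?I. U k \<omega>) \<in> ?S" using US by simp
      have 2: "(\<forall>k\<in>J. U k \<omega> \<in> A k) \<longleftrightarrow> (\<forall>k\<in>J. (\<lambda>k\<in>?I. U k \<omega>) k \<in> A k)"
        by (rule ball_cong) (use m in auto)
      have 3: "(\<lambda>k. U k \<omega>) \<in> prod_emb UNIV (\<lambda>k. borel) J (Pi\<^sub>E J A) \<longleftrightarrow> (\<forall>k\<in>J. U k \<omega> \<in> A k)"
        by (auto simp: prod_emb_def space_PiM)
      show "\<omega> \<in> (\<lambda>\<omega> k. U k \<omega>) -` prod_emb UNIV (\<lambda>k. borel) J (Pi\<^sub>E J A) \<inter> space M \<longleftrightarrow>
          \<omega> \<in> (\<lambda>\<omega>. \<lambda>k\<in>?I. U k \<omega>) -` ?E \<inter> space M"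
        unfolding vimage_eq Int_iff 3 2 mem_Collect_eq using 1 by blast
    qed
    also have "emeasure M \<dots> = emeasure (distr M (count_space ?S) (\<lambda>\<omega>. \<lambda>k\<in>?I. U k \<omega>)) ?E"
      by (rule emeasure_distr[OF restr[OF U US], symmetric]) auto
    finally show ?thesis .
  qed
  have "distr M (count_space ?S) (\<lambda>\<omega>. \<lambda>k\<in>?I. X k \<omega>) = distr M (count_space ?S) (\<lambda>\<omega>. \<lambda>k\<in>?I. Y k \<omega>)"
  proof (rule measure_eqI_countable[of _ ?S])
    fix f assume f: "f \<in> ?S"
    have "emeasure (distr M (count_space ?S) (\<lambda>\<omega>. \<lambda>k\<in>?I. U k \<omega>)) {f} = ennreal (measure M {\<omega>\<in>space M. \<forall>k\<in>?I. U k \<omega> = f k})"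
      if U: "\<And>k. U k \<in> borel_measurable M" and US: "\<And>k \<omega>. \<omega> \<in> space M \<Longrightarrow> U k \<omega> \<in> S" for U :: "int \<Rightarrow> 'a \<Rightarrow> real"
    proof -
      have "(\<lambda>\<omega>. \<lambda>k\<in>?I. U k \<omega>) -` {f} \<inter> space M = {\<omega>\<in>space M. \<forall>k\<in>?I. U k \<omega> = f k}"
        by (intro set_eqI) (simp only: vimage_eq Int_iff singleton_iff restrict_eq_iff[OF f] mem_Collect_eq conj_commute)
      then show ?thesis using f by (simp add: emeasure_distr[OF restr[OF U US]] emeasure_eq_measure)
    qed
    from this[OF X S(2)] this[OF Y S(3)] eq[of m f]
    show "emeasure (distr M (count_space ?S) (\<lambda>\<omega>. \<lambda>k\<in>?I. X k \<omega>)) {f} =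
      emeasure (distr M (count_space ?S) (\<lambda>\<omega>. \<lambda>k\<in>?I. Y k \<omega>)) {f}" by simp
  qed (use cS in auto)
  then show "emeasure (distr M ?B (\<lambda>\<omega> k. X k \<omega>)) (prod_emb UNIV (\<lambda>k. borel) J (Pi\<^sub>E J A)) =
      emeasure (distr M ?B (\<lambda>\<omega> k. Y k \<omega>)) (prod_emb UNIV (\<lambda>k. borel) J (Pi\<^sub>E J A))"
    by (simp add: emb[OF X S(2)] emb[OF Y S(3)])
qed simp_all

context hold_resample
begin

section \<open>Detailed balance and positivity of the one-step law\<close>

definition Z_pair :: "nat \<Rightarrow> real \<Rightarrow> real \<Rightarrow> real" where
  "Z_pair j a b = prob {\<omega>. Z j 0 \<omega> = a \<and> Z j 1 \<omega> = b}"

text \<open>The transition identity applied to the indicator of the starting value. The right side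
  is visibly symmetric in \<open>a\<close> and \<open>b\<close>, which is the reversibility of a
  single component.\<close>

lemma Z_pair_eq:
  "Z_pair j a b = (1 - \<theta> j) * (if a = b then resample_mean j (\<lambda>x. if x = a then 1 else 0) else 0)
     + \<theta> j * (resample_mean j (\<lambda>x. if x = a then 1 else 0) * resample_mean j (\<lambda>x. if x = b then 1 else (0::real)))"
proof -
  let ?i = "\<lambda>a x::real. if x = a then 1 else (0::real)"
  have "Z_pair j a b = (\<integral>\<omega>. indicator {\<omega>. Z j 0 \<omega> = a \<and> Z j 1 \<omega> = b} \<omega> \<partial>\<Omega>)"
    by (simp add: Z_pair_def)
  also have "\<dots> = (\<integral>\<omega>. ?i a (Z j 0 \<omega>) * ?i b (Z j (0 + 1) \<omega>) \<partial>\<Omega>)"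
    by (rule Bochner_Integration.integral_cong) (auto simp: indicator_def)
  also have "\<dots> = (1 - \<theta> j) *\<^sub>R (\<integral>\<omega>. ?i a (Z j 0 \<omega>) * ?i b (Z j 0 \<omega>) \<partial>\<Omega>)
      + \<theta> j *\<^sub>R ((\<integral>\<omega>. ?i a (Z j 0 \<omega>) \<partial>\<Omega>) * resample_mean j (?i b))"
  proof (rule one_step)
    show "integrable \<Omega> (\<lambda>\<omega>. ?i a (Z j 0 \<omega>))"
      using integrable_mult_Z[of "\<lambda>_. 1::real" "?i a" j 0] by simp
    show "depends_on (coords UNIV {..0}) (\<lambda>\<omega>. ?i a (Z j 0 \<omega>))"
      by (rule depends_on_compose, rule depends_on_mono[OF depends_on_Z]) (auto simp: coords_def)
  qed
  also have "(\<integral>\<omega>. ?i a (Z j 0 \<omega>) * ?i b (Z j 0 \<omega>) \<partial>\<Omega>) = (\<integral>\<omega>. (\<lambda>x. if a = b then ?i a x else 0) (Z j 0 \<omega>) \<partial>\<Omega>)"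
    by (rule Bochner_Integration.integral_cong) auto
  also have "\<dots> = (if a = b then resample_mean j (?i a) else 0)"
    by (subst integral_Z) (simp add: resample_mean_def)
  also have "(\<integral>\<omega>. ?i a (Z j 0 \<omega>) \<partial>\<Omega>) = resample_mean j (?i a)" by (rule integral_Z)
  finally show ?thesis by simp
qed

lemma Z_pair_sym: "Z_pair j a b = Z_pair j b a"
  by (simp add: Z_pair_eq)

lemma resample_mean_pos:
  assumes "a = 0 \<or> a = 1 \<or> a = -1"
  shows "resample_mean j (\<lambda>x. if x = a then 1 else 0 :: real) > 0"
  using assms p_pos[of j] p_le_quarter[of j] by (auto simp: resample_mean_def)

lemma Z_pair_pos:
  assumes "a = 0 \<or> a = 1 \<or> a = -1" "b = 0 \<or> b = 1 \<or> b = -1"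
  shows "Z_pair j a b > 0"
  unfolding Z_pair_eq
  using resample_mean_pos[OF assms(1), of j] resample_mean_pos[OF assms(2), of j] \<theta>_pos[of j] \<theta>_less[of j]
  by (intro add_nonneg_pos mult_nonneg_nonneg mult_pos_pos) auto

lemma depends_on_Z_pair: "depends_on (coords {j} {..1}) (\<lambda>\<omega>. Z j 0 \<omega> = a \<and> Z j 1 \<omega> = b)"
proof (rule depends_on_compose2[of _ "Z j 0" "Z j 1" "\<lambda>u v. u = a \<and> v = b"])
  show "depends_on (coords {j} {..1}) (Z j 0)"
    by (rule depends_on_mono[OF depends_on_Z]) (auto simp: coords_def)
qed (rule depends_on_Z)

lemma depends_on_Ball:
  fixes P :: "'j \<Rightarrow> (int \<Rightarrow> real) \<Rightarrow> bool"
  assumes "\<And>j. j \<in> J \<Longrightarrow> depends_on (B j) (P j)" "\<And>j. j \<in> J \<Longrightarrow> B j \<subseteq> A"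
  shows "depends_on A (\<lambda>\<omega>. \<forall>j\<in>J. P j \<omega>)"
proof (rule depends_onI)
  fix \<omega> \<omega>' :: "int \<Rightarrow> real" assume eq: "\<And>i. i \<in> A \<Longrightarrow> \<omega> i = \<omega>' i"
  have "P j \<omega> = P j \<omega>'" if "j \<in> J" for j
    by (rule depends_onD[OF assms(1)[OF that]], rule eq) (use assms(2)[OF that] in blast)
  then show "(\<forall>j\<in>J. P j \<omega>) = (\<forall>j\<in>J. P j \<omega>')" by auto
qed

lemma prob_Z_pairs_finite:
  "prob {\<omega>. \<forall>j\<in>{..<n}. Z j 0 \<omega> = z j \<and> Z j 1 \<omega> = z' j} = (\<Prod>j<n. Z_pair j (z j) (z' j))"
proof (induction n)
  case (Suc n)
  have "prob {\<omega>. \<forall>j\<in>{..<Suc n}. Z j 0 \<omega> = z j \<and> Z j 1 \<omega> = z' j} =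
    prob {\<omega>. (\<forall>j\<in>{..<n}. Z j 0 \<omega> = z j \<and> Z j 1 \<omega> = z' j) \<and> (Z n 0 \<omega> = z n \<and> Z n 1 \<omega> = z' n)}"
    by (rule arg_cong[of _ _ prob]) (auto simp: less_Suc_eq)
  also have "\<dots> = prob {\<omega>. \<forall>j\<in>{..<n}. Z j 0 \<omega> = z j \<and> Z j 1 \<omega> = z' j} * prob {\<omega>. Z n 0 \<omega> = z n \<and> Z n 1 \<omega> = z' n}"
  proof (rule prob_Int_coords)
    show "depends_on (coords {..<n} {..1}) (\<lambda>\<omega>. \<forall>j\<in>{..<n}. Z j 0 \<omega> = z j \<and> Z j 1 \<omega> = z' j)"
      by (rule depends_on_Ball[OF depends_on_Z_pair]) (auto simp: coords_def)
    show "depends_on (coords {n} {..1}) (\<lambda>\<omega>. Z n 0 \<omega> = z n \<and> Z n 1 \<omega> = z' n)" by (rule depends_on_Z_pair)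
    show "coords {..<n} {..1} \<inter> coords {n} {..1} = {}" by (rule coords_disjoint) auto
  qed measurable
  finally show ?case using Suc by (simp add: Z_pair_def)
qed simp

text \<open>Almost surely both states have finite support, where \<open>code\<close> is injective;
  equality of the coded values then means equality of all digits.\<close>

lemma pair_prob_code:
  assumes "z \<in> fin_states" "z' \<in> fin_states"
  shows "pair_prob (code z) (code z') = prob {\<omega>. \<forall>j. Z j 0 \<omega> = z j \<and> Z j 1 \<omega> = z' j}"
  unfolding pair_prob_def
proof (rule finite_measure_eq_AE)
  show "AE \<omega> in \<Omega>. (\<omega> \<in> {\<omega>. X 0 \<omega> = code z \<and> X 1 \<omega> = code z'}) = (\<omega> \<in> {\<omega>. \<forall>j. Z j 0 \<omega> = z j \<and> Z j 1 \<omega> = z' j})"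
    using AE_finite_Z[of 0] AE_finite_Z[of 1]
  proof eventually_elim
    fix \<omega> assume "finite {j. Z j 0 \<omega> \<noteq> 0}" "finite {j. Z j 1 \<omega> \<noteq> 0}"
    then have "(\<lambda>j. Z j 0 \<omega>) \<in> fin_states" "(\<lambda>j. Z j 1 \<omega>) \<in> fin_states" using Z_cases by (auto simp: fin_states_def)
    then have "X 0 \<omega> = code z \<longleftrightarrow> (\<lambda>j. Z j 0 \<omega>) = z" "X 1 \<omega> = code z' \<longleftrightarrow> (\<lambda>j. Z j 1 \<omega>) = z'"
      using inj_on_code assms by (auto simp: X_def inj_on_eq_iff)
    then show "(\<omega> \<in> {\<omega>. X 0 \<omega> = code z \<and> X 1 \<omega> = code z'}) = (\<omega> \<in> {\<omega>. \<forall>j. Z j 0 \<omega> = z j \<and> Z j 1 \<omega> = z' j})"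
      by (auto simp: fun_eq_iff)
  qed
qed (rule events_Collect, measurable)+

lemma prob_Z_pairs_limit:
  "(\<lambda>n. \<Prod>j<n. Z_pair j (z j) (z' j)) \<longlonglongrightarrow> prob {\<omega>. \<forall>j. Z j 0 \<omega> = z j \<and> Z j 1 \<omega> = z' j}"
proof -
  let ?A = "\<lambda>n. {\<omega>. \<forall>j\<in>{..<n}. Z j 0 \<omega> = z j \<and> Z j 1 \<omega> = z' j}"
  have "(\<lambda>n. prob (?A n)) \<longlonglongrightarrow> prob (\<Inter>n. ?A n)"
  proof (rule finite_Lim_measure_decseq)
    show "range ?A \<subseteq> events" by (auto intro!: events_Collect)
    show "decseq ?A" by (auto simp: decseq_def)
  qed
  also have "(\<Inter>n. ?A n) = {\<omega>. \<forall>j. Z j 0 \<omega> = z j \<and> Z j 1 \<omega> = z' j}" by blast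
  finally show ?thesis by (simp only: prob_Z_pairs_finite)
qed

text \<open>Detailed balance. By independence and continuity from above, the probability of a pair
  of states is the limit of finite products of \<open>Z_pair\<close>, and each factor is symmetric.
  Values outside the state space are never taken.\<close>

lemma pair_prob_sym: "pair_prob x y = pair_prob y x"
proof (cases "x \<in> state_space \<and> y \<in> state_space")
  case True
  then obtain z z' where z: "z \<in> fin_states" "z' \<in> fin_states" "x = code z" "y = code z'"
    by (auto simp: state_space_def)
  have "prob {\<omega>. \<forall>j. Z j 0 \<omega> = z j \<and> Z j 1 \<omega> = z' j} = prob {\<omega>. \<forall>j. Z j 0 \<omega> = z' j \<and> Z j 1 \<omega> = z j}"
    using prob_Z_pairs_limit[of z z'] prob_Z_pairs_limit[of z' z] by (simp add: Z_pair_sym LIMSEQ_unique)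
  then show ?thesis by (simp add: z pair_prob_code)
next
  case False
  then have "\<not> (X 0 \<omega> = x \<and> X 1 \<omega> = y)" "\<not> (X 0 \<omega> = y \<and> X 1 \<omega> = x)" for \<omega>
    using X_in_state_space by metis+
  then have "{\<omega>. X 0 \<omega> = x \<and> X 1 \<omega> = y} = {}" "{\<omega>. X 0 \<omega> = y \<and> X 1 \<omega> = x} = {}"
    by blast+
  then show ?thesis by (simp only: pair_prob_def)
qed

text \<open>A union bound over all components at the times \<open>0\<close> and \<open>1\<close>
  costs at most \<open>2 * suminf p\<close>, hence at most \<open>2 / 3\<close>.\<close>

lemma prob_Z_tail_pos: "prob {\<omega>. \<forall>j\<in>{n..}. Z j 0 \<omega> = 0 \<and> Z j 1 \<omega> = 0} > 0"
proof -
  let ?B = "\<lambda>j. {\<omega>. Z j 0 \<omega> \<noteq> 0} \<union> {\<omega>. Z j 1 \<omega> \<noteq> 0}"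
  have Bj: "prob (?B j) \<le> 2 * p j" for j
    using measure_Un_le[of "{\<omega>. Z j 0 \<omega> \<noteq> 0}" \<Omega> "{\<omega>. Z j 1 \<omega> \<noteq> 0}"]
    by (simp add: prob_Z events_Collect)
  have sum2: "summable (\<lambda>j. 2 * p j)" by (intro summable_mult summable_p)
  have sumB: "summable (\<lambda>j. prob (?B j))"
    by (rule summable_comparison_test'[OF sum2, of 0]) (use Bj in simp)
  have ev: "?B j \<in> events" for j by (intro sets.Un events_Collect) measurable
  have "prob (\<Union>j. ?B j) \<le> (\<Sum>j. prob (?B j))"
    by (rule finite_measure_subadditive_countably) (use ev sumB in auto)
  also have "\<dots> \<le> (\<Sum>j. 2 * p j)" by (rule suminf_le[OF Bj sumB sum2])
  also have "\<dots> \<le> 2 / 3" using suminf_mult[OF summable_p, of 2] suminf_p_le by simp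
  finally have "prob (\<Union>j. ?B j) \<le> 2 / 3" .
  then have "prob (UNIV - (\<Union>j. ?B j)) \<ge> 1 / 3"
    using prob_compl[of "\<Union>j. ?B j"] ev by (simp add: sets.countable_UN)
  moreover have "prob (UNIV - (\<Union>j. ?B j)) \<le> prob {\<omega>. \<forall>j\<in>{n..}. Z j 0 \<omega> = 0 \<and> Z j 1 \<omega> = 0}"
    by (rule finite_measure_mono) (auto intro!: events_Collect)
  ultimately show ?thesis by linarith
qed

text \<open>Beyond some \<open>n\<close> both states have only zero digits: the finitely many other
  digits give a product of positive factors and the independent tail is positive. Since every
  transition is possible in one step, irreducibility and aperiodicity follow together.\<close>

lemma pair_prob_pos:
  assumes "x \<in> state_space" "y \<in> state_space"
  shows "pair_prob x y > 0"
proof -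
  obtain z z' where z: "z \<in> fin_states" "z' \<in> fin_states" "x = code z" "y = code z'"
    using assms by (auto simp: state_space_def)
  have "finite ({j. z j \<noteq> 0} \<union> {j. z' j \<noteq> 0})" using z by (simp add: fin_states_def)
  then obtain n where "\<forall>j\<in>{j. z j \<noteq> 0} \<union> {j. z' j \<noteq> 0}. j < n"
    using finite_nat_set_iff_bounded by blast
  then have n: "z j = 0" "z' j = 0" if "n \<le> j" for j using that by (auto simp: not_less[symmetric])
  have "pair_prob x y = prob {\<omega>. \<forall>j. Z j 0 \<omega> = z j \<and> Z j 1 \<omega> = z' j}" by (simp add: z pair_prob_code)
  also have "\<dots> = prob {\<omega>. (\<forall>j\<in>{..<n}. Z j 0 \<omega> = z j \<and> Z j 1 \<omega> = z' j) \<and> (\<forall>j\<in>{n..}. Z j 0 \<omega> = 0 \<and> Z j 1 \<omega> = 0)}"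
  proof (rule arg_cong[of _ _ prob], rule Collect_cong)
    fix \<omega>
    have "(\<forall>j. Z j 0 \<omega> = z j \<and> Z j 1 \<omega> = z' j) \<longleftrightarrow>
        (\<forall>j\<in>{..<n}. Z j 0 \<omega> = z j \<and> Z j 1 \<omega> = z' j) \<and> (\<forall>j\<in>{n..}. Z j 0 \<omega> = z j \<and> Z j 1 \<omega> = z' j)"
      by (metis atLeast_iff lessThan_iff not_le)
    then show "(\<forall>j. Z j 0 \<omega> = z j \<and> Z j 1 \<omega> = z' j) \<longleftrightarrow>
        (\<forall>j\<in>{..<n}. Z j 0 \<omega> = z j \<and> Z j 1 \<omega> = z' j) \<and> (\<forall>j\<in>{n..}. Z j 0 \<omega> = 0 \<and> Z j 1 \<omega> = 0)"
      using n by simp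
  qed
  also have "\<dots> = prob {\<omega>. \<forall>j\<in>{..<n}. Z j 0 \<omega> = z j \<and> Z j 1 \<omega> = z' j} * prob {\<omega>. \<forall>j\<in>{n..}. Z j 0 \<omega> = 0 \<and> Z j 1 \<omega> = 0}"
  proof (rule prob_Int_coords)
    show "depends_on (coords {..<n} {..1}) (\<lambda>\<omega>. \<forall>j\<in>{..<n}. Z j 0 \<omega> = z j \<and> Z j 1 \<omega> = z' j)"
      by (rule depends_on_Ball[OF depends_on_Z_pair]) (auto simp: coords_def)
    show "depends_on (coords {n..} {..1}) (\<lambda>\<omega>. \<forall>j\<in>{n..}. Z j 0 \<omega> = 0 \<and> Z j 1 \<omega> = 0)"
      by (rule depends_on_Ball[OF depends_on_Z_pair]) (auto simp: coords_def)
    show "coords {..<n} {..1} \<inter> coords {n..} {..1} = {}" by (rule coords_disjoint) auto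
  qed measurable
  also have "\<dots> > 0"
    unfolding prob_Z_pairs_finite
    using z by (intro mult_pos_pos prod_pos prob_Z_tail_pos) (auto simp: fin_states_def intro!: Z_pair_pos)
  finally show ?thesis .
qed

lemma pair_prob_le: "pair_prob x y \<le> stat_prob x"
  unfolding pair_prob_def stat_prob_def by (rule finite_measure_mono) (auto intro!: events_Collect)

lemma stat_prob_pos: "x \<in> state_space \<Longrightarrow> stat_prob x > 0"
  using pair_prob_pos[of x x] pair_prob_le[of x x] by linarith

lemma cond_prob_next:
  assumes E[measurable]: "Measurable.pred \<Omega> E" and dep: "depends_on (coords UNIV {..k}) E"
    and EX: "\<And>\<omega>. E \<omega> \<Longrightarrow> X k \<omega> = x" and pos: "prob {\<omega>. E \<omega>} > 0"
  shows "cond_prob \<Omega> (\<lambda>\<omega>. X (k + 1) \<omega> = y) E = pair_prob x y / stat_prob x"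
proof -
  have "prob {\<omega>. E \<omega>} \<le> stat_prob x"
    unfolding prob_X_eq[of k, symmetric] by (rule finite_measure_mono) (auto intro!: events_Collect EX)
  with pos have "stat_prob x > 0" by linarith
  then show ?thesis
    using markov_step[OF E dep EX, of y] pos
    by (simp add: cond_prob_def conj_commute field_simps)
qed

section \<open>Markov property, irreducibility and aperiodicity\<close>

lemma markov_X: "markov_property \<Omega> X"
  unfolding markov_property_def
proof (intro allI impI)
  fix k :: int and m :: nat and x :: "nat \<Rightarrow> real" and y :: real
  assume "prob {\<omega> \<in> space \<Omega>. \<forall>i\<le>m. X (k - int i) \<omega> = x i} > 0"
  then have pos: "prob {\<omega>. \<forall>i\<in>{..m}. X (k - int i) \<omega> = x i} > 0" by (simp add: Ball_def)
  let ?E = "\<lambda>\<omega>. \<forall>i\<in>{..m}. X (k - int i) \<omega> = x i"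
  have dep: "depends_on (coords UNIV {..k}) ?E"
    by (rule depends_on_Ball[of _ "\<lambda>i. coords UNIV {..k - int i}"], rule depends_on_compose[OF depends_on_X])
       (auto simp: coords_def)
  have EX: "X k \<omega> = x 0" if "?E \<omega>" for \<omega> using bspec[OF that, of 0] by simp
  have "prob {\<omega>. ?E \<omega>} \<le> prob {\<omega>. X k \<omega> = x 0}"
    by (rule finite_measure_mono) (use EX in \<open>auto intro!: events_Collect\<close>)
  with pos have pos': "prob {\<omega>. X k \<omega> = x 0} > 0" by linarith
  have "cond_prob \<Omega> (\<lambda>\<omega>. X (k + 1) \<omega> = y) ?E = pair_prob (x 0) y / stat_prob (x 0)"
    by (rule cond_prob_next[OF _ dep EX pos]) measurable
  also have "\<dots> = cond_prob \<Omega> (\<lambda>\<omega>. X (k + 1) \<omega> = y) (\<lambda>\<omega>. X k \<omega> = x 0)"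
    by (rule cond_prob_next[symmetric, OF _ depends_on_compose[OF depends_on_X] _ pos']) simp_all
  finally show "cond_prob \<Omega> (\<lambda>\<omega>. X (k + 1) \<omega> = y) (\<lambda>\<omega>. \<forall>i\<le>m. X (k - int i) \<omega> = x i) =
    cond_prob \<Omega> (\<lambda>\<omega>. X (k + 1) \<omega> = y) (\<lambda>\<omega>. X k \<omega> = x 0)" by (simp add: Ball_def)
qed

lemma markov_chain_X: "stationary_markov_chain \<Omega> X state_space"
  unfolding stationary_markov_chain_def
  using stationary_X markov_X countable_state_space X_in_state_space stat_prob_pos by (simp add: stat_prob_def)

lemma trans_prob_pos: "i \<in> state_space \<Longrightarrow> j \<in> state_space \<Longrightarrow> trans_prob \<Omega> X 1 i j > 0"
  using pair_prob_pos[of i j] stat_prob_pos[of i]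
  by (simp add: trans_prob_def cond_prob_def pair_prob_def stat_prob_def conj_commute)

lemma irreducible_X: "irreducible_chain \<Omega> X state_space"
  unfolding irreducible_chain_def using trans_prob_pos by blast

lemma aperiodic_X: "aperiodic_chain \<Omega> X state_space"
  unfolding aperiodic_chain_def
proof
  fix i assume "i \<in> state_space"
  then have "1 \<in> {n::nat. n \<ge> 1 \<and> trans_prob \<Omega> X n i i > 0}" using trans_prob_pos by simp
  then have "Gcd {n::nat. n \<ge> 1 \<and> trans_prob \<Omega> X n i i > 0} dvd 1" by (rule Gcd_dvd)
  then show "Gcd {n::nat. n \<ge> 1 \<and> trans_prob \<Omega> X n i i > 0} = 1" by simp
qed

section \<open>Path probabilities and time reversal\<close>

definition step_prob :: "real \<Rightarrow> real \<Rightarrow> real" where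
  "step_prob x y = pair_prob x y / stat_prob x"

text \<open>When \<open>stat_prob x\<close> is zero the quotient has the default value zero, but
  then \<open>pair_prob x y\<close> vanishes too, so the identity survives.\<close>

lemma stat_step: "stat_prob x * step_prob x y = pair_prob x y"
  using pair_prob_le[of x y] measure_nonneg[of \<Omega>, folded pair_prob_def]
  by (cases "stat_prob x = 0") (auto simp: step_prob_def pair_prob_def intro: antisym)

lemma prob_path:
  "prob {\<omega>. \<forall>i\<in>{..m}. X (k + int i) \<omega> = x i} = stat_prob (x 0) * (\<Prod>i<m. step_prob (x i) (x (Suc i)))"
proof (induction m)
  case 0
  then show ?case by (simp add: prob_X_eq)
next
  case (Suc m)
  let ?E = "\<lambda>\<omega>. \<forall>i\<in>{..m}. X (k + int i) \<omega> = x i"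
  have dep: "depends_on (coords UNIV {..k + int m}) ?E"
    by (rule depends_on_Ball[of _ "\<lambda>i. coords UNIV {..k + int i}"], rule depends_on_compose[OF depends_on_X])
       (auto simp: coords_def)
  have E: "Measurable.pred \<Omega> ?E" by measurable
  have eq: "prob {\<omega>. \<forall>i\<in>{..Suc m}. X (k + int i) \<omega> = x i} = prob {\<omega>. ?E \<omega> \<and> X (k + int m + 1) \<omega> = x (Suc m)}"
    by (rule arg_cong[of _ _ prob]) (auto simp: atMost_Suc algebra_simps)
  have ms: "prob {\<omega>. ?E \<omega> \<and> X (k + int m + 1) \<omega> = x (Suc m)} * stat_prob (x m) = prob {\<omega>. ?E \<omega>} * pair_prob (x m) (x (Suc m))"
    by (rule markov_step[OF E dep]) auto
  have "prob {\<omega>. ?E \<omega> \<and> X (k + int m + 1) \<omega> = x (Suc m)} \<le> prob {\<omega>. ?E \<omega>}"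
    by (rule finite_measure_mono) (auto intro!: events_Collect)
  moreover have "prob {\<omega>. ?E \<omega>} \<le> stat_prob (x m)"
    unfolding prob_X_eq[of "k + int m", symmetric] by (rule finite_measure_mono) (auto intro!: events_Collect)
  \<comment> \<open>If \<open>stat_prob (x m)\<close> vanishes, the two preceding bounds force both
    sides to be zero; otherwise \<open>ms\<close> can be divided by it.\<close>
  ultimately have "prob {\<omega>. ?E \<omega> \<and> X (k + int m + 1) \<omega> = x (Suc m)} = prob {\<omega>. ?E \<omega>} * step_prob (x m) (x (Suc m))"
    using ms measure_nonneg[of \<Omega> "{\<omega>. ?E \<omega>}"] measure_nonneg[of \<Omega> "{\<omega>. ?E \<omega> \<and> X (k + int m + 1) \<omega> = x (Suc m)}"]
    by (cases "stat_prob (x m) = 0") (simp_all add: step_prob_def field_simps del: measure_nonneg measure_le_0_iff)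
  then show ?case using Suc eq by simp
qed

text \<open>Detailed balance moves the stationary factor across one transition at a time, from the
  left end of the path to the right end, reversing each transition it passes.\<close>

lemma path_weight_reverse:
  "stat_prob (x 0) * (\<Prod>i<m. step_prob (x i) (x (Suc i))) = stat_prob (x m) * (\<Prod>i<m. step_prob (x (Suc i)) (x i))"
proof (induction m)
  case (Suc m)
  have "stat_prob (x 0) * (\<Prod>i<Suc m. step_prob (x i) (x (Suc i))) =
      (stat_prob (x m) * (\<Prod>i<m. step_prob (x (Suc i)) (x i))) * step_prob (x m) (x (Suc m))"
    using Suc by (simp add: mult.assoc[symmetric])
  also have "\<dots> = pair_prob (x m) (x (Suc m)) * (\<Prod>i<m. step_prob (x (Suc i)) (x i))"
    using stat_step[of "x m" "x (Suc m)"] by (simp add: mult_ac)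
  also have "\<dots> = stat_prob (x (Suc m)) * step_prob (x (Suc m)) (x m) * (\<Prod>i<m. step_prob (x (Suc i)) (x i))"
    by (simp add: stat_step pair_prob_sym[of "x m"])
  finally show ?case by (simp add: mult_ac)
qed simp

lemma prob_path_reverse:
  "prob {\<omega>. \<forall>i\<in>{..m}. X (k + int i) \<omega> = x i} = prob {\<omega>. \<forall>i\<in>{..m}. X (k + int i) \<omega> = x (m - i)}"
proof -
  have "(\<Prod>i<m. step_prob (x (m - i)) (x (m - Suc i))) = (\<Prod>i<m. step_prob (x (Suc (m - Suc i))) (x (m - Suc i)))"
    by (rule prod.cong) (auto simp: Suc_diff_Suc)
  also have "\<dots> = (\<Prod>i<m. step_prob (x (Suc i)) (x i))"
    by (rule prod.nat_diff_reindex[of "\<lambda>i. step_prob (x (Suc i)) (x i)"])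
  finally show ?thesis
    using prob_path[where x=x and k=k and m=m] prob_path[where x="\<lambda>i. x (m - i)" and k=k and m=m] path_weight_reverse[of x m]
    by simp
qed

lemma reversible_X: "reversible_process \<Omega> X"
  unfolding reversible_process_def
proof (rule distr_process_eqI[where S=state_space])
  fix m :: nat and x :: "int \<Rightarrow> real"
  \<comment> \<open>The window is enumerated from its left end, the index \<open>i\<close> standing
    for \<open>k = int m - int i\<close>; the reflected process thus becomes a path read
    backwards.\<close>
  have "{\<omega> \<in> space \<Omega>. \<forall>k\<in>{- int m..int m}. X (- k) \<omega> = x k} = {\<omega>. \<forall>i\<in>{..2*m}. X (- int m + int i) \<omega> = x (int m - int i)}" (is "?A = ?B")
  proof (intro set_eqI iffI)
    fix \<omega> assume "\<omega> \<in> ?A"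
    then have *: "X (- k) \<omega> = x k" if "- int m \<le> k" "k \<le> int m" for k using that by auto
    have "X (- int m + int i) \<omega> = x (int m - int i)" if "i \<le> 2 * m" for i
      using *[of "int m - int i"] that by simp
    then show "\<omega> \<in> ?B" by simp
  next
    fix \<omega> assume *: "\<omega> \<in> ?B"
    show "\<omega> \<in> ?A"
    proof clarsimp
      fix k assume "- int m \<le> k" "k \<le> int m"
      then show "X (- k) \<omega> = x k" using * by (auto dest!: bspec[of _ _ "nat (int m - k)"])
    qed
  qed
  moreover have "{\<omega> \<in> space \<Omega>. \<forall>k\<in>{- int m..int m}. X k \<omega> = x k} = {\<omega>. \<forall>i\<in>{..2*m}. X (- int m + int i) \<omega> = x (- int m + int i)}" (is "?A = ?B")
  proof (intro set_eqI iffI)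
    fix \<omega> assume *: "\<omega> \<in> ?B"
    show "\<omega> \<in> ?A"
    proof clarsimp
      fix k assume "- int m \<le> k" "k \<le> int m"
      then show "X k \<omega> = x k" using * by (auto dest!: bspec[of _ _ "nat (int m + k)"])
    qed
  qed auto
  moreover have "prob {\<omega>. \<forall>i\<in>{..2*m}. X (- int m + int i) \<omega> = x (int m - int i)} = prob {\<omega>. \<forall>i\<in>{..2*m}. X (- int m + int i) \<omega> = x (- int m + int i)}"
    unfolding prob_path_reverse[where m="2*m" and k="- int m" and x="\<lambda>i. x (int m - int i)"]
    by (rule arg_cong[of _ _ prob]) (auto simp: of_nat_diff algebra_simps)
  ultimately show "prob {\<omega> \<in> space \<Omega>. \<forall>k\<in>{- int m..int m}. X (- k) \<omega> = x k} = prob {\<omega> \<in> space \<Omega>. \<forall>k\<in>{- int m..int m}. X k \<omega> = x k}"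
    by simp
qed (simp_all add: prob_space_axioms countable_state_space X_in_state_space)

end

section \<open>Mixing coefficients\<close>

text \<open>An indexed family instead of a set of blocks, because it is also applied to the
  preimages under \<open>swap_past\<close> of the blocks in \<open>Q\<close>.\<close>

lemma (in finite_measure) sum_measure_Int_partition:
  assumes "finite Q" "C \<in> sets M" "\<And>B. B \<in> Q \<Longrightarrow> g B \<in> sets M"
    "disjoint_family_on g Q" "(\<Union>B\<in>Q. g B) = space M"
  shows "(\<Sum>B\<in>Q. measure M (C \<inter> g B)) = measure M C"
proof -
  have "measure M (\<Union>B\<in>Q. C \<inter> g B) = (\<Sum>B\<in>Q. measure M (C \<inter> g B))"
    by (rule finite_measure_finite_Union) (use assms in \<open>auto simp: disjoint_family_on_def\<close>)
  also have "(\<Union>B\<in>Q. C \<inter> g B) = C"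
    using assms(2,5) sets.sets_into_space by blast
  finally show ?thesis by simp
qed

lemma (in finite_measure) sum_measure_partition_on:
  assumes Q: "finite Q" "partition_on (space M) Q" "Q \<subseteq> sets M" and C: "C \<in> sets M"
  shows "(\<Sum>B\<in>Q. measure M (C \<inter> B)) = measure M C"
  by (rule sum_measure_Int_partition[where g="\<lambda>B. B"])
     (use assms in \<open>auto simp: partition_on_def disjoint_def disjoint_family_on_def\<close>)

lemma (in prob_space) beta_sum_le_1:
  assumes P: "finite P" "partition_on (space M) P" "P \<subseteq> events"
    and Q: "finite Q" "partition_on (space M) Q" "Q \<subseteq> events"
  shows "1 / 2 * (\<Sum>A\<in>P. \<Sum>B\<in>Q. \<bar>prob (A \<inter> B) - prob A * prob B\<bar>) \<le> 1"
proof -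
  have one: "(\<Sum>A\<in>R. prob A) = 1" if R: "finite R" "partition_on (space M) R" "R \<subseteq> events" for R
  proof -
    have "(\<Sum>A\<in>R. prob A) = (\<Sum>A\<in>R. prob (space M \<inter> A))"
      by (rule sum.cong) (use R in \<open>auto dest: sets.sets_into_space simp: Int_absorb1\<close>)
    then show ?thesis using sum_measure_partition_on[OF R, of "space M"] by (simp add: prob_space)
  qed
  have "(\<Sum>A\<in>P. \<Sum>B\<in>Q. \<bar>prob (A \<inter> B) - prob A * prob B\<bar>) \<le> (\<Sum>A\<in>P. \<Sum>B\<in>Q. prob (A \<inter> B) + prob A * prob B)"
    by (intro sum_mono) (auto simp: abs_le_iff intro: add_increasing add_increasing2 mult_nonneg_nonneg order_trans[of "_ - _" "_"])
  also have "\<dots> = (\<Sum>A\<in>P. prob A) + (\<Sum>A\<in>P. prob A * 1)"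
    unfolding sum.distrib
    by (intro arg_cong2[where f="(+)"] sum.cong refl)
       (use P sum_measure_partition_on[OF Q] one[OF Q] in \<open>auto simp: sum_distrib_left[symmetric]\<close>)
  also have "\<dots> = 2" using one[OF P] by simp
  finally show ?thesis by simp
qed

text \<open>A supremum of reals bounds its members only if the set is bounded above; this supplies
  the bound for every later use of \<open>beta_coeff\<close>.\<close>

lemma (in prob_space) bdd_above_beta:
  assumes "\<A> \<subseteq> events" "\<B> \<subseteq> events"
  shows "bdd_above ((\<lambda>(P, Q). 1 / 2 * (\<Sum>A\<in>P. \<Sum>B\<in>Q. \<bar>prob (A \<inter> B) - prob A * prob B\<bar>)) `
    (finite_partitions M \<A> \<times> finite_partitions M \<B>))"
  by (rule bdd_aboveI[of _ 1])
     (use assms in \<open>auto simp: finite_partitions_def simp del: times_divide_eq_left divide_le_eq_1 intro!: beta_sum_le_1[simplified]\<close>)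

lemma (in prob_space) beta_sum_le_beta_coeff:
  assumes "\<A> \<subseteq> events" "\<B> \<subseteq> events" "P \<in> finite_partitions M \<A>" "Q \<in> finite_partitions M \<B>"
  shows "1 / 2 * (\<Sum>A\<in>P. \<Sum>B\<in>Q. \<bar>prob (A \<inter> B) - prob A * prob B\<bar>) \<le> beta_coeff M \<A> \<B>"
  unfolding beta_coeff_def
  using cSUP_upper[OF _ bdd_above_beta[OF assms(1,2)], of "(P, Q)"] assms(3,4) by simp

lemma partition_on_singleton_space: "\<Omega> \<noteq> {} \<Longrightarrow> partition_on \<Omega> {\<Omega>}"
  by (auto simp: partition_on_def)

text \<open>The partitions into \<open>A\<close>, \<open>B\<close> and their complements suffice:
  passing from \<open>B\<close> to its complement leaves the absolute difference unchanged, so the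
  row of \<open>A\<close> alone contributes it twice, which cancels the factor
  \<open>1 / 2\<close>.\<close>

lemma (in prob_space) alpha_le_beta:
  assumes A: "sigma_algebra (space M) \<A>" "\<A> \<subseteq> events" and B: "sigma_algebra (space M) \<B>" "\<B> \<subseteq> events"
  shows "alpha_coeff M \<A> \<B> \<le> beta_coeff M \<A> \<B>"
  unfolding alpha_coeff_def
proof (rule cSUP_least)
  interpret A: sigma_algebra "space M" \<A> by fact
  interpret B: sigma_algebra "space M" \<B> by fact
  show "\<A> \<times> \<B> \<noteq> {}" using A.top B.top by blast
  let ?d = "\<lambda>A B. \<bar>prob (A \<inter> B) - prob A * prob B\<bar>"
  fix x assume "x \<in> \<A> \<times> \<B>"
  then obtain A B where x: "x = (A, B)" and A': "A \<in> \<A>" and B': "B \<in> \<B>" by auto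
  have ev: "A \<in> events" "B \<in> events" using A' B' A B by auto
  have sub: "A \<subseteq> space M" "B \<subseteq> space M" using ev by (auto dest: sets.sets_into_space)
  show "(case x of (A, B) \<Rightarrow> ?d A B) \<le> beta_coeff M \<A> \<B>"
  \<comment> \<open>Blocks must be nonempty, so trivial sets admit no two-block partition. For them
    the difference is zero, and the one-block partitions show that \<open>beta_coeff\<close> is
    nonnegative.\<close>
  proof (cases "A = {} \<or> A = space M \<or> B = {} \<or> B = space M")
    case True
    then have "?d A B = 0" using sub by (auto simp: prob_space Int_absorb1 Int_absorb2)
    moreover have "1 / 2 * (\<Sum>A\<in>{space M}. \<Sum>B\<in>{space M}. ?d A B) \<le> beta_coeff M \<A> \<B>"
      by (rule beta_sum_le_beta_coeff)
         (use A B not_empty in \<open>auto simp: finite_partitions_def intro!: partition_on_singleton_space\<close>)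
    ultimately show ?thesis by (simp add: x prob_space)
  next
    case False
    have part: "partition_on (space M) {C, space M - C}" "C \<noteq> space M - C" if "C \<subseteq> space M" "C \<noteq> {}" "C \<noteq> space M" for C
      using that by (auto simp: partition_on_def disjoint_def)
    have "1 / 2 * (\<Sum>A\<in>{A, space M - A}. \<Sum>B\<in>{B, space M - B}. ?d A B) \<le> beta_coeff M \<A> \<B>"
      by (rule beta_sum_le_beta_coeff)
         (use A B A' B' False sub in \<open>auto simp: finite_partitions_def intro!: part\<close>)
    moreover have "?d A (space M - B) = ?d A B"
    proof -
      have "A \<inter> (space M - B) = A - (A \<inter> B)" using sub by auto
      then have "prob (A \<inter> (space M - B)) = prob A - prob (A \<inter> B)"
        using ev by (simp add: finite_measure_Diff)
      then show ?thesis using ev by (simp add: prob_compl algebra_simps abs_minus_commute)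
    qed
    ultimately have "1 / 2 * (?d A B + ?d A B + (?d (space M - A) B + ?d (space M - A) (space M - B))) \<le> beta_coeff M \<A> \<B>"
      using part(2)[of A] part(2)[of B] False sub by simp
    then have "?d A B \<le> beta_coeff M \<A> \<B>"
      using abs_ge_zero[of "prob ((space M - A) \<inter> B) - prob (space M - A) * prob B"]
        abs_ge_zero[of "prob ((space M - A) \<inter> (space M - B)) - prob (space M - A) * prob (space M - B)"] by argo
    then show ?thesis by (simp add: x)
  qed
qed

text \<open>A set generated by some of the variables cannot separate two sample points at which
  these variables agree; this property passes through complements and countable unions. It converts
  membership in the sigma field into dependence on few coordinates.\<close>

lemma sigma_field_agree:
  assumes "A \<in> sigma_field M X I" "\<And>k. k \<in> I \<Longrightarrow> X k \<omega> = X k \<omega>'" "\<omega> \<in> space M" "\<omega>' \<in> space M"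
  shows "\<omega> \<in> A \<longleftrightarrow> \<omega>' \<in> A"
  using assms(1) unfolding sigma_field_def
  by induction (use assms in auto)

lemma sigma_field_subset:
  assumes "\<And>k. X k \<in> borel_measurable M"
  shows "sigma_field M X I \<subseteq> sets M"
  unfolding sigma_field_def
  by (rule sets.sigma_sets_subset) (use assms in \<open>auto intro: measurable_sets\<close>)

lemma space_in_sigma_field: "space M \<in> sigma_field M X I"
  unfolding sigma_field_def by (rule sigma_sets_top)

lemma sigma_algebra_sigma_field: "sigma_algebra (space M) (sigma_field M X I)"
  unfolding sigma_field_def by (rule sigma_algebra_sigma_sets) auto

context hold_resample
begin

text \<open>
  Coupling: replacing the past innovations by their independent copies preserves the measure, makes
  the chain after time \<open>0\<close> independent of its past, and changes component \<open>j\<close> at time \<open>n\<close> only if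
  it was never resampled in between.
\<close>

definition swap_past :: "(int \<Rightarrow> real) \<Rightarrow> int \<Rightarrow> real" where
  "swap_past \<omega> i = \<omega> (index_code (case index_decode i of (b, j, t) \<Rightarrow> (if t \<le> 0 then \<not> b else b, j, t)))"

lemma distr_swap_past: "distr \<Omega> \<Omega> swap_past = \<Omega>"
  unfolding \<Omega>_def swap_past_def[abs_def]
proof (rule distr_reindex_iid)
  show "inj (\<lambda>i. index_code (case index_decode i of (b, j, t) \<Rightarrow> (if t \<le> 0 then \<not> b else b, j, t)))"
    by (rule inj_conj_index_code) (auto simp: inj_def split: if_splits)
qed (auto split: prod.splits)

lemma measurable_swap_past [measurable]: "swap_past \<in> \<Omega> \<rightarrow>\<^sub>M \<Omega>"
  unfolding \<Omega>_def swap_past_def[abs_def]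
  by (rule measurable_reindex_iid) (auto split: prod.splits)

lemma measurable_Z_swap_past [measurable]: "(\<lambda>\<omega>. Z j k (swap_past \<omega>)) \<in> \<Omega> \<rightarrow>\<^sub>M count_space UNIV"
  by (rule measurable_compose[OF measurable_swap_past measurable_Z])

lemma measurable_\<xi>_swap_past [measurable]: "(\<lambda>\<omega>. \<xi> j k (swap_past \<omega>)) \<in> \<Omega> \<rightarrow>\<^sub>M count_space UNIV"
  by (rule measurable_compose[OF measurable_swap_past measurable_\<xi>])

lemma pred_Z_swap_past [measurable]: "Measurable.pred \<Omega> (\<lambda>\<omega>. Z j k \<omega> \<noteq> Z j k (swap_past \<omega>))"
proof -
  have [measurable]: "(\<lambda>\<omega>. Z j k (swap_past \<omega>)) \<in> borel_measurable \<Omega>"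
    by (rule measurable_compose[OF measurable_swap_past measurable_Z_borel])
  have "Measurable.pred \<Omega> (\<lambda>\<omega>. Z j k \<omega> - Z j k (swap_past \<omega>) \<noteq> 0)" by measurable
  then show ?thesis by simp
qed

lemma \<xi>_swap_past: "\<xi> j t (swap_past \<omega>) = \<omega> (index_code (t \<le> 0, j, t))"
  by (simp add: \<xi>_def swap_past_def)

lemma prob_swap_past:
  assumes "Measurable.pred \<Omega> P"
  shows "prob {\<omega>. P (swap_past \<omega>)} = prob {\<omega>. P \<omega>}"
proof -
  have "prob {\<omega>. P \<omega>} = measure (distr \<Omega> \<Omega> swap_past) {\<omega>. P \<omega>}" by (simp add: distr_swap_past)
  also have "\<dots> = prob {\<omega>. P (swap_past \<omega>)}"
    using assms by (subst measure_distr) (simp_all add: vimage_def events_Collect)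
  finally show ?thesis by simp
qed

lemma prob_\<xi>_hold: "prob {\<omega>. \<xi> j k \<omega> = 2} = 1 - \<theta> j"
proof -
  have "prob {\<omega>. \<xi> j k \<omega> = 2} = (\<integral>\<omega>. indicator {\<omega>. \<xi> j k \<omega> = 2} \<omega> \<partial>\<Omega>)" by simp
  also have "\<dots> = (\<integral>\<omega>. (if \<xi> j k \<omega> = 2 then 1 else 0) \<partial>\<Omega>)"
    by (rule Bochner_Integration.integral_cong) (auto simp: indicator_def)
  also have "\<dots> = 1 - \<theta> j"
    using integral_\<xi>[of "\<lambda>x. if x = 2 then 1 else (0::real)" j k] by simp
  finally show ?thesis .
qed

lemma prob_hold_nonzero:
  "prob {\<omega>. Z j 0 \<omega> \<noteq> 0 \<and> (\<forall>t\<in>{1..n}. \<xi> j (int t) \<omega> = 2)} = p j * (1 - \<theta> j) ^ n"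
proof (induction n)
  case 0
  then show ?case by (simp add: prob_Z)
next
  case (Suc n)
  let ?E = "\<lambda>n \<omega>. Z j 0 \<omega> \<noteq> 0 \<and> (\<forall>t\<in>{1..n}. \<xi> j (int t) \<omega> = 2)"
  have "prob {\<omega>. ?E (Suc n) \<omega>} = prob {\<omega>. ?E n \<omega> \<and> \<xi> j (int (Suc n)) \<omega> = 2}"
    by (rule arg_cong[of _ _ prob]) (auto simp: atLeastAtMostSuc_conv)
  also have "\<dots> = prob {\<omega>. ?E n \<omega>} * prob {\<omega>. \<xi> j (int (Suc n)) \<omega> = 2}"
  proof (rule prob_Int_coords)
    show "depends_on (coords {j} {..int n}) (?E n)"
    proof (rule depends_on_compose2[of _ "Z j 0" "\<lambda>\<omega>. \<forall>t\<in>{1..n}. \<xi> j (int t) \<omega> = 2" "\<lambda>u v. u \<noteq> 0 \<and> v"])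
      show "depends_on (coords {j} {..int n}) (Z j 0)"
        by (rule depends_on_mono[OF depends_on_Z]) (auto simp: coords_def)
      show "depends_on (coords {j} {..int n}) (\<lambda>\<omega>. \<forall>t\<in>{1..n}. \<xi> j (int t) \<omega> = 2)"
        by (rule depends_on_Ball[of _ "\<lambda>t. coords {j} {int t}"], rule depends_on_compose[OF depends_on_\<xi>])
           (auto simp: coords_def)
    qed
    show "depends_on (coords {j} {int (Suc n)}) (\<lambda>\<omega>. \<xi> j (int (Suc n)) \<omega> = 2)"
      by (rule depends_on_compose[OF depends_on_\<xi>])
    show "coords {j} {..int n} \<inter> coords {j} {int (Suc n)} = {}" by (rule coords_disjoint) auto
  qed measurable
  finally show ?case using Suc by (simp add: prob_\<xi>_hold)
qed

text \<open>After time \<open>0\<close> the process and its swapped version use the same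
  innovations, so any resampling merges them for good; a disagreement can only have been carried
  along by holds.\<close>

lemma Z_swap_past_neq:
  assumes "Z j (int n) \<omega> \<noteq> Z j (int n) (swap_past \<omega>)"
  shows "Z j 0 \<omega> \<noteq> Z j 0 (swap_past \<omega>) \<and> (\<forall>t\<in>{1..n}. \<xi> j (int t) \<omega> = 2)"
  using assms
proof (induction n)
  case (Suc n)
  have \<xi>: "\<xi> j (int n + 1) (swap_past \<omega>) = \<xi> j (int n + 1) \<omega>" by (simp add: \<xi>_swap_past) (simp add: \<xi>_def)
  have ne: "Z j (int n + 1) \<omega> \<noteq> Z j (int n + 1) (swap_past \<omega>)" using Suc.prems by (simp add: add.commute)
  then have h: "\<xi> j (int n + 1) \<omega> = 2" "Z j (int n) \<omega> \<noteq> Z j (int n) (swap_past \<omega>)"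
    unfolding Z_Suc \<xi> by (auto split: if_splits)
  show ?case using Suc.IH[OF h(2)] h(1) by (auto simp: le_Suc_eq add.commute)
qed simp

definition uncoupled :: "nat \<Rightarrow> (int \<Rightarrow> real) set" where
  "uncoupled n = {\<omega>. \<exists>j. Z j (int n) \<omega> \<noteq> Z j (int n) (swap_past \<omega>)}"

lemma uncoupled_event [measurable]: "uncoupled n \<in> events"
  unfolding uncoupled_def
  by (rule events_Collect, rule pred_intros_countable) (rule pred_Z_swap_past)

text \<open>A disagreement of component \<open>j\<close> needs a nonzero starting value in one of
  the two copies, hence the factor \<open>2\<close>, and holds throughout. The requirement of a
  nonzero start yields the factor \<open>p j\<close>, which makes the union bound over all
  components summable.\<close>

lemma prob_uncoupled_le: "prob (uncoupled n) \<le> (\<Sum>j. 2 * (p j * (1 - \<theta> j) ^ n))"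
proof -
  let ?B = "\<lambda>j. {\<omega>. Z j (int n) \<omega> \<noteq> Z j (int n) (swap_past \<omega>)}"
  let ?W = "\<lambda>j \<omega>. Z j 0 \<omega> \<noteq> 0 \<and> (\<forall>t\<in>{1..n}. \<xi> j (int t) \<omega> = 2)"
  have ev: "?B j \<in> events" for j by (rule events_Collect) (rule pred_Z_swap_past)
  have Bj: "prob (?B j) \<le> 2 * (p j * (1 - \<theta> j) ^ n)" for j
  proof -
    have "?B j \<subseteq> {\<omega>. ?W j \<omega>} \<union> {\<omega>. ?W j (swap_past \<omega>)}"
    proof
      fix \<omega> assume "\<omega> \<in> ?B j"
      then have "Z j 0 \<omega> \<noteq> Z j 0 (swap_past \<omega>)" "\<forall>t\<in>{1..n}. \<xi> j (int t) \<omega> = 2"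
        using Z_swap_past_neq by auto
      moreover have "\<xi> j (int t) (swap_past \<omega>) = \<xi> j (int t) \<omega>" if "t \<in> {1..n}" for t
        using that by (simp add: \<xi>_swap_past) (simp add: \<xi>_def)
      ultimately show "\<omega> \<in> {\<omega>. ?W j \<omega>} \<union> {\<omega>. ?W j (swap_past \<omega>)}"
        by (cases "Z j 0 \<omega> = 0") simp_all
    qed
    then have "prob (?B j) \<le> prob ({\<omega>. ?W j \<omega>} \<union> {\<omega>. ?W j (swap_past \<omega>)})"
      by (rule finite_measure_mono) (intro sets.Un events_Collect, measurable)
    also have "\<dots> \<le> prob {\<omega>. ?W j \<omega>} + prob {\<omega>. ?W j (swap_past \<omega>)}"
      by (rule measure_Un_le; rule events_Collect) measurable
    also have "prob {\<omega>. ?W j (swap_past \<omega>)} = prob {\<omega>. ?W j \<omega>}"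
      by (rule prob_swap_past) measurable
    finally show ?thesis by (simp only: prob_hold_nonzero mult_2)
  qed
  have sum: "summable (\<lambda>j. 2 * (p j * (1 - \<theta> j) ^ n))"
  proof (intro summable_mult summable_comparison_test'[OF summable_p, of 0])
    show "norm (p j * (1 - \<theta> j) ^ n) \<le> p j" for j
      using p_pos[of j] \<theta>_pos[of j] \<theta>_less[of j] by (simp add: mult_left_le power_le_one less_imp_le)
  qed
  have sumB: "summable (\<lambda>j. prob (?B j))"
    by (rule summable_comparison_test'[OF sum, of 0]) (use Bj in simp)
  have "uncoupled n = (\<Union>j. ?B j)" by (auto simp: uncoupled_def)
  then have "prob (uncoupled n) \<le> (\<Sum>j. prob (?B j))"
    using finite_measure_subadditive_countably[of ?B] ev sumB by auto
  also have "\<dots> \<le> (\<Sum>j. 2 * (p j * (1 - \<theta> j) ^ n))" by (rule suminf_le[OF Bj sumB sum])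
  finally show ?thesis .
qed

text \<open>Once all components agree they stay together, driven by common innovations. The
  condition \<open>n \<ge> 1\<close> matters because innovations up to time \<open>0\<close> are the
  swapped ones.\<close>

lemma X_swap_past:
  assumes "n \<ge> 1" "\<omega> \<notin> uncoupled n" "k \<ge> int n"
  shows "X k (swap_past \<omega>) = X k \<omega>"
proof -
  have "Z j (int n + int m) (swap_past \<omega>) = Z j (int n + int m) \<omega>" for j m
  proof (induction m)
    case 0
    then show ?case using assms(2) by (auto simp: uncoupled_def)
  next
    case (Suc m)
    have "\<xi> j (int n + int m + 1) (swap_past \<omega>) = \<xi> j (int n + int m + 1) \<omega>"
      using assms(1) by (simp add: \<xi>_swap_past) (simp add: \<xi>_def)
    then show ?case using Suc Z_Suc[of j "int n + int m" \<omega>] Z_Suc[of j "int n + int m" "swap_past \<omega>"]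
      by (simp add: algebra_simps)
  qed
  from this[of _ "nat (k - int n)"] assms(3) show ?thesis by (simp add: X_def)
qed

lemma sigma_field_events: "sigma_field \<Omega> X I \<subseteq> events"
  by (rule sigma_field_subset) simp

text \<open>With \<open>B\<close> replaced by its preimage under \<open>swap_past\<close> the joint
  probability is exactly the product, and the replacement changes nothing off
  \<open>uncoupled n\<close>. Each entry is therefore at most the mass of two sets inside that
  event, and summing over both partitions gives twice its probability, cancelling the
  \<open>1 / 2\<close>.\<close>

lemma beta_mixing_le_uncoupled:
  assumes n: "n \<ge> 1"
  shows "beta_mixing \<Omega> X n \<le> prob (uncoupled n)"
  unfolding beta_mixing_def beta_coeff_def
proof (rule cSUP_least)
  let ?P = "finite_partitions \<Omega> (sigma_field \<Omega> X {..0})" and ?Q = "finite_partitions \<Omega> (sigma_field \<Omega> X {int n..})"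
  have "{UNIV} \<in> finite_partitions \<Omega> (sigma_field \<Omega> X I)" for I
    using space_in_sigma_field[of \<Omega> X I]
    by (simp add: finite_partitions_def partition_on_singleton_space)
  then show "?P \<times> ?Q \<noteq> {}" by blast
  fix x assume "x \<in> ?P \<times> ?Q"
  then obtain P Q where x: "x = (P, Q)" and P: "P \<in> ?P" and Q: "Q \<in> ?Q" by auto
  note PQ = P[unfolded finite_partitions_def] Q[unfolded finite_partitions_def]
  have evP: "A \<in> events" if "A \<in> P" for A using PQ that sigma_field_events by blast
  have evQ: "B \<in> events" if "B \<in> Q" for B using PQ that sigma_field_events by blast
  let ?T = "\<lambda>B. swap_past -` B" and ?F = "uncoupled n"
  have evT: "?T B \<in> events" if "B \<in> Q" for B
    using measurable_sets[OF measurable_swap_past evQ[OF that]] by simp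
  have indep: "prob (A \<inter> ?T B) = prob A * prob B" if A: "A \<in> P" and B: "B \<in> Q" for A B
  proof -
    \<comment> \<open>The coordinates seen by the swapped process: the copy \<open>True\<close> up
      to time \<open>0\<close> and the copy \<open>False\<close> afterwards, disjoint from the past
      of the chain.\<close>
    let ?J = "index_code ` ({True} \<times> UNIV \<times> {..0} \<union> {False} \<times> UNIV \<times> {1..})"
    have "prob {\<omega>. \<omega> \<in> A \<and> \<omega> \<in> ?T B} = prob {\<omega>. \<omega> \<in> A} * prob {\<omega>. \<omega> \<in> ?T B}"
    proof (rule prob_Int_coords)
      show "Measurable.pred \<Omega> (\<lambda>\<omega>. \<omega> \<in> A)" "Measurable.pred \<Omega> (\<lambda>\<omega>. \<omega> \<in> ?T B)"
        using evP[OF A] evT[OF B] by (simp_all add: pred_def vimage_def)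
      show "depends_on (coords UNIV {..0}) (\<lambda>\<omega>. \<omega> \<in> A)"
      proof (rule depends_onI)
        fix \<omega> \<omega>' :: "int \<Rightarrow> real" assume eq: "\<And>i. i \<in> coords UNIV {..0} \<Longrightarrow> \<omega> i = \<omega>' i"
        show "(\<omega> \<in> A) = (\<omega>' \<in> A)"
        proof (rule sigma_field_agree)
          show "A \<in> sigma_field \<Omega> X {..0}" using PQ A by blast
          show "X k \<omega> = X k \<omega>'" if "k \<in> {..0}" for k
            by (rule depends_onD[OF depends_on_X], rule eq) (use that in \<open>auto simp: coords_def\<close>)
        qed simp_all
      qed
      show "depends_on ?J (\<lambda>\<omega>. \<omega> \<in> ?T B)"
      proof (rule depends_onI)
        fix \<omega> \<omega>' :: "int \<Rightarrow> real" assume eq: "\<And>i. i \<in> ?J \<Longrightarrow> \<omega> i = \<omega>' i"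
        have "\<xi> j t (swap_past \<omega>) = \<xi> j t (swap_past \<omega>')" for j t
          unfolding \<xi>_swap_past by (rule eq) auto
        then have "X k (swap_past \<omega>) = X k (swap_past \<omega>')" for k
          unfolding X_def Z_def by (simp only:)
        moreover have "B \<in> sigma_field \<Omega> X {int n..}" using PQ B by blast
        ultimately show "(\<omega> \<in> ?T B) = (\<omega>' \<in> ?T B)"
          using sigma_field_agree[of B \<Omega> X "{int n..}" "swap_past \<omega>" "swap_past \<omega>'"] by simp
      qed
      show "coords UNIV {..0} \<inter> ?J = {}" by (auto simp: coords_def)
    qed
    moreover have "prob {\<omega>. swap_past \<omega> \<in> B} = prob {\<omega>. \<omega> \<in> B}"
      by (rule prob_swap_past) (use evQ[OF B] in \<open>simp add: pred_def\<close>)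
    ultimately show ?thesis by (simp add: Int_def)
  qed
  have bound: "\<bar>prob (A \<inter> B) - prob A * prob B\<bar> \<le> prob (A \<inter> ?F \<inter> B) + prob (A \<inter> ?F \<inter> ?T B)"
    if A: "A \<in> P" and B: "B \<in> Q" for A B
  proof -
    have agree: "\<omega> \<in> B \<longleftrightarrow> \<omega> \<in> ?T B" if "\<omega> \<notin> ?F" for \<omega>
      using sigma_field_agree[of B \<Omega> X "{int n..}" \<omega> "swap_past \<omega>"] X_swap_past[OF n that] PQ B by auto
    note [measurable] = evP[OF A] evQ[OF B] evT[OF B]
    have "prob (A \<inter> B) = prob (A \<inter> ?F \<inter> B) + prob (A \<inter> B - ?F)"
      by (subst finite_measure_Union[symmetric]) (auto intro!: arg_cong[of _ _ prob])
    moreover have "prob (A \<inter> ?T B) = prob (A \<inter> ?F \<inter> ?T B) + prob (A \<inter> ?T B - ?F)"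
      by (subst finite_measure_Union[symmetric]) (auto intro!: arg_cong[of _ _ prob])
    moreover have "A \<inter> B - ?F = A \<inter> ?T B - ?F" using agree by blast
    ultimately have "prob (A \<inter> B) - prob A * prob B = prob (A \<inter> ?F \<inter> B) - prob (A \<inter> ?F \<inter> ?T B)"
      using indep[OF A B] by simp
    then show ?thesis
      using measure_nonneg[of \<Omega> "A \<inter> ?F \<inter> B"] measure_nonneg[of \<Omega> "A \<inter> ?F \<inter> ?T B"] by linarith
  qed
  have Qp: "finite Q" "partition_on (space \<Omega>) Q" "Q \<subseteq> events" and Pp: "finite P" "partition_on (space \<Omega>) P" "P \<subseteq> events"
    using PQ evP evQ by auto
  have s1: "(\<Sum>B\<in>Q. prob (A \<inter> ?F \<inter> B)) = prob (A \<inter> ?F)" if "A \<in> P" for A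
    by (rule sum_measure_partition_on[OF Qp]) (use evP[OF that] in simp)
  have s2: "(\<Sum>B\<in>Q. prob (A \<inter> ?F \<inter> ?T B)) = prob (A \<inter> ?F)" if "A \<in> P" for A
  proof (rule sum_measure_Int_partition[OF Qp(1)])
    show "disjoint_family_on ?T Q" 
      using Qp(2) by (auto simp: disjoint_family_on_def partition_on_def disjoint_def)
    show "(\<Union>B\<in>Q. ?T B) = space \<Omega>" using Qp(2) by (auto simp: partition_on_def)
  qed (use evP[OF that] evT in auto)
  have "(\<Sum>A\<in>P. \<Sum>B\<in>Q. \<bar>prob (A \<inter> B) - prob A * prob B\<bar>) \<le>
      (\<Sum>A\<in>P. \<Sum>B\<in>Q. prob (A \<inter> ?F \<inter> B) + prob (A \<inter> ?F \<inter> ?T B))"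
    by (intro sum_mono bound)
  also have "\<dots> = 2 * (\<Sum>A\<in>P. prob (?F \<inter> A))"
  proof -
    have "(\<Sum>A\<in>P. \<Sum>B\<in>Q. prob (A \<inter> ?F \<inter> B) + prob (A \<inter> ?F \<inter> ?T B)) = (\<Sum>A\<in>P. 2 * prob (?F \<inter> A))"
      by (rule sum.cong) (simp_all only: sum.distrib s1 s2 Int_commute[of ?F] mult_2)
    then show ?thesis by (simp only: sum_distrib_left)
  qed
  also have "(\<Sum>A\<in>P. prob (?F \<inter> A)) = prob ?F"
    by (rule sum_measure_partition_on[OF Pp]) simp
  finally show "(case x of (P, Q) \<Rightarrow> 1 / 2 * (\<Sum>A\<in>P. \<Sum>B\<in>Q. \<bar>prob (A \<inter> B) - prob A * prob B\<bar>)) \<le> prob (uncoupled n)"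
    by (simp add: x)
qed

lemma alpha_mixing_le_beta_mixing: "alpha_mixing \<Omega> X n \<le> beta_mixing \<Omega> X n"
  unfolding alpha_mixing_def beta_mixing_def
  by (intro alpha_le_beta sigma_algebra_sigma_field sigma_field_events)

lemma beta_mixing_nonneg: "beta_mixing \<Omega> X n \<ge> 0"
proof -
  have "{UNIV} \<in> finite_partitions \<Omega> (sigma_field \<Omega> X I)" for I
    using space_in_sigma_field[of \<Omega> X I]
    by (simp add: finite_partitions_def partition_on_singleton_space)
  from beta_sum_le_beta_coeff[OF sigma_field_events sigma_field_events this this]
  show ?thesis unfolding beta_mixing_def by simp
qed

end

section \<open>Second moments\<close>

lemma square_le_square: "\<bar>a\<bar> \<le> b \<Longrightarrow> a\<^sup>2 \<le> (b::real)\<^sup>2"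
  using power_mono[of "\<bar>a\<bar>" b 2] by simp

context hold_resample
begin

definition comp_sum :: "nat \<Rightarrow> nat \<Rightarrow> (int \<Rightarrow> real) \<Rightarrow> real" where
  "comp_sum j n \<omega> = (\<Sum>k=1..n. Z j (int k) \<omega>)"

lemma comp_sum_0 [simp]: "comp_sum j 0 \<omega> = 0"
  by (simp add: comp_sum_def)

lemma comp_sum_Suc: "comp_sum j (Suc n) \<omega> = comp_sum j n \<omega> + Z j (int n + 1) \<omega>"
  by (simp add: comp_sum_def add.commute)

lemma measurable_comp_sum [measurable]: "comp_sum j n \<in> borel_measurable \<Omega>"
  unfolding comp_sum_def by measurable

lemma abs_comp_sum_le: "\<bar>comp_sum j n \<omega>\<bar> \<le> real n"
proof -
  have "\<bar>comp_sum j n \<omega>\<bar> \<le> (\<Sum>k=1..n. \<bar>Z j (int k) \<omega>\<bar>)" unfolding comp_sum_def by (rule sum_abs)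
  also have "\<dots> \<le> (\<Sum>k=1..n. 1)" by (intro sum_mono abs_Z_le)
  finally show ?thesis by simp
qed

lemma depends_on_comp_sum: "depends_on (coords {j} {..int n}) (comp_sum j n)"
proof (rule depends_onI)
  fix \<omega> \<omega>' :: "int \<Rightarrow> real" assume eq: "\<And>i. i \<in> coords {j} {..int n} \<Longrightarrow> \<omega> i = \<omega>' i"
  have "Z j (int k) \<omega> = Z j (int k) \<omega>'" if "k \<in> {1..n}" for k
    by (rule depends_onD[OF depends_on_Z], rule eq) (use that in \<open>auto simp: coords_def\<close>)
  then show "comp_sum j n \<omega> = comp_sum j n \<omega>'" by (simp add: comp_sum_def)
qed

lemma integrable_bounded:
  fixes f :: "_ \<Rightarrow> 'c::{banach, second_countable_topology}"
  assumes "f \<in> borel_measurable \<Omega>" "\<And>\<omega>. norm (f \<omega>) \<le> B"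
  shows "integrable \<Omega> f"
  by (rule integrable_const_bound[of _ B]) (use assms in auto)

lemma integrable_Z: "integrable \<Omega> (Z j k)"
  by (rule integrable_bounded[of _ 1]) (use abs_Z_le in auto)

lemma integrable_comp_sum: "integrable \<Omega> (comp_sum j n)"
  by (rule integrable_bounded[of _ "real n"]) (use abs_comp_sum_le in auto)

lemma integral_Z_id: "(\<integral>\<omega>. Z j k \<omega> \<partial>\<Omega>) = 0"
  using integral_Z[of "\<lambda>x::real. x" j k] by (simp add: resample_mean_def)

lemma integral_Z_square: "(\<integral>\<omega>. (Z j k \<omega>)\<^sup>2 \<partial>\<Omega>) = p j"
  using integral_Z[of "\<lambda>x::real. x\<^sup>2" j k] by (simp add: resample_mean_def)

lemma integral_comp_sum: "(\<integral>\<omega>. comp_sum j n \<omega> \<partial>\<Omega>) = 0"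
  unfolding comp_sum_def by (simp add: integrable_Z integral_Z_id)

lemma integrable_comp_sum_Z: "integrable \<Omega> (\<lambda>\<omega>. comp_sum j n \<omega> * Z j k \<omega>)"
  using integrable_mult_Z[OF integrable_comp_sum, where \<psi>="\<lambda>x. x"] .

text \<open>Fresh values have mean zero, so a resampling erases the correlation with the past and
  only the hold branch survives.\<close>

lemma integral_comp_sum_next:
  "(\<integral>\<omega>. comp_sum j n \<omega> * Z j (int n + 1) \<omega> \<partial>\<Omega>) = (1 - \<theta> j) * (\<integral>\<omega>. comp_sum j n \<omega> * Z j (int n) \<omega> \<partial>\<Omega>)"
proof -
  have "depends_on (coords UNIV {..int n}) (comp_sum j n)"
    by (rule depends_on_mono[OF depends_on_comp_sum]) (auto simp: coords_def)
  from one_step[OF integrable_comp_sum this, where \<psi>="\<lambda>x. x" and j=j] show ?thesis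
    by (simp add: integral_comp_sum)
qed

lemma integral_comp_sum_last:
  "(\<integral>\<omega>. comp_sum j n \<omega> * Z j (int n) \<omega> \<partial>\<Omega>) = (\<Sum>i<n. p j * (1 - \<theta> j) ^ i)"
proof (induction n)
  case (Suc n)
  have "(\<integral>\<omega>. comp_sum j (Suc n) \<omega> * Z j (int (Suc n)) \<omega> \<partial>\<Omega>) =
      (\<integral>\<omega>. comp_sum j n \<omega> * Z j (int n + 1) \<omega> + (Z j (int n + 1) \<omega>)\<^sup>2 \<partial>\<Omega>)"
    by (rule Bochner_Integration.integral_cong) (simp_all add: comp_sum_Suc algebra_simps power2_eq_square)
  also have "\<dots> = (\<integral>\<omega>. comp_sum j n \<omega> * Z j (int n + 1) \<omega> \<partial>\<Omega>) + (\<integral>\<omega>. (Z j (int n + 1) \<omega>)\<^sup>2 \<partial>\<Omega>)"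
    using integrable_mult_Z[OF integrable_Z, where \<psi>="\<lambda>x. x" and j=j and k="int n + 1"]
    by (intro Bochner_Integration.integral_add integrable_comp_sum_Z) (simp add: power2_eq_square)
  also have "\<dots> = (1 - \<theta> j) * (\<Sum>i<n. p j * (1 - \<theta> j) ^ i) + p j"
    by (simp only: integral_comp_sum_next Suc integral_Z_square)
  also have "\<dots> = (\<Sum>i<Suc n. p j * (1 - \<theta> j) ^ i)"
    by (subst sum.lessThan_Suc_shift) (simp add: sum_distrib_left mult_ac)
  finally show ?case .
qed simp

definition comp_var :: "nat \<Rightarrow> nat \<Rightarrow> real" where
  "comp_var j n = (\<integral>\<omega>. (comp_sum j n \<omega>)\<^sup>2 \<partial>\<Omega>)"

lemma comp_var_Suc:
  "comp_var j (Suc n) = comp_var j n + (p j + 2 * (1 - \<theta> j) * (\<Sum>i<n. p j * (1 - \<theta> j) ^ i))"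
proof -
  have i2: "integrable \<Omega> (\<lambda>\<omega>. (comp_sum j n \<omega>)\<^sup>2)"
    by (rule integrable_bounded[of _ "(real n)\<^sup>2"]) (auto intro!: square_le_square abs_comp_sum_le)
  have iZ: "integrable \<Omega> (\<lambda>\<omega>. (Z j k \<omega>)\<^sup>2)" for k
    using integrable_mult_Z[OF integrable_Z, where \<psi>="\<lambda>x. x"] by (simp add: power2_eq_square)
  have "comp_var j (Suc n) = (\<integral>\<omega>. (comp_sum j n \<omega>)\<^sup>2 + (2 * (comp_sum j n \<omega> * Z j (int n + 1) \<omega>) + (Z j (int n + 1) \<omega>)\<^sup>2) \<partial>\<Omega>)"
    unfolding comp_var_def
    by (rule Bochner_Integration.integral_cong) (simp_all add: comp_sum_Suc power2_sum algebra_simps)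
  also have "\<dots> = comp_var j n + (2 * (\<integral>\<omega>. comp_sum j n \<omega> * Z j (int n + 1) \<omega> \<partial>\<Omega>) + (\<integral>\<omega>. (Z j (int n + 1) \<omega>)\<^sup>2 \<partial>\<Omega>))"
    unfolding comp_var_def
    using i2 iZ integrable_comp_sum_Z by simp
  also have "\<dots> = comp_var j n + (p j + 2 * (1 - \<theta> j) * (\<Sum>i<n. p j * (1 - \<theta> j) ^ i))"
    unfolding integral_comp_sum_next integral_comp_sum_last integral_Z_square by simp
  finally show ?thesis .
qed

lemma comp_var_0 [simp]: "comp_var j 0 = 0"
  by (simp add: comp_var_def)

lemma comp_var_nonneg: "comp_var j n \<ge> 0"
  by (simp add: comp_var_def)

lemma geometric_sum_\<theta>: "(\<Sum>i<n. p j * (1 - \<theta> j) ^ i) = p j * (1 - (1 - \<theta> j) ^ n) / \<theta> j"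
  using \<theta>_pos[of j] \<theta>_less[of j] sum_gp_strict[of "1 - \<theta> j" n]
  by (simp add: sum_distrib_left[symmetric])

text \<open>No covariance exceeds \<open>p j\<close>; this is the bound for a chain that never
  resamples.\<close>

lemma comp_var_le_square: "comp_var j n \<le> p j * (real n)\<^sup>2"
proof (induction n)
  case (Suc n)
  have "(\<Sum>i<n. p j * (1 - \<theta> j) ^ i) \<le> (\<Sum>i<n. p j)"
    using p_pos[of j] \<theta>_pos[of j] \<theta>_less[of j] by (intro sum_mono) (simp add: mult_left_le power_le_one less_imp_le)
  then have "(1 - \<theta> j) * (\<Sum>i<n. p j * (1 - \<theta> j) ^ i) \<le> 1 * (real n * p j)"
  proof (intro mult_mono)
    show "0 \<le> (\<Sum>i<n. p j * (1 - \<theta> j) ^ i)"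
      using p_pos[of j] \<theta>_less[of j] by (intro sum_nonneg mult_nonneg_nonneg zero_le_power) auto
  qed (use \<theta>_pos[of j] in auto)
  then show ?case using Suc unfolding comp_var_Suc by (simp add: power2_eq_square algebra_simps)
qed simp

text \<open>The covariances form a geometric series, so each new summand adds at most
  \<open>2 * (p j / \<theta> j)\<close> to the variance.\<close>

lemma comp_var_le_linear: "comp_var j n \<le> 2 * real n * (p j / \<theta> j)"
proof (induction n)
  case (Suc n)
  have "p j + 2 * (1 - \<theta> j) * (\<Sum>i<n. p j * (1 - \<theta> j) ^ i) \<le> p j + 2 * (1 - \<theta> j) * (p j / \<theta> j)"
    unfolding geometric_sum_\<theta> using p_pos[of j] \<theta>_pos[of j] \<theta>_less[of j]
    by (intro add_left_mono mult_left_mono divide_right_mono) (auto intro: less_imp_le)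
  also have "\<dots> \<le> 2 * (p j / \<theta> j)"
    using p_pos[of j] \<theta>_pos[of j] by (simp add: field_simps)
  finally show ?case using Suc unfolding comp_var_Suc by (simp add: algebra_simps)
qed simp

text \<open>Up to time \<open>n\<close> no covariance has dropped below
  \<open>p j * (1 - \<theta> j) ^ n\<close>, so the quadratic growth persists while \<open>n\<close>
  is short compared with \<open>1 / \<theta> j\<close>.\<close>

lemma comp_var_ge_square: "comp_var j n \<ge> p j * (real n)\<^sup>2 * (1 - \<theta> j) ^ n"
proof -
  let ?q = "1 - \<theta> j"
  have q: "0 < ?q" "?q \<le> 1" using \<theta>_pos[of j] \<theta>_less[of j] by auto
  \<comment> \<open>The induction runs over \<open>m\<close> with the exponent frozen at the final
    time \<open>n\<close>, so that the lower bound for the covariances is the same in every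
    step.\<close>
  have "comp_var j m \<ge> p j * (real m)\<^sup>2 * ?q ^ n" if "m \<le> n" for m
    using that
  proof (induction m)
    case (Suc m)
    have "(\<Sum>i<m. p j * ?q ^ n) \<le> (\<Sum>i<m. p j * ?q ^ Suc i)"
      using Suc.prems p_pos[of j] q by (intro sum_mono mult_left_mono power_decreasing) auto
    then have "real m * (p j * ?q ^ n) \<le> ?q * (\<Sum>i<m. p j * ?q ^ i)"
      by (simp add: sum_distrib_left mult_ac)
    moreover have "p j * ?q ^ n \<le> p j" using p_pos[of j] q by (simp add: mult_left_le power_le_one)
    ultimately show ?case using Suc unfolding comp_var_Suc by (simp add: power2_eq_square algebra_simps)
  qed simp
  then show ?thesis by simp
qed

text \<open>The increment at step \<open>n\<close> is at least \<open>p j / \<theta> j\<close> times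
  \<open>1 - (1 - \<theta> j) ^ n\<close>; the deficits form a geometric series, whose sum is at
  most \<open>1 / \<theta> j\<close>.\<close>

lemma comp_var_ge_linear: "comp_var j n \<ge> p j / \<theta> j * (real n - 1 / \<theta> j)"
proof -
  let ?q = "1 - \<theta> j"
  have q: "0 < ?q" "?q \<le> 1" using \<theta>_pos[of j] \<theta>_less[of j] by auto
  have w: "p j / \<theta> j > 0" using p_pos[of j] \<theta>_pos[of j] by simp
  have "comp_var j n \<ge> p j / \<theta> j * (real n - (\<Sum>i<n. ?q ^ i))"
  proof (induction n)
    case (Suc n)
    have qn: "0 \<le> 1 - ?q ^ n" "?q ^ n \<ge> 0" using q by (auto simp: power_le_one)
    have "p j / \<theta> j * (1 - ?q ^ n) \<le> p j / \<theta> j * (\<theta> j + 2 * ?q * (1 - ?q ^ n))"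
    proof (rule mult_left_mono)
      have "0 \<le> \<theta> j * ?q ^ n + ?q * (1 - ?q ^ n)"
        using qn q \<theta>_pos[of j] by (intro add_nonneg_nonneg mult_nonneg_nonneg) auto
      then show "1 - ?q ^ n \<le> \<theta> j + 2 * ?q * (1 - ?q ^ n)" by (simp add: algebra_simps)
    qed (use w in simp)
    also have "\<dots> = p j + 2 * ?q * (\<Sum>i<n. p j * ?q ^ i)"
      unfolding geometric_sum_\<theta> using \<theta>_pos[of j] by (simp add: field_simps)
    finally have step: "p j / \<theta> j * (1 - ?q ^ n) \<le> p j + 2 * ?q * (\<Sum>i<n. p j * ?q ^ i)" .
    have "p j / \<theta> j * (real (Suc n) - (\<Sum>i<Suc n. ?q ^ i)) = p j / \<theta> j * ((real n - (\<Sum>i<n. ?q ^ i)) + (1 - ?q ^ n))"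
      by simp
    also have "\<dots> = p j / \<theta> j * (real n - (\<Sum>i<n. ?q ^ i)) + p j / \<theta> j * (1 - ?q ^ n)"
      by (rule distrib_left)
    finally show ?case unfolding comp_var_Suc using Suc step by linarith
  qed simp
  moreover have "(\<Sum>i<n. ?q ^ i) \<le> 1 / \<theta> j"
    using sum_gp_strict[of ?q n] q \<theta>_pos[of j] by (simp add: divide_right_mono)
  then have "p j / \<theta> j * (real n - 1 / \<theta> j) \<le> p j / \<theta> j * (real n - (\<Sum>i<n. ?q ^ i))"
    using w by (intro mult_left_mono) auto
  ultimately show ?thesis by linarith
qed

lemma comp_sum_shift: "comp_sum j n (shift (int m) \<omega>) = comp_sum j (m + n) \<omega> - comp_sum j m \<omega>"
proof (induction n)
  case (Suc n)
  then show ?case using comp_sum_Suc[of j n "shift (int m) \<omega>"] comp_sum_Suc[of j "m + n" \<omega>]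
    by (simp add: Z_shift algebra_simps)
qed simp

text \<open>The sum is cut into \<open>N\<close> blocks of length \<open>n\<close> with the same
  law; Cauchy-Schwarz over the blocks gives the square of \<open>N\<close>. It yields the upper half
  of the limit superior.\<close>

lemma comp_var_mult_le: "comp_var j (N * n) \<le> (real N)\<^sup>2 * comp_var j n"
proof -
  have sum: "comp_sum j (N * n) \<omega> = (\<Sum>i<N. comp_sum j n (shift (int (i * n)) \<omega>))" for \<omega>
    unfolding comp_sum_shift
    by (induction N) (simp_all add: algebra_simps)
  have i2: "integrable \<Omega> (\<lambda>\<omega>. (comp_sum j n \<omega>)\<^sup>2)" for n
    by (rule integrable_bounded[of _ "(real n)\<^sup>2"]) (auto intro!: square_le_square abs_comp_sum_le)
  have m2: "(\<lambda>\<omega>. (comp_sum j n (shift m \<omega>))\<^sup>2) \<in> borel_measurable \<Omega>" for m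
    by (rule measurable_compose[OF measurable_shift, of "\<lambda>\<omega>. (comp_sum j n \<omega>)\<^sup>2"]) measurable
  have i3: "integrable \<Omega> (\<lambda>\<omega>. (comp_sum j n (shift m \<omega>))\<^sup>2)" for m
    by (rule integrable_bounded[of _ "(real n)\<^sup>2", OF m2]) (auto intro!: square_le_square abs_comp_sum_le)
  have "comp_var j (N * n) \<le> (\<integral>\<omega>. real N * (\<Sum>i<N. (comp_sum j n (shift (int (i * n)) \<omega>))\<^sup>2) \<partial>\<Omega>)"
    unfolding comp_var_def
  proof (rule integral_mono)
    show "integrable \<Omega> (\<lambda>\<omega>. real N * (\<Sum>i<N. (comp_sum j n (shift (int (i * n)) \<omega>))\<^sup>2))"
      using i3 by simp
    show "(comp_sum j (N * n) \<omega>)\<^sup>2 \<le> real N * (\<Sum>i<N. (comp_sum j n (shift (int (i * n)) \<omega>))\<^sup>2)" for \<omega>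
      using Cauchy_Schwarz_ineq_sum[of "\<lambda>_. 1" "\<lambda>i. comp_sum j n (shift (int (i * n)) \<omega>)" "{..<N}"]
      by (simp add: sum)
  qed (rule i2)
  also have "\<dots> = real N * (\<Sum>i<N. \<integral>\<omega>. (comp_sum j n (shift (int (i * n)) \<omega>))\<^sup>2 \<partial>\<Omega>)"
    using i3 by simp
  also have "\<dots> = real N * (\<Sum>i<N. comp_var j n)"
    using integral_shift[of "\<lambda>\<omega>. (comp_sum j n \<omega>)\<^sup>2"] by (simp add: comp_var_def)
  finally show ?thesis by (simp add: power2_eq_square)
qed

section \<open>Weighted sums over all components\<close>

definition wsum :: "(nat \<Rightarrow> real) \<Rightarrow> nat \<Rightarrow> (int \<Rightarrow> real) \<Rightarrow> real" where
  "wsum c n \<omega> = (\<Sum>j. c j * comp_sum j n \<omega>)"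

lemma wsum_bounds:
  assumes c: "\<And>j. \<bar>c j\<bar> \<le> 1 / 4 ^ j"
  shows "summable (\<lambda>j. c j * comp_sum j n \<omega>)" "\<bar>\<Sum>j<m. c j * comp_sum j n \<omega>\<bar> \<le> 2 * real n"
    "\<bar>wsum c n \<omega>\<bar> \<le> 2 * real n"
proof -
  have b: "\<bar>c j * comp_sum j n \<omega>\<bar> \<le> real n * (1/4) ^ j" for j
    using mult_mono[OF c[of j] abs_comp_sum_le[of j n \<omega>]] by (simp add: abs_mult power_divide mult.commute)
  have s: "summable (\<lambda>j. real n * (1/4) ^ j)" by (intro summable_mult summable_geometric) simp
  show sc: "summable (\<lambda>j. c j * comp_sum j n \<omega>)"
    by (rule summable_comparison_test'[OF s, of 0]) (use b in simp)
  show bm: "\<bar>\<Sum>j<m. c j * comp_sum j n \<omega>\<bar> \<le> 2 * real n" for m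
  proof -
    have "\<bar>\<Sum>j<m. c j * comp_sum j n \<omega>\<bar> \<le> (\<Sum>j<m. real n * (1/4) ^ j)"
      by (rule order_trans[OF sum_abs sum_mono]) (rule b)
    also have "\<dots> \<le> (\<Sum>j. real n * (1/4) ^ j)" by (rule sum_le_suminf[OF s]) auto
    also have "\<dots> = real n * (4/3)" by (subst suminf_mult) (simp_all add: summable_geometric suminf_geometric)
    finally show ?thesis by simp
  qed
  have "(\<lambda>m. \<bar>\<Sum>j<m. c j * comp_sum j n \<omega>\<bar>) \<longlonglongrightarrow> \<bar>wsum c n \<omega>\<bar>"
    unfolding wsum_def by (intro tendsto_rabs summable_LIMSEQ sc)
  then show "\<bar>wsum c n \<omega>\<bar> \<le> 2 * real n"
    by (rule Lim_bounded[of _ _ 0]) (use bm in auto)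
qed

lemma measurable_wsum [measurable]: "wsum c n \<in> borel_measurable \<Omega>"
  unfolding wsum_def by measurable

lemma integral_comp_sum_cross:
  assumes "i \<noteq> j"
  shows "(\<integral>\<omega>. comp_sum i n \<omega> * comp_sum j m \<omega> \<partial>\<Omega>) = 0"
proof -
  have "indep_var borel (comp_sum i n) borel (comp_sum j m)"
    by (rule indep_var_coords[OF _ _ depends_on_comp_sum depends_on_comp_sum])
       (use assms in \<open>auto intro!: coords_disjoint\<close>)
  from indep_var_lebesgue_integral[OF this integrable_comp_sum integrable_comp_sum]
  show ?thesis by (simp add: integral_comp_sum)
qed

lemma integral_finite_wsum_square:
  "(\<integral>\<omega>. (\<Sum>j<m. c j * comp_sum j n \<omega>)\<^sup>2 \<partial>\<Omega>) = (\<Sum>j<m. (c j)\<^sup>2 * comp_var j n)"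
proof -
  have int: "integrable \<Omega> (\<lambda>\<omega>. comp_sum i n \<omega> * comp_sum j n \<omega>)" for i j
    by (rule integrable_bounded[of _ "real n * real n"])
       (auto simp: abs_mult intro!: mult_mono abs_comp_sum_le)
  have "(\<integral>\<omega>. (\<Sum>j<m. c j * comp_sum j n \<omega>)\<^sup>2 \<partial>\<Omega>) =
      (\<integral>\<omega>. (\<Sum>i<m. \<Sum>j<m. (c i * c j) * (comp_sum i n \<omega> * comp_sum j n \<omega>)) \<partial>\<Omega>)"
    by (rule Bochner_Integration.integral_cong) (simp_all add: power2_eq_square sum_product mult_ac)
  also have "\<dots> = (\<Sum>i<m. \<Sum>j<m. (c i * c j) * (\<integral>\<omega>. comp_sum i n \<omega> * comp_sum j n \<omega> \<partial>\<Omega>))"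
    using int by simp
  also have "\<dots> = (\<Sum>i<m. \<Sum>j<m. if i = j then (c i)\<^sup>2 * comp_var i n else 0)"
    by (intro sum.cong refl) (auto simp: integral_comp_sum_cross comp_var_def power2_eq_square)
  also have "\<dots> = (\<Sum>j<m. (c j)\<^sup>2 * comp_var j n)" by simp
  finally show ?thesis .
qed

text \<open>For finite truncations the cross terms vanish by independence. The geometric weights
  bound all truncations by \<open>2 * real n\<close>, so dominated convergence passes to the
  series.\<close>

lemma wsum_square_sums:
  assumes c: "\<And>j. \<bar>c j\<bar> \<le> 1 / 4 ^ j"
  shows "(\<lambda>j. (c j)\<^sup>2 * comp_var j n) sums (\<integral>\<omega>. (wsum c n \<omega>)\<^sup>2 \<partial>\<Omega>)"
proof -
  have "(\<lambda>m. \<integral>\<omega>. (\<Sum>j<m. c j * comp_sum j n \<omega>)\<^sup>2 \<partial>\<Omega>) \<longlonglongrightarrow> (\<integral>\<omega>. (wsum c n \<omega>)\<^sup>2 \<partial>\<Omega>)"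
  proof (rule integral_dominated_convergence[where w="\<lambda>_. (2 * real n)\<^sup>2"])
    show "AE \<omega> in \<Omega>. (\<lambda>m. (\<Sum>j<m. c j * comp_sum j n \<omega>)\<^sup>2) \<longlonglongrightarrow> (wsum c n \<omega>)\<^sup>2"
      unfolding wsum_def by (intro AE_I2 tendsto_power summable_LIMSEQ wsum_bounds c)
    show "AE \<omega> in \<Omega>. norm ((\<Sum>j<m. c j * comp_sum j n \<omega>)\<^sup>2) \<le> (2 * real n)\<^sup>2" for m
      using square_le_square[OF wsum_bounds(2)[OF c, where m=m and n=n]] by (simp del: power_mult_distrib)
  qed auto
  then show ?thesis by (simp only: integral_finite_wsum_square sums_def)
qed

lemma integral_wsum:
  assumes c: "\<And>j. \<bar>c j\<bar> \<le> 1 / 4 ^ j"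
  shows "(\<integral>\<omega>. wsum c n \<omega> \<partial>\<Omega>) = 0"
proof -
  have "(\<lambda>m. \<integral>\<omega>. (\<Sum>j<m. c j * comp_sum j n \<omega>) \<partial>\<Omega>) \<longlonglongrightarrow> (\<integral>\<omega>. wsum c n \<omega> \<partial>\<Omega>)"
  proof (rule integral_dominated_convergence[where w="\<lambda>_. 2 * real n"])
    show "AE \<omega> in \<Omega>. (\<lambda>m. \<Sum>j<m. c j * comp_sum j n \<omega>) \<longlonglongrightarrow> wsum c n \<omega>"
      unfolding wsum_def by (intro AE_I2 summable_LIMSEQ wsum_bounds c)
    show "AE \<omega> in \<Omega>. norm (\<Sum>j<m. c j * comp_sum j n \<omega>) \<le> 2 * real n" for m
      using wsum_bounds(2)[OF c, where m=m and n=n] by auto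
  qed auto
  moreover have "(\<integral>\<omega>. (\<Sum>j<m. c j * comp_sum j n \<omega>) \<partial>\<Omega>) = 0" for m
    by (simp add: integrable_comp_sum integral_comp_sum)
  ultimately show ?thesis by (simp add: LIMSEQ_const_iff)
qed

section \<open>Moments of the partial sums of the coded chain\<close>

lemma AE_partial_sum: "AE \<omega> in \<Omega>. partial_sum X n \<omega> = wsum (\<lambda>j. 1 / 4 ^ j) n \<omega>"
proof -
  have "AE \<omega> in \<Omega>. \<forall>k\<in>{1..n}. X (int k) \<omega> = (\<Sum>j. Z j (int k) \<omega> / 4 ^ j)"
    by (rule AE_finite_allI) (auto intro: AE_X)
  then show ?thesis
  proof eventually_elim
    fix \<omega> assume h: "\<forall>k\<in>{1..n}. X (int k) \<omega> = (\<Sum>j. Z j (int k) \<omega> / 4 ^ j)"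
    have "partial_sum X n \<omega> = (\<Sum>k=1..n. \<Sum>j. Z j (int k) \<omega> / 4 ^ j)"
      unfolding partial_sum_def using h by simp
    also have "\<dots> = (\<Sum>j. \<Sum>k=1..n. Z j (int k) \<omega> / 4 ^ j)"
      by (rule suminf_sum[symmetric]) (rule summable_ternary, rule abs_Z_le)
    also have "\<dots> = wsum (\<lambda>j. 1 / 4 ^ j) n \<omega>"
      by (simp add: wsum_def comp_sum_def sum_divide_distrib)
    finally show "partial_sum X n \<omega> = wsum (\<lambda>j. 1 / 4 ^ j) n \<omega>" .
  qed
qed

lemma measurable_partial_sum [measurable]: "partial_sum X n \<in> borel_measurable \<Omega>"
  unfolding partial_sum_def by measurable

lemma expectation_partial_sum: "expectation (partial_sum X n) = 0"
proof -
  have "expectation (partial_sum X n) = expectation (wsum (\<lambda>j. 1 / 4 ^ j) n)"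
    by (rule integral_cong_AE) (use AE_partial_sum in auto)
  then show ?thesis by (simp add: integral_wsum)
qed

lemma expectation_X: "expectation (X 0) = 0"
proof -
  have "expectation (\<lambda>\<omega>. X 0 (shift 1 \<omega>)) = expectation (X 0)" by (rule integral_shift) simp
  moreover have "partial_sum X 1 = X 1" by (simp add: partial_sum_def fun_eq_iff)
  ultimately show ?thesis using expectation_partial_sum[of 1] by (simp add: X_shift)
qed

lemma integrable_X_square: "integrable \<Omega> (\<lambda>\<omega>. (X 0 \<omega>)\<^sup>2)"
proof (rule integrable_bounded[of _ "2\<^sup>2"])
  show "norm ((X 0 \<omega>)\<^sup>2) \<le> 2\<^sup>2" for \<omega>
    using square_le_square[OF abs_X_le[of 0 \<omega>]] by simp
qed measurable

lemma prob_X_bounded: "prob {\<omega> \<in> space \<Omega>. \<bar>X 0 \<omega>\<bar> \<le> 2} = 1"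
  using abs_X_le by simp

lemma variance_sums: "(\<lambda>j. (1 / 4 ^ j)\<^sup>2 * comp_var j n) sums variance (partial_sum X n)"
proof -
  have "variance (partial_sum X n) = expectation (\<lambda>\<omega>. (wsum (\<lambda>j. 1 / 4 ^ j) n \<omega>)\<^sup>2)"
    unfolding expectation_partial_sum
    by (rule integral_cong_AE) (use AE_partial_sum[of n] in auto)
  then show ?thesis using wsum_square_sums[of "\<lambda>j. 1 / 4 ^ j" n] by simp
qed

lemma variance_mult_le: "variance (partial_sum X (N * n)) \<le> (real N)\<^sup>2 * variance (partial_sum X n)"
proof (rule sums_le[OF _ variance_sums sums_mult[OF variance_sums]])
  show "(1 / 4 ^ j)\<^sup>2 * comp_var j (N * n) \<le> (real N)\<^sup>2 * ((1 / 4 ^ j)\<^sup>2 * comp_var j n)" for j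
    using mult_left_mono[OF comp_var_mult_le[of j N n], of "(1 / 4 ^ j)\<^sup>2"] by (simp add: mult_ac)
qed

lemma comp_var_le_variance: "(1 / 4 ^ j)\<^sup>2 * comp_var j n \<le> variance (partial_sum X n)"
  using sum_le_suminf[OF sums_summable[OF variance_sums[of n]], of "{j}"] sums_unique[OF variance_sums[of n]]
  by (simp add: comp_var_nonneg)

end

section \<open>Characteristic functions of the components\<close>

lemma norm_one_minus_mult_iexp_ge:
  assumes "0 \<le> q"
  shows "norm (1 - complex_of_real q * iexp u) \<ge> 1 - q"
proof -
  have "norm (1 :: complex) - norm (complex_of_real q * iexp u) \<le> norm (1 - complex_of_real q * iexp u)"
    by (rule norm_triangle_ineq2)
  then show ?thesis using assms by (simp add: norm_mult)
qed

lemma norm_iexp_minus_one_le: "norm (1 - iexp u) \<le> \<bar>u\<bar>"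
  using iexp_approx1[of u 0] by (simp add: norm_minus_commute)

context hold_resample
begin

text \<open>
  The correction factor is chosen so that, by \<open>corr_step\<close> below, the corrected characteristic
  function obeys the exact recursion \<open>corr_char_Suc\<close>.  Since the factor is \<open>1\<close> in the state \<open>0\<close>,
  the correction is small both for small \<open>p\<close> (Poisson regime) and for small \<open>s\<close> (Gaussian regime).
\<close>

definition corr :: "nat \<Rightarrow> real \<Rightarrow> real \<Rightarrow> complex" where
  "corr j s x = complex_of_real (\<theta> j) / (1 - complex_of_real (1 - \<theta> j) * iexp (s * x))"

text \<open>One minus the characteristic function of a block length that is geometric with mean
  \<open>1 / \<theta> j\<close> and carries a fair random sign; compare
  \<open>Re_iexp_corr\<close>.\<close>

definition kappa :: "nat \<Rightarrow> real \<Rightarrow> real" where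
  "kappa j s = (2 - \<theta> j) * (1 - cos s) / ((\<theta> j)\<^sup>2 + 2 * (1 - \<theta> j) * (1 - cos s))"

definition comp_char :: "nat \<Rightarrow> nat \<Rightarrow> real \<Rightarrow> complex" where
  "comp_char j n s = (\<integral>\<omega>. iexp (s * comp_sum j n \<omega>) \<partial>\<Omega>)"

lemma corr_denom: "norm (1 - complex_of_real (1 - \<theta> j) * iexp u) \<ge> \<theta> j"
  "1 - complex_of_real (1 - \<theta> j) * iexp u \<noteq> 0"
proof -
  show "norm (1 - complex_of_real (1 - \<theta> j) * iexp u) \<ge> \<theta> j"
    using norm_one_minus_mult_iexp_ge[of "1 - \<theta> j" u] \<theta>_less[of j] by simp
  then show "1 - complex_of_real (1 - \<theta> j) * iexp u \<noteq> 0"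
    using \<theta>_pos[of j] by (metis norm_zero not_less)
qed

lemma norm_corr_le: "norm (corr j s x) \<le> 1"
  using corr_denom[of j "s * x"] \<theta>_pos[of j] by (simp add: corr_def norm_divide divide_le_eq_1)

lemma corr_0 [simp]: "corr j s 0 = 1"
  using \<theta>_pos[of j] by (simp add: corr_def)

lemma corr_minus: "corr j s (-1) = cnj (corr j s 1)"
  by (simp add: corr_def exp_cnj)

text \<open>The first-step equation of a geometric waiting time: \<open>corr j s x\<close> is the
  characteristic function of \<open>x\<close> times the number of further holds before the next
  resampling.\<close>

lemma corr_step: "complex_of_real (1 - \<theta> j) * (iexp (s * x) * corr j s x) = corr j s x - complex_of_real (\<theta> j)"
  using corr_denom(2)[of j "s * x"] unfolding corr_def by (simp add: field_simps)

text \<open>The mean error of inserting the correction: the factor is \<open>1\<close> in state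
  \<open>0\<close>, and \<open>p j\<close> is the probability of the other two states.\<close>

definition corr_err :: "nat \<Rightarrow> real \<Rightarrow> real" where
  "corr_err j s = p j * norm (1 - corr j s 1)"

lemma norm_one_minus_corr_le: "norm (1 - corr j s 1) \<le> 2" "norm (1 - corr j s 1) \<le> \<bar>s\<bar> / \<theta> j"
proof -
  show "norm (1 - corr j s 1) \<le> 2"
    using norm_triangle_ineq4[of 1 "corr j s 1"] norm_corr_le[of j s 1] by simp
  have "1 - corr j s 1 = complex_of_real (1 - \<theta> j) * (1 - iexp s) / (1 - complex_of_real (1 - \<theta> j) * iexp s)"
    using corr_denom(2)[of j s] unfolding corr_def by (simp add: field_simps)
  then have "norm (1 - corr j s 1) = (1 - \<theta> j) * norm (1 - iexp s) / norm (1 - complex_of_real (1 - \<theta> j) * iexp s)"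
    using \<theta>_less[of j] by (simp only: norm_divide norm_mult norm_of_real)
  also have "\<dots> \<le> 1 * \<bar>s\<bar> / \<theta> j"
    using corr_denom[of j s] \<theta>_pos[of j] \<theta>_less[of j] norm_iexp_minus_one_le[of s]
    by (intro frac_le mult_mono) auto
  finally show "norm (1 - corr j s 1) \<le> \<bar>s\<bar> / \<theta> j" by simp
qed

text \<open>The first bound serves the Poisson regime, where \<open>p j\<close> tends to zero while
  \<open>s\<close> is of order \<open>\<theta> j\<close>; the second serves the Gaussian regime of
  fixed \<open>j\<close> and vanishing \<open>s\<close>.\<close>

lemma corr_err_le: "corr_err j s \<le> 2 * p j" "corr_err j s \<le> p j * \<bar>s\<bar> / \<theta> j"
  using mult_left_mono[OF norm_one_minus_corr_le(1)[of j s], of "p j"]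
    mult_left_mono[OF norm_one_minus_corr_le(2)[of j s], of "p j"] p_pos[of j]
  by (simp_all add: corr_err_def mult.commute)

lemma Re_iexp_corr: "Re (iexp s * corr j s 1) = 1 - kappa j s"
proof -
  let ?q = "1 - \<theta> j"
  have ne: "cnj (iexp s) - complex_of_real ?q \<noteq> 0"
  proof
    assume "cnj (iexp s) - complex_of_real ?q = 0"
    then have "1 = norm (complex_of_real ?q)" by (metis complex_mod_cnj eq_iff_diff_eq_0 norm_exp_i_times)
    then have "1 = \<bar>1 - \<theta> j\<bar>" by (simp only: norm_of_real)
    then show False using \<theta>_pos[of j] \<theta>_less[of j] by simp
  qed
  have u: "iexp s * cnj (iexp s) = 1" by (simp add: exp_cnj flip: exp_add)
  \<comment> \<open>Taking \<open>iexp s\<close> out of the denominator cancels it against the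
    numerator and leaves the real number \<open>\<theta> j\<close> on top, so that the real part is
    easy to read off.\<close>
  have "1 - complex_of_real ?q * iexp s = iexp s * (cnj (iexp s) - complex_of_real ?q)"
    using u by (simp only: right_diff_distrib mult.commute)
  then have "iexp s * corr j s 1 = complex_of_real (\<theta> j) / (cnj (iexp s) - complex_of_real ?q)"
    by (simp add: corr_def)
  also have "Re \<dots> = \<theta> j * (cos s - ?q) / ((cos s - ?q)\<^sup>2 + (sin s)\<^sup>2)"
    by (simp add: Re_divide Re_exp Im_exp)
  also have "(cos s - ?q)\<^sup>2 + (sin s)\<^sup>2 = (\<theta> j)\<^sup>2 + 2 * ?q * (1 - cos s)"
    using sin_cos_squared_add2[of s] by (simp add: power2_eq_square algebra_simps)
  also have "\<theta> j * (cos s - ?q) / ((\<theta> j)\<^sup>2 + 2 * ?q * (1 - cos s)) = 1 - kappa j s"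
  proof -
    have "(\<theta> j)\<^sup>2 + 2 * ?q * (1 - cos s) > 0"
      using \<theta>_pos[of j] \<theta>_less[of j] by (intro add_pos_nonneg mult_nonneg_nonneg) auto
    then show ?thesis
      unfolding kappa_def by (simp add: field_simps power2_eq_square)
  qed
  finally show ?thesis .
qed

lemma kappa_nonneg: "0 \<le> kappa j s"
  using \<theta>_pos[of j] \<theta>_less[of j]
  by (auto simp: kappa_def intro!: divide_nonneg_nonneg mult_nonneg_nonneg add_nonneg_nonneg)

lemma kappa_le: "kappa j s \<le> 2"
proof -
  have "\<bar>Re (iexp s * corr j s 1)\<bar> \<le> norm (iexp s * corr j s 1)" by (rule abs_Re_le_cmod)
  also have "\<dots> \<le> 1" using norm_corr_le[of j s 1] by (simp add: norm_mult)
  finally show ?thesis unfolding Re_iexp_corr by simp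
qed

text \<open>The compound Poisson exponent per unit time: nonzero blocks start with probability
  \<open>\<theta> j * p j\<close> per step, and \<open>kappa\<close> is the loss that each of them
  causes in the characteristic function.\<close>

definition decay :: "nat \<Rightarrow> real \<Rightarrow> real" where
  "decay j s = \<theta> j * (p j * kappa j s)"

lemma decay_bounds: "0 \<le> decay j s" "decay j s \<le> 1 / 2" "decay j s \<le> 2 * (\<theta> j * p j)"
proof -
  have "p j * kappa j s \<le> 1 / 4 * 2"
    by (rule mult_mono[OF p_le_quarter kappa_le]) (simp_all add: kappa_nonneg)
  then have "\<theta> j * (p j * kappa j s) \<le> 1 * (1 / 4 * 2)"
    by (rule mult_mono[OF less_imp_le[OF \<theta>_less]])
       (use p_pos[of j] kappa_nonneg[of j s] in \<open>simp_all add: mult_nonneg_nonneg\<close>)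
  then show "decay j s \<le> 1 / 2" by (simp add: decay_def)
  show "0 \<le> decay j s" using p_pos[of j] kappa_nonneg[of j s] \<theta>_pos[of j] by (simp add: decay_def)
  have "p j * kappa j s \<le> p j * 2" using p_pos[of j] kappa_le[of j s] by simp
  then have "\<theta> j * (p j * kappa j s) \<le> \<theta> j * (p j * 2)" using \<theta>_pos[of j] by simp
  then show "decay j s \<le> 2 * (\<theta> j * p j)" by (simp add: decay_def mult_ac)
qed

lemma resample_mean_corr:
  "resample_mean j (\<lambda>x. iexp (s * x) * corr j s x) = 1 - complex_of_real (p j * kappa j s)"
proof -
  have "iexp (s * (-1)) * corr j s (-1) = cnj (iexp (s * 1) * corr j s 1)"
    by (simp add: corr_minus exp_cnj)
  then have "iexp (s * 1) * corr j s 1 + iexp (s * (-1)) * corr j s (-1) = complex_of_real (2 * Re (iexp (s * 1) * corr j s 1))"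
    by (simp only: complex_add_cnj)
  also have "\<dots> = complex_of_real (2 * (1 - kappa j s))"
    by (simp only: mult_1_right Re_iexp_corr)
  finally have sum: "iexp (s * 1) * corr j s 1 + iexp (s * (-1)) * corr j s (-1) = complex_of_real (2 * (1 - kappa j s))" .
  show ?thesis
    unfolding resample_mean_def sum by (simp add: scaleR_conv_of_real algebra_simps)
qed

lemma integrable_iexp_comp_sum: "integrable \<Omega> (\<lambda>\<omega>. iexp (s * comp_sum j n \<omega>))"
  by (rule integrable_bounded[of _ 1]) auto

definition corr_char :: "nat \<Rightarrow> nat \<Rightarrow> real \<Rightarrow> complex" where
  "corr_char j n s = (\<integral>\<omega>. iexp (s * comp_sum j n \<omega>) * corr j s (Z j (int n) \<omega>) \<partial>\<Omega>)"

text \<open>On a hold, \<open>corr_step\<close> reproduces \<open>corr_char j n s\<close> minus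
  \<open>\<theta> j\<close> times \<open>comp_char j n s\<close>; a resampling returns that amount
  reduced by the factor \<open>1 - p j * kappa j s\<close>. Only the decay term is left
  over.\<close>

lemma corr_char_Suc: "corr_char j (Suc n) s = corr_char j n s - complex_of_real (decay j s) * comp_char j n s"
proof -
  let ?Y = "\<lambda>\<omega>. iexp (s * comp_sum j n \<omega>)" and ?\<psi> = "\<lambda>x. iexp (s * x) * corr j s x"
  note int = integrable_mult_Z[OF integrable_iexp_comp_sum[of s j n]]
  have dep: "depends_on (coords UNIV {..int n}) ?Y"
    by (rule depends_on_compose, rule depends_on_mono[OF depends_on_comp_sum]) (auto simp: coords_def)
  have "corr_char j (Suc n) s = (\<integral>\<omega>. ?Y \<omega> * ?\<psi> (Z j (int n + 1) \<omega>) \<partial>\<Omega>)"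
    unfolding corr_char_def
    by (rule Bochner_Integration.integral_cong)
       (simp_all add: comp_sum_Suc distrib_left exp_add mult_ac add.commute)
  also have "\<dots> = (1 - \<theta> j) *\<^sub>R (\<integral>\<omega>. ?Y \<omega> * ?\<psi> (Z j (int n) \<omega>) \<partial>\<Omega>) + \<theta> j *\<^sub>R ((\<integral>\<omega>. ?Y \<omega> \<partial>\<Omega>) * resample_mean j ?\<psi>)"
    by (rule one_step[OF integrable_iexp_comp_sum dep])
  also have "(1 - \<theta> j) *\<^sub>R (\<integral>\<omega>. ?Y \<omega> * ?\<psi> (Z j (int n) \<omega>) \<partial>\<Omega>) =
      (\<integral>\<omega>. ?Y \<omega> * corr j s (Z j (int n) \<omega>) - complex_of_real (\<theta> j) * ?Y \<omega> \<partial>\<Omega>)"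
  proof -
    have "(1 - \<theta> j) *\<^sub>R (\<integral>\<omega>. ?Y \<omega> * ?\<psi> (Z j (int n) \<omega>) \<partial>\<Omega>) =
        (\<integral>\<omega>. complex_of_real (1 - \<theta> j) * (?Y \<omega> * ?\<psi> (Z j (int n) \<omega>)) \<partial>\<Omega>)"
      by (simp only: scaleR_conv_of_real integral_mult_right_zero)
    also have "\<dots> = (\<integral>\<omega>. ?Y \<omega> * corr j s (Z j (int n) \<omega>) - complex_of_real (\<theta> j) * ?Y \<omega> \<partial>\<Omega>)"
    proof (rule Bochner_Integration.integral_cong[OF refl])
      fix \<omega>
      have "complex_of_real (1 - \<theta> j) * (?Y \<omega> * ?\<psi> (Z j (int n) \<omega>)) = ?Y \<omega> * (complex_of_real (1 - \<theta> j) * ?\<psi> (Z j (int n) \<omega>))"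
        by (rule mult.left_commute)
      then show "complex_of_real (1 - \<theta> j) * (?Y \<omega> * ?\<psi> (Z j (int n) \<omega>)) = ?Y \<omega> * corr j s (Z j (int n) \<omega>) - complex_of_real (\<theta> j) * ?Y \<omega>"
        unfolding corr_step by (simp add: right_diff_distrib mult.commute)
    qed
    finally show ?thesis .
  qed
  also have "\<dots> = corr_char j n s - complex_of_real (\<theta> j) * comp_char j n s"
    unfolding corr_char_def comp_char_def using int[of "corr j s" j "int n"] integrable_iexp_comp_sum
    by (subst Bochner_Integration.integral_diff) auto
  finally show ?thesis
    unfolding resample_mean_corr comp_char_def[symmetric]
    by (simp add: decay_def scaleR_conv_of_real algebra_simps)
qed

lemma norm_comp_char_minus_corr_char: "norm (comp_char j n s - corr_char j n s) \<le> corr_err j s"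
proof -
  let ?Y = "\<lambda>\<omega>. iexp (s * comp_sum j n \<omega>)"
  have "comp_char j n s - corr_char j n s = (\<integral>\<omega>. ?Y \<omega> * (1 - corr j s (Z j (int n) \<omega>)) \<partial>\<Omega>)"
    unfolding comp_char_def corr_char_def right_diff_distrib
    using integrable_iexp_comp_sum[of s j n] integrable_mult_Z[OF integrable_iexp_comp_sum[of s j n], of "corr j s" j "int n"]
    by simp
  also have "norm \<dots> \<le> (\<integral>\<omega>. norm (?Y \<omega> * (1 - corr j s (Z j (int n) \<omega>))) \<partial>\<Omega>)"
    by (rule integral_norm_bound)
  also have "\<dots> = (\<integral>\<omega>. norm (1 - corr j s (Z j (int n) \<omega>)) \<partial>\<Omega>)"
    by (simp add: norm_mult)
  also have "\<dots> = corr_err j s"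
  proof -
    have "norm (1 - corr j s (-1)) = norm (1 - corr j s 1)"
      unfolding corr_minus by (metis complex_cnj_diff complex_cnj_one complex_mod_cnj)
    then show ?thesis
      using integral_Z[of "\<lambda>x. norm (1 - corr j s x)" j "int n"] by (simp add: resample_mean_def corr_err_def)
  qed
  finally show ?thesis .
qed

text \<open>Were the two characteristic functions equal, the recursion would give an exact power.
  They differ by at most \<open>corr_err\<close>: once at time \<open>0\<close>, weighted by the
  decay in each of the \<open>n\<close> steps, and once when passing back from
  \<open>corr_char\<close>. These are the terms of the prefactor.\<close>

lemma comp_char_approx:
  "norm (comp_char j n s - complex_of_real ((1 - decay j s) ^ n)) \<le> (2 + real n * decay j s) * corr_err j s"
proof -
  let ?d = "decay j s" and ?e = "corr_err j s"
  have "norm (corr_char j n s - complex_of_real ((1 - ?d) ^ n)) \<le> (1 + real n * ?d) * ?e"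
  proof (induction n)
    case 0
    show ?case using norm_comp_char_minus_corr_char[of j 0 s] by (simp add: comp_char_def norm_minus_commute)
  next
    case (Suc n)
    have eq: "corr_char j (Suc n) s - complex_of_real ((1 - ?d) ^ Suc n) =
        complex_of_real (1 - ?d) * (corr_char j n s - complex_of_real ((1 - ?d) ^ n))
        - complex_of_real ?d * (comp_char j n s - corr_char j n s)"
    proof -
      have "a - d * f - (1 - d) * P = (1 - d) * (a - P) - d * (f - a)" for a d f P :: complex
        by (simp add: algebra_simps)
      from this[of "corr_char j n s" "complex_of_real ?d" "comp_char j n s" "complex_of_real ((1 - ?d) ^ n)"]
      show ?thesis by (simp only: corr_char_Suc power_Suc of_real_mult of_real_diff of_real_1)
    qed
    have "norm (corr_char j (Suc n) s - complex_of_real ((1 - ?d) ^ Suc n)) \<le> norm (complex_of_real (1 - ?d) * (corr_char j n s - complex_of_real ((1 - ?d) ^ n)))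
        + norm (complex_of_real ?d * (comp_char j n s - corr_char j n s))"
      unfolding eq by (rule norm_triangle_ineq4)
    also have "\<dots> \<le> 1 * ((1 + real n * ?d) * ?e) + ?d * ?e"
      unfolding norm_mult norm_of_real
      using decay_bounds[of j s] Suc norm_comp_char_minus_corr_char[of j n s] by (intro add_mono mult_mono) auto
    finally show ?case by (simp add: algebra_simps)
  qed
  then show ?thesis
    using norm_comp_char_minus_corr_char[of j n s]
      norm_triangle_ineq[of "comp_char j n s - corr_char j n s" "corr_char j n s - complex_of_real ((1 - ?d) ^ n)"]
    by (simp add: algebra_simps)
qed

text \<open>General weights were allowed in \<open>wsum\<close> so that the sum without component
  \<open>j\<close> is again of that form, with \<open>c j\<close> set to zero.\<close>

lemma wsum_split:
  assumes c: "\<And>i. \<bar>c i\<bar> \<le> 1 / 4 ^ i"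
  shows "wsum c n \<omega> = c j * comp_sum j n \<omega> + wsum (c(j := 0)) n \<omega>"
proof -
  let ?c = "c(j := 0)"
  have c': "\<bar>?c i\<bar> \<le> 1 / 4 ^ i" for i using c by simp
  have "(\<lambda>i. (if i = j then c j * comp_sum j n \<omega> else 0) + ?c i * comp_sum i n \<omega>) sums (c j * comp_sum j n \<omega> + wsum ?c n \<omega>)"
    unfolding wsum_def by (intro sums_add sums_single summable_sums wsum_bounds c')
  moreover have "(\<lambda>i. (if i = j then c j * comp_sum j n \<omega> else 0) + ?c i * comp_sum i n \<omega>) = (\<lambda>i. c i * comp_sum i n \<omega>)"
    by auto
  ultimately show ?thesis by (simp add: wsum_def sums_iff)
qed

text \<open>Component \<open>j\<close> is independent of all the others, so the characteristic
  function factors, and the factor of the others has modulus at most one.\<close>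

lemma norm_char_wsum_le:
  assumes c: "\<And>i. \<bar>c i\<bar> \<le> 1 / 4 ^ i"
  shows "norm (\<integral>\<omega>. iexp (s * wsum c n \<omega>) \<partial>\<Omega>) \<le> norm (comp_char j n (s * c j))"
proof -
  let ?c = "c(j := 0)"
  note split = wsum_split[OF c, of n _ j]
  have dep: "depends_on (coords (- {j}) UNIV) (wsum ?c n)"
  proof (rule depends_onI)
    fix \<omega> \<omega>' :: "int \<Rightarrow> real" assume eq: "\<And>i. i \<in> coords (- {j}) UNIV \<Longrightarrow> \<omega> i = \<omega>' i"
    have "?c i * comp_sum i n \<omega> = ?c i * comp_sum i n \<omega>'" for i
    proof (cases "i = j")
      case False
      have "comp_sum i n \<omega> = comp_sum i n \<omega>'"
        by (rule depends_onD[OF depends_on_comp_sum], rule eq) (use False in \<open>auto simp: coords_def\<close>)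
      then show ?thesis by simp
    qed simp
    then show "wsum ?c n \<omega> = wsum ?c n \<omega>'" by (simp only: wsum_def)
  qed
  have ind: "indep_var borel (\<lambda>\<omega>. iexp (s * c j * comp_sum j n \<omega>)) borel (\<lambda>\<omega>. iexp (s * wsum ?c n \<omega>))"
    by (rule indep_var_coords[OF _ _ depends_on_compose[OF depends_on_comp_sum] depends_on_compose[OF dep]])
       (auto intro!: coords_disjoint)
  have "(\<integral>\<omega>. iexp (s * wsum c n \<omega>) \<partial>\<Omega>) = (\<integral>\<omega>. iexp (s * c j * comp_sum j n \<omega>) * iexp (s * wsum ?c n \<omega>) \<partial>\<Omega>)"
    by (subst split) (simp add: distrib_left exp_add mult_ac)
  also have "\<dots> = comp_char j n (s * c j) * (\<integral>\<omega>. iexp (s * wsum ?c n \<omega>) \<partial>\<Omega>)"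
    unfolding comp_char_def
    by (rule indep_var_lebesgue_integral[OF ind]) (rule integrable_bounded[of _ 1]; simp)+
  also have "norm \<dots> \<le> norm (comp_char j n (s * c j)) * 1"
  proof -
    have "norm (\<integral>\<omega>. iexp (s * wsum ?c n \<omega>) \<partial>\<Omega>) \<le> (\<integral>\<omega>. norm (iexp (s * wsum ?c n \<omega>)) \<partial>\<Omega>)"
      by (rule integral_norm_bound)
    also have "\<dots> = 1" by (simp only: norm_exp_i_times) simp
    finally show ?thesis unfolding norm_mult by (intro mult_left_mono) auto
  qed
  finally show ?thesis by simp
qed

end

text \<open>
  The indicator of an interval is dominated by a multiple of a Gaussian density, which is itself
  the Fourier transform of a Gaussian measure.
\<close>

lemma (in prob_space) concentration_le:
  assumes Y[measurable]: "Y \<in> borel_measurable M" and c: "c > 0"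
  shows "prob {\<omega> \<in> space M. r - c < Y \<omega> \<and> Y \<omega> < r + c} \<le>
    exp (1 / 2) * (\<integral>u. norm (\<integral>\<omega>. iexp (u / c * Y \<omega>) \<partial>M) \<partial>std_normal_distribution)"
proof -
  let ?N = std_normal_distribution
  interpret N: real_distribution ?N by (rule real_dist_normal_dist)
  interpret P: pair_prob_space ?N M ..
  let ?f = "\<lambda>u \<omega>. iexp ((Y \<omega> - r) / c * u)"
  let ?G = "\<lambda>\<omega>. exp (- ((Y \<omega> - r) / c)\<^sup>2 / 2)"
  have G: "complex_of_real (?G \<omega>) = (\<integral>u. ?f u \<omega> \<partial>?N)" for \<omega>
    using fun_cong[OF char_std_normal_distribution, of "(Y \<omega> - r) / c"] by (simp add: char_def)
  have int2: "integrable (?N \<Otimes>\<^sub>M M) (\<lambda>(u, \<omega>). ?f u \<omega>)"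
    by (rule P.integrable_const_bound[of _ 1]) (auto simp: split_beta')
  have intG: "integrable M ?G"
    by (rule integrable_const_bound[of _ 1]) auto
  have "prob {\<omega> \<in> space M. r - c < Y \<omega> \<and> Y \<omega> < r + c} = (\<integral>\<omega>. indicator {\<omega> \<in> space M. r - c < Y \<omega> \<and> Y \<omega> < r + c} \<omega> \<partial>M)"
    by (subst Bochner_Integration.integral_indicator) (auto intro!: arg_cong[where f=prob])
  also have "\<dots> \<le> (\<integral>\<omega>. exp (1 / 2) * ?G \<omega> \<partial>M)"
  proof (rule integral_mono)
    show "integrable M (\<lambda>\<omega>. indicator {\<omega> \<in> space M. r - c < Y \<omega> \<and> Y \<omega> < r + c} \<omega> :: real)"
      by (rule integrable_real_indicator) (auto simp: emeasure_eq_measure)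
    show "integrable M (\<lambda>\<omega>. exp (1 / 2) * ?G \<omega>)" using intG by simp
    fix \<omega>
    show "indicator {\<omega> \<in> space M. r - c < Y \<omega> \<and> Y \<omega> < r + c} \<omega> \<le> exp (1 / 2) * ?G \<omega>"
    proof (cases "r - c < Y \<omega> \<and> Y \<omega> < r + c")
      case True
      then have "\<bar>(Y \<omega> - r) / c\<bar> \<le> 1" using c by (simp add: abs_le_iff divide_le_eq)  
      then have "((Y \<omega> - r) / c)\<^sup>2 \<le> 1\<^sup>2" by (rule square_le_square)
      \<comment> \<open>On the interval the Gaussian factor is at least
        \<open>exp (- 1 / 2)\<close>; this is the origin of the constant.\<close>
      then have "1 \<le> exp (1 / 2 + - ((Y \<omega> - r) / c)\<^sup>2 / 2)" by simp
      then show ?thesis unfolding exp_add by (simp split: split_indicator)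
    qed (auto simp: indicator_def)
  qed
  also have "\<dots> = exp (1 / 2) * (\<integral>\<omega>. ?G \<omega> \<partial>M)" by simp
  also have "(\<integral>\<omega>. ?G \<omega> \<partial>M) \<le> (\<integral>u. norm (\<integral>\<omega>. iexp (u / c * Y \<omega>) \<partial>M) \<partial>?N)"
  proof -
    have "(\<integral>\<omega>. ?G \<omega> \<partial>M) \<le> norm (complex_of_real (\<integral>\<omega>. ?G \<omega> \<partial>M))" by simp
    also have "complex_of_real (\<integral>\<omega>. ?G \<omega> \<partial>M) = (\<integral>\<omega>. complex_of_real (?G \<omega>) \<partial>M)"
      by (rule integral_complex_of_real[symmetric])
    also have "\<dots> = (\<integral>\<omega>. (\<integral>u. ?f u \<omega> \<partial>?N) \<partial>M)" by (simp only: G)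
    also have "\<dots> = (\<integral>u. (\<integral>\<omega>. ?f u \<omega> \<partial>M) \<partial>?N)" by (rule P.Fubini_integral[OF int2])
    also have "norm \<dots> \<le> (\<integral>u. norm (\<integral>\<omega>. ?f u \<omega> \<partial>M) \<partial>?N)" by (rule integral_norm_bound)
    also have "\<dots> = (\<integral>u. norm (\<integral>\<omega>. iexp (u / c * Y \<omega>) \<partial>M) \<partial>?N)"
    proof (rule Bochner_Integration.integral_cong[OF refl])
      fix u
      \<comment> \<open>The centre \<open>r\<close> enters only through a factor of modulus one, so
        the bound is uniform in \<open>r\<close>, as the supremum requires.\<close>
      have "(\<integral>\<omega>. ?f u \<omega> \<partial>M) = (\<integral>\<omega>. iexp (- r * u / c) * iexp (u / c * Y \<omega>) \<partial>M)"
      proof (rule Bochner_Integration.integral_cong[OF refl])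
        fix \<omega>
        have "(Y \<omega> - r) / c * u = - r * u / c + u / c * Y \<omega>" by (simp add: diff_divide_distrib algebra_simps)
        then show "?f u \<omega> = iexp (- r * u / c) * iexp (u / c * Y \<omega>)"
          by (simp only: of_real_add distrib_left exp_add)
      qed
      also have "\<dots> = iexp (- r * u / c) * (\<integral>\<omega>. iexp (u / c * Y \<omega>) \<partial>M)" by simp
      finally show "norm (\<integral>\<omega>. ?f u \<omega> \<partial>M) = norm (\<integral>\<omega>. iexp (u / c * Y \<omega>) \<partial>M)"
        by (simp only: norm_mult norm_exp_i_times mult_1)
    qed
    finally show ?thesis .
  qed
  finally show ?thesis by simp
qed

section \<open>The limit law\<close>

text \<open>The characteristic function of the standard exponential law, which is one half of the
  Laplace law up to normalization.\<close>

lemma exp_half_line_integral: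
  fixes t :: real
  defines "f \<equiv> \<lambda>x::real. exp ((\<i> * complex_of_real t - 1) * complex_of_real x)"
  shows "has_bochner_integral lborel (\<lambda>x. indicator {0<..} x *\<^sub>R f x) (1 / (1 - \<i> * complex_of_real t))"
proof -
  let ?c = "\<i> * complex_of_real t - 1"
  have c: "?c \<noteq> 0" by (simp add: complex_eq_iff)
  have norm_f: "norm (f x) = exp (- x)" for x
    by (simp add: f_def)
  have lim: "((\<lambda>x::real. exp (- x)) \<longlongrightarrow> 0) at_top"
    by (rule filterlim_compose[OF exp_at_bot filterlim_uminus_at_bot_at_top])
  \<comment> \<open>The fundamental theorem for the complex integrand presupposes integrability. It
    is inherited from the modulus \<open>exp (- x)\<close>, for which the nonnegative version proves
    it.\<close>
  have e: "set_integrable lborel (einterval 0 \<infinity>) (\<lambda>x. exp (- x) :: real)"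
  proof (rule interval_integral_FTC_nonneg(1))
    show "DERIV (\<lambda>x. - exp (- x)) x :> exp (- x)" for x :: real
      by (auto intro!: derivative_eq_intros)
    show "((((\<lambda>x::real. - exp (- x)) \<circ> real_of_ereal)) \<longlongrightarrow> -1) (at_right 0)"
      unfolding zero_ereal_def ereal_tendsto_simps
      by (rule tendsto_eq_rhs[OF tendsto_within_subset[OF isContD]]) auto
    show "((((\<lambda>x::real. - exp (- x)) \<circ> real_of_ereal)) \<longlongrightarrow> 0) (at_left \<infinity>)"
      unfolding ereal_tendsto_simps using tendsto_minus[OF lim] by simp
  qed auto
  have fm: "f \<in> borel_measurable borel"
    unfolding f_def by (intro borel_measurable_continuous_onI continuous_intros)
  have int: "set_integrable lborel (einterval 0 \<infinity>) f"
    using e unfolding set_integrable_def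
    by (rule Bochner_Integration.integrable_bound) (use fm norm_f in \<open>auto split: split_indicator\<close>)
  have "(LBINT x=0..\<infinity>. f x) = 0 - 1 / ?c"
  proof (rule interval_integral_FTC_integrable[where F="\<lambda>x. f x / ?c"])
    show "((\<lambda>x. f x / ?c) has_vector_derivative f x) (at x)" for x
    proof -
      have "((\<lambda>z. exp (?c * z) / ?c) has_field_derivative exp (?c * of_real x)) (at (complex_of_real x))"
        using c by (auto intro!: derivative_eq_intros)
      then show ?thesis unfolding f_def by (rule has_vector_derivative_real_field)
    qed
    show "isCont f x" for x unfolding f_def by (intro continuous_intros)
    have "isCont (\<lambda>x. f x / ?c) 0" unfolding f_def using c by (intro continuous_intros) auto
    then have "((\<lambda>x. f x / ?c) \<longlongrightarrow> f 0 / ?c) (at_right 0)"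
      unfolding isCont_def by (rule filterlim_mono) (auto intro: at_le)
    then show "((((\<lambda>x. f x / ?c) \<circ> real_of_ereal)) \<longlongrightarrow> 1 / ?c) (at_right 0)"
      unfolding zero_ereal_def ereal_tendsto_simps by (simp add: f_def)
    have "((\<lambda>x. exp (- x) / norm ?c) \<longlongrightarrow> 0) at_top"
      by (rule tendsto_divide_zero[OF lim])
    then have "((\<lambda>x. f x / ?c) \<longlongrightarrow> 0) at_top"
      by (rule Lim_null_comparison[rotated]) (simp add: norm_f norm_divide)
    then show "((((\<lambda>x. f x / ?c) \<circ> real_of_ereal)) \<longlongrightarrow> 0) (at_left \<infinity>)"
      unfolding ereal_tendsto_simps .
  qed (use int in auto)
  then have "(\<integral>x. indicator {0<..} x *\<^sub>R f x \<partial>lborel) = - 1 / ?c"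
    by (simp add: interval_lebesgue_integral_def set_lebesgue_integral_def einterval_eq zero_ereal_def)
  also have "\<dots> = 1 / (1 - \<i> * complex_of_real t)"
    using c by (simp add: field_simps)
  finally have val: "(\<integral>x. indicator {0<..} x *\<^sub>R f x \<partial>lborel) = 1 / (1 - \<i> * complex_of_real t)" .
  from int have "integrable lborel (\<lambda>x. indicator {0<..} x *\<^sub>R f x)"
    by (simp add: set_integrable_def einterval_eq zero_ereal_def)
  with val show ?thesis by (simp add: has_bochner_integral_iff)
qed

text \<open>The line is cut at \<open>0\<close>. Reflection turns the negative half into the
  half-line integral with parameter \<open>- t\<close>, and the two values are combined by partial
  fractions; the cut point is a null set.\<close>

lemma laplace_fourier:
  "has_bochner_integral lborel (\<lambda>x. (1 / 2 * exp (- \<bar>x\<bar>)) *\<^sub>R iexp (t * x)) (1 / (1 + (complex_of_real t)\<^sup>2))"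
proof -
  let ?f = "\<lambda>t x::real. indicator {0<..} x *\<^sub>R exp ((\<i> * complex_of_real t - 1) * complex_of_real x)"
  note A = exp_half_line_integral[of t]
  have B: "has_bochner_integral lborel (\<lambda>x. ?f (- t) (- x)) (1 / (1 + \<i> * complex_of_real t))"
    using exp_half_line_integral[of "- t"]
      lborel_has_bochner_integral_real_affine_iff[of "-1" "?f (- t)" "1 / (1 + \<i> * complex_of_real t)" 0] by simp
  have "has_bochner_integral lborel (\<lambda>x. (1 / 2) *\<^sub>R (?f t x + ?f (- t) (- x)))
      ((1 / 2) *\<^sub>R (1 / (1 - \<i> * complex_of_real t) + 1 / (1 + \<i> * complex_of_real t)))"
    by (intro has_bochner_integral_scaleR_right has_bochner_integral_add A B)
  also have "(1 / 2) *\<^sub>R (1 / (1 - \<i> * complex_of_real t) + 1 / (1 + \<i> * complex_of_real t)) = 1 / (1 + (complex_of_real t)\<^sup>2)"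
  proof -
    have ne: "1 - \<i> * complex_of_real t \<noteq> 0" "1 + \<i> * complex_of_real t \<noteq> 0"
      by (simp_all add: complex_eq_iff)
    have prod: "(1 - \<i> * complex_of_real t) * (1 + \<i> * complex_of_real t) = 1 + (complex_of_real t)\<^sup>2"
      by (simp add: algebra_simps power2_eq_square)
    have "1 / (1 - \<i> * complex_of_real t) + 1 / (1 + \<i> * complex_of_real t) = 2 / ((1 - \<i> * complex_of_real t) * (1 + \<i> * complex_of_real t))"
      using ne by (simp add: add_frac_eq)
    then show ?thesis unfolding prod by (simp add: scaleR_conv_of_real)
  qed
  finally have C: "has_bochner_integral lborel (\<lambda>x. (1 / 2) *\<^sub>R (?f t x + ?f (- t) (- x))) (1 / (1 + (complex_of_real t)\<^sup>2))" .
  show ?thesis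
  proof (rule has_bochner_integralI_AE[OF C])
    show "AE x in lborel. (1 / 2) *\<^sub>R (?f t x + ?f (- t) (- x)) = (1 / 2 * exp (- \<bar>x\<bar>)) *\<^sub>R iexp (t * x)"
      using AE_lborel_singleton[of 0]
    proof eventually_elim
      fix x :: real assume "x \<noteq> 0"
      then show "(1 / 2) *\<^sub>R (?f t x + ?f (- t) (- x)) = (1 / 2 * exp (- \<bar>x\<bar>)) *\<^sub>R iexp (t * x)"
        by (cases "x > 0") (auto simp: scaleR_conv_of_real exp_of_real[symmetric] exp_add[symmetric] algebra_simps)
    qed
  qed measurable
qed

lemma sets_laplace [simp, measurable_cong]: "sets laplace_measure = sets borel"
  by (simp add: laplace_measure_def)

lemma real_distribution_laplace: "real_distribution laplace_measure"
proof -
  \<comment> \<open>The transform at frequency \<open>0\<close> gives the total mass of the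
    density.\<close>
  have "has_bochner_integral lborel (\<lambda>x. Re ((1 / 2 * exp (- \<bar>x\<bar>)) *\<^sub>R iexp (0 * x))) (Re (1 / (1 + (complex_of_real 0)\<^sup>2)))"
    by (rule has_bochner_integral_Re[OF laplace_fourier])
  then have h: "has_bochner_integral lborel (\<lambda>x::real. 1 / 2 * exp (- \<bar>x\<bar>)) 1" by simp
  have "emeasure laplace_measure UNIV = (\<integral>\<^sup>+x. ennreal (1 / 2 * exp (- \<bar>x\<bar>)) \<partial>lborel)"
    unfolding laplace_measure_def by (subst emeasure_density) auto
  also have "\<dots> = ennreal 1"
    using h by (subst nn_integral_eq_integral) (auto simp: has_bochner_integral_iff)
  finally have "prob_space laplace_measure"
    by (intro prob_spaceI) (simp add: laplace_measure_def)
  then show ?thesis by (simp add: real_distribution_def real_distribution_axioms_def laplace_measure_def)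
qed

lemma char_laplace: "char laplace_measure t = complex_of_real (1 / (1 + t\<^sup>2))"
proof -
  have "char laplace_measure t = (\<integral>x. (1 / 2 * exp (- \<bar>x\<bar>)) *\<^sub>R iexp (t * x) \<partial>lborel)"
    unfolding char_def laplace_measure_def by (rule integral_density) auto
  also have "\<dots> = 1 / (1 + (complex_of_real t)\<^sup>2)"
    using laplace_fourier[of t] by (simp only: has_bochner_integral_iff)
  finally show ?thesis by simp
qed

lemma poisson_power_mean:
  "(\<integral>n. complex_of_real c ^ n \<partial>measure_pmf (poisson_pmf 1)) = complex_of_real (exp (c - 1))" if "\<bar>c\<bar> \<le> 1" for c :: real
proof -
  have sums: "(\<lambda>n. c ^ n / fact n * exp (- 1)) sums (exp c * exp (-1))"
    using sums_mult2[OF exp_converges[of c], of "exp (- 1)"] by (simp add: divide_inverse mult.commute)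
  have summ: "summable (\<lambda>n. norm (c ^ n / fact n * exp (- 1)))"
  proof -
    have "summable (\<lambda>n. norm (c ^ n / fact n))" 
      using summable_norm_exp[of c] by (simp add: divide_inverse mult.commute)
    from summable_mult2[OF this, of "exp (-1)"] show ?thesis by (simp add: abs_mult)
  qed
  have "(\<integral>n. complex_of_real c ^ n \<partial>measure_pmf (poisson_pmf 1)) = complex_of_real (\<integral>n. c ^ n \<partial>measure_pmf (poisson_pmf 1))"
    by (simp flip: of_real_power)
  also have "(\<integral>n. c ^ n \<partial>measure_pmf (poisson_pmf 1)) = (\<integral>n. c ^ n / fact n * exp (- 1) \<partial>count_space UNIV)"
    unfolding measure_pmf_eq_density
    by (subst integral_density) (auto intro!: Bochner_Integration.integral_cong)
  also have "\<dots> = (\<Sum>n. c ^ n / fact n * exp (- 1))"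
    using summ by (intro integral_count_space_nat) (simp add: integrable_count_space_nat_iff)
  also have "\<dots> = exp (c - 1)" using sums by (simp add: sums_iff exp_diff exp_minus divide_inverse)
  finally show ?thesis .
qed

lemma compound_sum_measurable:
  "(\<lambda>(N, \<eta>). \<Sum>k=1..N. \<eta> k) \<in> borel_measurable (measure_pmf (poisson_pmf 1) \<Otimes>\<^sub>M (\<Pi>\<^sub>M k\<in>(UNIV::nat set). laplace_measure))"
proof -
  have "(\<lambda>\<eta>. \<Sum>k=1..N. \<eta> k) \<in> borel_measurable (\<Pi>\<^sub>M k\<in>(UNIV::nat set). laplace_measure)" for N
  proof (rule borel_measurable_sum)
    fix k assume "k \<in> {1..N}"
    have "(\<lambda>\<eta>. \<eta> k) \<in> (\<Pi>\<^sub>M k\<in>(UNIV::nat set). laplace_measure) \<rightarrow>\<^sub>M laplace_measure"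
      by (rule measurable_component_singleton) simp
    then show "(\<lambda>\<eta>. \<eta> k) \<in> borel_measurable (\<Pi>\<^sub>M k\<in>(UNIV::nat set). laplace_measure)"
      by (simp add: measurable_cong_sets[OF refl sets_laplace])
  qed
  then have "(\<lambda>(N, \<eta>). \<Sum>k=1..N. \<eta> k) \<in> borel_measurable (count_space UNIV \<Otimes>\<^sub>M (\<Pi>\<^sub>M k\<in>(UNIV::nat set). laplace_measure))"
    by (intro measurable_pair_measure_countable1) auto
  then show ?thesis
    by (simp cong: measurable_cong_sets add: sets_pair_measure_cong[OF sets_measure_pmf_count_space refl])
qed

lemma real_distribution_P1sL: "real_distribution mu_P1sL"
proof -
  interpret L: prob_space "\<Pi>\<^sub>M k\<in>(UNIV::nat set). laplace_measure"
    by (rule prob_space_PiM) (use real_distribution_laplace in \<open>simp add: real_distribution_def\<close>)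
  interpret P: pair_prob_space "measure_pmf (poisson_pmf 1)" "\<Pi>\<^sub>M k\<in>(UNIV::nat set). laplace_measure" ..
  show ?thesis
    unfolding mu_P1sL_def by (rule P.real_distribution_distr[OF compound_sum_measurable])
qed

text \<open>For a fixed number \<open>n\<close> of summands independence gives the
  \<open>n\<close>-th power of the Laplace transform; integrating over the Poisson number evaluates
  its generating function at \<open>1 / (1 + t\<^sup>2)\<close>.\<close>

lemma char_P1sL: "char mu_P1sL t = complex_of_real (exp (1 / (1 + t\<^sup>2) - 1))"
proof -
  let ?L = "\<Pi>\<^sub>M k\<in>(UNIV::nat set). laplace_measure"
  let ?Q = "measure_pmf (poisson_pmf 1)"
  have lap: "prob_space laplace_measure" using real_distribution_laplace by (simp add: real_distribution_def)
  interpret L: prob_space ?L by (rule prob_space_PiM) (rule lap)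
  interpret P: pair_prob_space ?Q ?L ..
  interpret PP: product_prob_space "\<lambda>_. laplace_measure" "UNIV :: nat set"
    by (rule product_prob_spaceI) (rule lap)
  have comp: "(\<lambda>\<eta>. \<eta> k) \<in> borel_measurable ?L" for k
    using measurable_component_singleton[of k UNIV "\<lambda>_. laplace_measure"]
    by (simp add: measurable_cong_sets[OF refl sets_laplace])
  have distr_comp: "distr ?L borel (\<lambda>\<eta>. \<eta> k) = laplace_measure" for k
  proof -
    have "distr ?L borel (\<lambda>\<eta>. \<eta> k) = distr ?L laplace_measure (\<lambda>\<eta>. \<eta> k)" by (rule distr_cong) simp_all
    then show ?thesis using PP.PiM_component[of k] by simp
  qed
  have inner: "(\<integral>\<eta>. iexp (t * (\<Sum>k=1..n. \<eta> k)) \<partial>?L) = complex_of_real (1 / (1 + t\<^sup>2)) ^ n" for n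
  proof -
    have ind: "L.indep_vars (\<lambda>_. laplace_measure) (\<lambda>i \<omega>. \<omega> i) {1..n}"
      by (rule L.indep_vars_subset[OF indep_vars_PiM_coordinates]) (use lap in auto)
    then have "L.indep_vars (\<lambda>_. borel) (\<lambda>i \<omega>. \<omega> i) {1..n}"
      using L.indep_vars_compose2[OF ind, of "\<lambda>_ x. x" "\<lambda>_. borel"] by simp
    from L.char_distr_sum[OF this, of t] show ?thesis
      using comp by (simp add: char_def[of "distr _ _ _"] integral_distr distr_comp char_laplace)
  qed
  have "char mu_P1sL t = (\<integral>x. iexp (t * (case x of (N, \<eta>) \<Rightarrow> \<Sum>k=1..N. \<eta> k)) \<partial>(?Q \<Otimes>\<^sub>M ?L))"
    unfolding char_def mu_P1sL_def by (rule integral_distr[OF compound_sum_measurable]) simp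
  also have "\<dots> = (\<integral>n. (\<integral>\<eta>. iexp (t * (\<Sum>k=1..n. \<eta> k)) \<partial>?L) \<partial>?Q)"
  proof -
    have "integrable (?Q \<Otimes>\<^sub>M ?L) (\<lambda>x. iexp (t * (case x of (N, \<eta>) \<Rightarrow> \<Sum>k=1..N. \<eta> k)))"
      using compound_sum_measurable by (intro P.integrable_const_bound[of _ 1]) auto
    from P.integral_fst'[OF this] show ?thesis by simp
  qed
  also have "\<dots> = complex_of_real (exp (1 / (1 + t\<^sup>2) - 1))"
    unfolding inner by (rule poisson_power_mean) (use add_pos_nonneg[of 1 "t\<^sup>2"] in \<open>simp add: abs_le_iff divide_le_eq\<close>)
  finally show ?thesis .
qed

section \<open>Scale separation\<close>

text \<open>Consecutive values have ratio \<open>real (Suc j) ^ 3\<close>. The \<open>J\<close>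
  earlier weights are each at most the last of them, so their sum is smaller than
  \<open>weight J\<close> by a factor of the square of \<open>J\<close>, which tends to
  infinity.\<close>

definition weight :: "nat \<Rightarrow> real" where
  "weight j = fact j ^ 3"

lemma weight_ge_1: "weight j \<ge> 1"
  by (simp add: weight_def)

lemma weight_pos: "weight j > 0"
  using weight_ge_1[of j] by linarith

lemma weight_Suc: "weight (Suc j) = real (Suc j) ^ 3 * weight j"
  by (simp add: weight_def power_mult_distrib)

lemma weight_mono: "i \<le> j \<Longrightarrow> weight i \<le> weight j"
  unfolding weight_def by (intro power_mono fact_mono) auto

lemma weight_ge: "weight j \<ge> real j"
proof -
  have "real j \<le> real (fact j)" using fact_ge_self[of j] by (simp only: of_nat_le_iff)
  also have "\<dots> \<le> weight j"
    using self_le_power[of "fact j :: real" 3] by (simp add: weight_def)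
  finally show ?thesis .
qed

lemma sum_weight_less: "J \<ge> 1 \<Longrightarrow> (\<Sum>j<J. weight j) \<le> weight J / (real J)\<^sup>2"
proof -
  assume "J \<ge> 1"
  then obtain i where J: "J = Suc i" by (cases J) auto
  have "(\<Sum>j<J. weight j) \<le> (\<Sum>j<J. weight i)" by (intro sum_mono weight_mono) (simp add: J)
  also have "\<dots> = weight J / (real J)\<^sup>2"
    by (simp add: J weight_Suc power2_eq_square power3_eq_cube del: of_nat_Suc)
  finally show ?thesis .
qed

text \<open>After taking logarithms, \<open>ln (1 - d n)\<close> lies between
  \<open>- d n - 2 * (d n)\<^sup>2\<close> and \<open>- d n\<close>; the lower estimate is where
  \<open>d n \<le> 1 / 2\<close> enters, and the quadratic term vanishes because \<open>d\<close>
  tends to zero.\<close>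

lemma power_one_minus_tendsto_exp:
  fixes d :: "nat \<Rightarrow> real" and m :: "nat \<Rightarrow> nat"
  assumes d: "\<And>n. 0 \<le> d n" "\<And>n. d n \<le> 1 / 2" and d0: "d \<longlonglongrightarrow> 0" and md: "(\<lambda>n. real (m n) * d n) \<longlonglongrightarrow> k"
  shows "(\<lambda>n. (1 - d n) ^ m n) \<longlonglongrightarrow> exp (- k)"
proof -
  have "(\<lambda>n. real (m n) * ln (1 - d n)) \<longlonglongrightarrow> - k"
  proof (rule tendsto_sandwich)
    show "(\<lambda>n. - (real (m n) * d n) - 2 * (real (m n) * d n) * d n) \<longlonglongrightarrow> - k"
      using tendsto_diff[OF tendsto_minus[OF md] tendsto_mult[OF tendsto_mult[OF tendsto_const[of 2] md] d0]] by simp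
    show "(\<lambda>n. - (real (m n) * d n)) \<longlonglongrightarrow> - k" by (rule tendsto_minus[OF md])
    show "\<forall>\<^sub>F n in sequentially. - (real (m n) * d n) - 2 * (real (m n) * d n) * d n \<le> real (m n) * ln (1 - d n)"
    proof (rule always_eventually, rule allI)
      fix n
      have "- d n - 2 * (d n)\<^sup>2 \<le> ln (1 - d n)" by (rule ln_one_minus_pos_lower_bound[OF d])
      from mult_left_mono[OF this, of "real (m n)"]
      show "- (real (m n) * d n) - 2 * (real (m n) * d n) * d n \<le> real (m n) * ln (1 - d n)"
        by (simp add: power2_eq_square algebra_simps)
    qed
    show "\<forall>\<^sub>F n in sequentially. real (m n) * ln (1 - d n) \<le> - (real (m n) * d n)"
    proof (rule always_eventually, rule allI)
      fix n
      have "ln (1 - d n) \<le> - d n" using ln_add_one_self_le_self2[of "- d n"] d[of n] by simp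
      from mult_left_mono[OF this, of "real (m n)"]
      show "real (m n) * ln (1 - d n) \<le> - (real (m n) * d n)" by simp
    qed
  qed
  then have "(\<lambda>n. exp (real (m n) * ln (1 - d n))) \<longlonglongrightarrow> exp (- k)" by (rule tendsto_exp)
  moreover have "exp (real (m n) * ln (1 - d n)) = (1 - d n) ^ m n" for n
  proof -
    have "1 - d n > 0" using d(2)[of n] by linarith
    then show ?thesis by (simp add: exp_of_nat_mult)
  qed
  ultimately show ?thesis by simp
qed

text \<open>
  Component \<open>j\<close> contributes about \<open>min (n * p j / 16 ^ j) (2 * weight j)\<close> to the variance per unit
  time at horizon \<open>n\<close>; \<open>weight\<close> grows so fast that the last saturated component dominates.
\<close>

locale reversible_example = hold_resample +
  fixes g :: "nat \<Rightarrow> real"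
  assumes \<theta>_eq: "\<theta> j = p j / (16 ^ j * weight j)"
    and p_tail: "i > j \<Longrightarrow> p i \<le> (p j)\<^sup>2 / 4 ^ (i + j)"
    and g_bound: "n \<ge> 1 \<Longrightarrow> min (real n * p j) (16 ^ j * weight j) \<le> g n / 2 ^ (j + 3)"
    and g_pos: "n \<ge> 1 \<Longrightarrow> g n > 0"
begin

section \<open>Variance and mixing bounds for the chosen parameters\<close>

lemma p_over_\<theta>: "p j / \<theta> j = 16 ^ j * weight j"
  using p_pos[of j] weight_pos[of j] by (simp add: \<theta>_eq)

lemma \<theta>_le_p: "\<theta> j \<le> p j"
proof -
  have "1 * 1 \<le> 16 ^ j * weight j" using weight_ge_1[of j] by (intro mult_mono) auto
  then show ?thesis using p_pos[of j] by (simp add: \<theta>_eq divide_le_eq mult_le_cancel_left1)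
qed

lemma square_inverse_power: "(1 / 4 ^ j :: real)\<^sup>2 = 1 / 16 ^ j"
  by (simp add: power_divide power_mult[symmetric] power_mult_distrib[symmetric] power2_eq_square)

lemma power_2_sums: "(\<lambda>j. C / 2 ^ (j + 3)) sums (C / 4 :: real)"
proof -
  have "(\<lambda>j. C / 8 * (1 / 2) ^ j) sums (C / 8 * (1 / (1 - 1 / 2)))"
    by (intro sums_mult geometric_sums) simp
  then show ?thesis by (simp add: power_add power_divide mult.commute)
qed

text \<open>The quadratic and the linear bound together give \<open>2 * real n\<close> times the
  minimum in \<open>g_bound\<close>, and the factors \<open>1 / 2 ^ (j + 3)\<close> sum to
  \<open>1 / 4\<close>.\<close>

lemma variance_le:
  assumes n: "n \<ge> 1"
  shows "variance (partial_sum X n) / real n \<le> g n"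
proof -
  have "variance (partial_sum X n) \<le> 2 * real n * (g n / 4)"
  proof (rule sums_le[OF _ variance_sums sums_mult[OF power_2_sums]])
    fix j
    have "(1 / 4 ^ j)\<^sup>2 * comp_var j n \<le> comp_var j n"
    proof -
      have "(1 / 4 ^ j)\<^sup>2 \<le> (1::real)" by (simp add: square_inverse_power)
      from mult_right_mono[OF this comp_var_nonneg] show ?thesis by simp
    qed
    also have "\<dots> \<le> 2 * real n * min (real n * p j) (16 ^ j * weight j)"
    proof -
      have "comp_var j n \<le> 2 * real n * (real n * p j)"
      proof -
        have "p j * (real n)\<^sup>2 \<le> 2 * (p j * (real n)\<^sup>2)" using p_pos[of j] by simp
        then have "comp_var j n \<le> 2 * (p j * (real n)\<^sup>2)" using comp_var_le_square[of j n] by linarith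
        then show ?thesis by (simp add: power2_eq_square mult_ac)
      qed
      then show ?thesis using comp_var_le_linear[of j n] unfolding p_over_\<theta> by (simp add: min_def)
    qed
    also have "\<dots> \<le> 2 * real n * (g n / 2 ^ (j + 3))"
      using g_bound[OF n] by (intro mult_left_mono) auto
    finally show "(1 / 4 ^ j)\<^sup>2 * comp_var j n \<le> 2 * real n * (g n / 2 ^ (j + 3))" .
  qed
  also have "\<dots> \<le> real n * g n" using g_pos[OF n] by simp
  finally show ?thesis using n by (simp add: divide_le_eq mult.commute)
qed

text \<open>By Bernoulli, \<open>(1 + real n * \<theta> j) * (1 - \<theta> j) ^ n\<close> is at most
  \<open>(1 - (\<theta> j)\<^sup>2) ^ n\<close>, hence at most \<open>1\<close>. So the mixing rate
  times \<open>n\<close> is controlled by the same minimum as the variance.\<close>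

lemma n_hold_le: "real n * (p j * (1 - \<theta> j) ^ n) \<le> min (real n * p j) (16 ^ j * weight j)"
proof (rule min.boundedI)
  have q: "0 \<le> 1 - \<theta> j" "1 - \<theta> j \<le> 1" using \<theta>_pos[of j] \<theta>_less[of j] by auto
  show "real n * (p j * (1 - \<theta> j) ^ n) \<le> real n * p j"
    using p_pos[of j] q by (intro mult_left_mono mult_left_le power_le_one) auto
  have "(1 + real n * \<theta> j) * (1 - \<theta> j) ^ n \<le> (1 + \<theta> j) ^ n * (1 - \<theta> j) ^ n"
    using Bernoulli_inequality[of "\<theta> j" n] \<theta>_pos[of j] q by (intro mult_right_mono) auto
  also have "\<dots> = (1 - (\<theta> j)\<^sup>2) ^ n" by (simp add: power_mult_distrib[symmetric] power2_eq_square algebra_simps)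
  also have "\<dots> \<le> 1" using \<theta>_pos[of j] \<theta>_less[of j] by (intro power_le_one) (auto simp: power_le_one)
  finally have "real n * \<theta> j * (1 - \<theta> j) ^ n \<le> 1" using q by (simp add: algebra_simps) (smt (verit) zero_le_power)
  then have "(p j / \<theta> j) * (real n * \<theta> j * (1 - \<theta> j) ^ n) \<le> (p j / \<theta> j) * 1"
    using p_pos[of j] \<theta>_pos[of j] by (intro mult_left_mono) auto
  then show "real n * (p j * (1 - \<theta> j) ^ n) \<le> 16 ^ j * weight j"
    unfolding p_over_\<theta>[symmetric] using \<theta>_pos[of j] by (simp add: mult_ac)
qed

lemma beta_mixing_le:
  assumes n: "n \<ge> 1"
  shows "beta_mixing \<Omega> X n \<le> g n * (1 / real n)"
proof -
  have b: "2 * (p j * (1 - \<theta> j) ^ n) \<le> 2 / real n * (g n / 2 ^ (j + 3))" for j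
  proof -
    have "real n * (p j * (1 - \<theta> j) ^ n) \<le> g n / 2 ^ (j + 3)"
      using n_hold_le[of n j] g_bound[OF n, of j] by linarith
    then show ?thesis using n by (simp add: field_simps)
  qed
  have s: "(\<lambda>j. 2 / real n * (g n / 2 ^ (j + 3))) sums (2 / real n * (g n / 4))"
    by (intro sums_mult power_2_sums)
  have "summable (\<lambda>j. 2 * (p j * (1 - \<theta> j) ^ n))"
    by (rule summable_comparison_test'[OF sums_summable[OF s], of 0])
       (use b p_pos \<theta>_less in \<open>simp add: abs_mult less_imp_le\<close>)
  then have "(\<Sum>j. 2 * (p j * (1 - \<theta> j) ^ n)) \<le> (\<Sum>j. 2 / real n * (g n / 2 ^ (j + 3)))"
    by (intro suminf_le b sums_summable[OF s])
  also have "\<dots> = 2 / real n * (g n / 4)" using s by (simp add: sums_iff)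
  also have "\<dots> \<le> g n * (1 / real n)" using g_pos[OF n] n by (simp add: field_simps)
  finally show ?thesis using beta_mixing_le_uncoupled[OF n] prob_uncoupled_le[of n] by linarith
qed

lemma beta_mixing_bigo: "beta_mixing \<Omega> X \<in> O(\<lambda>n. g n * (1 / real n))"
proof (rule bigoI[of _ 1])
  show "\<forall>\<^sub>F n in sequentially. norm (beta_mixing \<Omega> X n) \<le> 1 * norm (g n * (1 / real n))"
    using eventually_ge_at_top[of 1]
  proof eventually_elim
    fix n :: nat assume "n \<ge> 1"
    then show "norm (beta_mixing \<Omega> X n) \<le> 1 * norm (g n * (1 / real n))"
      using beta_mixing_le[of n] beta_mixing_nonneg[of n] g_pos[of n] by simp
  qed
qed

text \<open>One component alone already contributes this much: its code weight squared,
  \<open>1 / 16 ^ j\<close>, cancels the power in \<open>p j / \<theta> j\<close> and leaves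
  \<open>weight j\<close>.\<close>

lemma variance_ge: "n \<ge> 1 \<Longrightarrow> variance (partial_sum X n) / real n \<ge> weight j * (1 - 1 / (real n * \<theta> j))"
proof -
  assume n: "n \<ge> 1"
  have "weight j * (1 - 1 / (real n * \<theta> j)) * real n = (1 / 4 ^ j)\<^sup>2 * (p j / \<theta> j * (real n - 1 / \<theta> j))"
    unfolding p_over_\<theta> square_inverse_power using n \<theta>_pos[of j] by (simp add: field_simps)
  also have "\<dots> \<le> (1 / 4 ^ j)\<^sup>2 * comp_var j n"
    by (intro mult_left_mono comp_var_ge_linear) simp
  also have "\<dots> \<le> variance (partial_sum X n)" by (rule comp_var_le_variance)
  finally show ?thesis using n by (simp add: le_divide_eq)
qed

lemma variance_at_top: "filterlim (\<lambda>n. variance (partial_sum X n) / real n) at_top sequentially"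
  unfolding filterlim_at_top
proof
  fix K :: real
  \<comment> \<open>First a component with a weight above \<open>K\<close> is fixed; only then does
    \<open>n\<close> tend to infinity.\<close>
  obtain j :: nat where j: "2 * K \<le> real j" using real_arch_simple by blast
  have "(\<lambda>n. weight j * (1 - 1 / (real n * \<theta> j))) \<longlonglongrightarrow> weight j * (1 - 0)"
    using \<theta>_pos[of j] 
    by (intro tendsto_intros tendsto_divide_0[OF tendsto_const] filterlim_at_top_imp_at_infinity
        filterlim_tendsto_pos_mult_at_top[OF tendsto_const _ filterlim_real_sequentially, where c="\<theta> j", simplified mult.commute[of "\<theta> j"]])
  moreover have "weight j > K" using j weight_ge[of j] weight_pos[of j] by linarith
  then have "weight j * (1 - 0) > K" by simp
  ultimately have "\<forall>\<^sub>F n in sequentially. weight j * (1 - 1 / (real n * \<theta> j)) > K"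
    by (rule order_tendstoD(1))
  then show "\<forall>\<^sub>F n in sequentially. K \<le> variance (partial_sum X n) / real n"
    using eventually_ge_at_top[of 1] by eventually_elim (use variance_ge[of _ j] in \<open>force intro: order_trans less_imp_le\<close>)
qed

text \<open>Components before \<open>J\<close> are treated as saturated and their weights sum to at
  most \<open>weight J / (real J)\<^sup>2\<close>. Components after \<open>J\<close> are bounded by
  their quadratic growth, and \<open>p_tail\<close> makes that second order in \<open>p J\<close>.
  The common factor is the squared code weight of component \<open>J\<close>, for comparison with
  its variance.\<close>

lemma rest_bound:
  assumes J: "J \<ge> 1" and a: "\<And>j. c j = (if j = J then 0 else 1 / 4 ^ j)"
  shows "expectation (\<lambda>\<omega>. (wsum c n \<omega>)\<^sup>2) \<le>
    (1 / 4 ^ J)\<^sup>2 * (2 * real n * (p J / \<theta> J) / (real J)\<^sup>2 + 2 * (real n)\<^sup>2 * (p J)\<^sup>2 / 4 ^ J)"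
proof -
  \<comment> \<open>The envelope of the components after \<open>J\<close>, before a geometric factor
    \<open>(1 / 4) ^ j\<close>; the sum \<open>4 / 3\<close> of the geometric series is later
    absorbed into the constant \<open>2\<close>.\<close>
  let ?E = "(1 / 4 ^ J)\<^sup>2 * ((real n)\<^sup>2 * (p J)\<^sup>2 / 4 ^ J)"
  have c: "\<bar>c j\<bar> \<le> 1 / 4 ^ j" for j by (simp add: a)
  have "(\<lambda>j. if j \<in> {..<J} then 2 * real n * weight j else 0) sums (\<Sum>j\<in>{..<J}. 2 * real n * weight j)"
    by (rule sums_If_finite_set) simp
  moreover have "(\<lambda>j. ?E * (1 / 4) ^ j) sums (?E * (1 / (1 - 1 / 4)))"
    by (intro sums_mult geometric_sums) simp
  ultimately have s: "(\<lambda>j. (if j \<in> {..<J} then 2 * real n * weight j else 0) + ?E * (1 / 4) ^ j) sums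
      ((\<Sum>j\<in>{..<J}. 2 * real n * weight j) + ?E * (1 / (1 - 1 / 4)))"
    by (rule sums_add)
  have "expectation (\<lambda>\<omega>. (wsum c n \<omega>)\<^sup>2) \<le> (\<Sum>j\<in>{..<J}. 2 * real n * weight j) + ?E * (1 / (1 - 1 / 4))"
  proof (rule sums_le[OF _ wsum_square_sums[OF c] s])
    fix j
    have E0: "?E * (1 / 4) ^ j \<ge> 0" by simp
    consider "j < J" | "j = J" | "j > J" by linarith
    then show "(c j)\<^sup>2 * comp_var j n \<le> (if j \<in> {..<J} then 2 * real n * weight j else 0) + ?E * (1 / 4) ^ j"
    proof cases
      case 1
      have "(c j)\<^sup>2 * comp_var j n \<le> (1 / 4 ^ j)\<^sup>2 * (2 * real n * (p j / \<theta> j))"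
      proof -
        have "c j = 1 / 4 ^ j" using 1 by (simp add: a)
        then show ?thesis by (simp only:) (intro mult_left_mono comp_var_le_linear zero_le_power2)
      qed
      also have "\<dots> = 2 * real n * weight j" unfolding p_over_\<theta> square_inverse_power by simp
      finally have "(c j)\<^sup>2 * comp_var j n \<le> 2 * real n * weight j" .
      then show ?thesis using 1 E0 by (simp only: lessThan_iff if_True)
    next
      case 2
      then show ?thesis using E0 by (simp add: a)
    next
      case 3
      have "(c j)\<^sup>2 * comp_var j n \<le> (1 / 4 ^ J)\<^sup>2 * (p j * (real n)\<^sup>2)"
      proof (rule mult_mono)
        show "(c j)\<^sup>2 \<le> (1 / 4 ^ J)\<^sup>2"
          using 3 by (intro power_mono) (simp_all add: a frac_le power_increasing)
      qed (auto intro: comp_var_le_square comp_var_nonneg)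
      also have "\<dots> \<le> (1 / 4 ^ J)\<^sup>2 * ((p J)\<^sup>2 / 4 ^ (j + J) * (real n)\<^sup>2)"
        using p_tail[OF 3] by (intro mult_left_mono mult_right_mono) auto
      also have "\<dots> = ?E * (1 / 4) ^ j" by (simp add: power_add power_divide mult_ac)
      finally show ?thesis using 3 by simp
    qed
  qed
  also have "(\<Sum>j\<in>{..<J}. 2 * real n * weight j) \<le> 2 * real n * (weight J / (real J)\<^sup>2)"
    unfolding sum_distrib_left[symmetric] by (intro mult_left_mono sum_weight_less J) simp
  also have "2 * real n * (weight J / (real J)\<^sup>2) = (1 / 4 ^ J)\<^sup>2 * (2 * real n * (p J / \<theta> J) / (real J)\<^sup>2)"
    unfolding p_over_\<theta> square_inverse_power by simp
  also have "?E * (1 / (1 - 1 / 4)) \<le> (1 / 4 ^ J)\<^sup>2 * (2 * (real n)\<^sup>2 * (p J)\<^sup>2 / 4 ^ J)"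
    by (simp add: field_simps)
  finally show ?thesis by (simp add: distrib_left)
qed

end

context reversible_example
begin

section \<open>Limit superior of the variance ratios\<close>

lemma variance_split:
  assumes c: "\<And>j. c j = (if j = J then 0 else 1 / 4 ^ j)"
  shows "variance (partial_sum X n) = (1 / 4 ^ J)\<^sup>2 * comp_var J n + expectation (\<lambda>\<omega>. (wsum c n \<omega>)\<^sup>2)"
proof -
  have c': "\<bar>c j\<bar> \<le> 1 / 4 ^ j" for j by (simp add: c)
  have "(\<lambda>j. (if j = J then (1 / 4 ^ J)\<^sup>2 * comp_var J n else 0) + (c j)\<^sup>2 * comp_var j n) sums
      ((1 / 4 ^ J)\<^sup>2 * comp_var J n + expectation (\<lambda>\<omega>. (wsum c n \<omega>)\<^sup>2))"
    by (intro sums_add sums_single wsum_square_sums c')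
  also have "(\<lambda>j. (if j = J then (1 / 4 ^ J)\<^sup>2 * comp_var J n else 0) + (c j)\<^sup>2 * comp_var j n) = (\<lambda>j. (1 / 4 ^ j)\<^sup>2 * comp_var j n)"
    by (auto simp: c)
  finally show ?thesis by (rule sums_unique2[OF variance_sums])
qed

lemma variance_pos: "n \<ge> 1 \<Longrightarrow> variance (partial_sum X n) > 0"
proof -
  assume n: "n \<ge> 1"
  have "0 < p 0 * (real n)\<^sup>2 * (1 - \<theta> 0) ^ n" using p_pos[of 0] \<theta>_less[of 0] n by simp
  also have "\<dots> \<le> comp_var 0 n" by (rule comp_var_ge_square)
  also have "\<dots> \<le> variance (partial_sum X n)" using comp_var_le_variance[of 0 n] by simp
  finally show ?thesis .
qed

text \<open>
  At this time component \<open>J\<close> already dominates the variance but has hardly been resampled, so the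
  variance still grows quadratically.
\<close>

definition ratio_time :: "nat \<Rightarrow> nat" where
  "ratio_time J = nat \<lceil>1 / (real J * \<theta> J)\<rceil>"

lemma nat_le_power_4: "real J \<le> 4 ^ J" "real J * real J \<le> 4 ^ J"
proof -
  have "real J < 2 ^ J" by (rule of_nat_less_two_power)
  then have "real J * real J \<le> 2 ^ J * 2 ^ J" by (intro mult_mono) auto
  then show sq: "real J * real J \<le> 4 ^ J" by (simp add: power_mult_distrib[symmetric])
  show "real J \<le> 4 ^ J" 
    by (rule order_trans[OF less_imp_le[OF of_nat_less_two_power] power_mono]) auto
qed

lemma p_le': "p J \<le> 1 / 4 ^ J"
proof -
  have "p J \<le> 1 / 4 ^ (J + 1)" by (rule p_le)
  also have "\<dots> \<le> 1 / 4 ^ J" by (intro divide_left_mono power_increasing) auto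
  finally show ?thesis .
qed

lemma J_\<theta>_bounds:
  assumes J: "J \<ge> 1"
  shows "0 < real J * \<theta> J" "real J * \<theta> J \<le> 1" "real J * (real J * \<theta> J) \<le> 1"
proof -
  show "0 < real J * \<theta> J" using J \<theta>_pos[of J] by simp
  have t: "\<theta> J \<le> 1 / 4 ^ J" using \<theta>_le_p[of J] p_le'[of J] by linarith
  have "real J * \<theta> J \<le> 4 ^ J * (1 / 4 ^ J)"
    by (rule mult_mono[OF nat_le_power_4(1) t]) (use \<theta>_pos[of J] in auto)
  then show "real J * \<theta> J \<le> 1" by simp
  have "real J * real J * \<theta> J \<le> 4 ^ J * (1 / 4 ^ J)"
    by (rule mult_mono[OF nat_le_power_4(2) t]) (use \<theta>_pos[of J] in auto)
  then show "real J * (real J * \<theta> J) \<le> 1" by simp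
qed

lemma ratio_time_bounds:
  assumes J: "J \<ge> 1"
  shows "1 \<le> real (ratio_time J) * (real J * \<theta> J)" "real (ratio_time J) * (real J * \<theta> J) \<le> 2" "J \<le> ratio_time J"
proof -
  let ?x = "1 / (real J * \<theta> J)"
  note b = J_\<theta>_bounds[OF J]
  have n: "?x \<le> real (ratio_time J)" "real (ratio_time J) \<le> ?x + 1"
    using b(1) by (auto simp: ratio_time_def)
  from n(1) b(1) show "1 \<le> real (ratio_time J) * (real J * \<theta> J)" by (simp add: divide_le_eq)
  have "real (ratio_time J) * (real J * \<theta> J) \<le> (?x + 1) * (real J * \<theta> J)" using n(2) b(1) by (intro mult_right_mono) auto
  also have "\<dots> = 1 + real J * \<theta> J" using J \<theta>_pos[of J] by (simp add: distrib_right)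
  finally show "real (ratio_time J) * (real J * \<theta> J) \<le> 2" using b(2) by linarith
  have "real J \<le> ?x" using b(1,3) by (simp add: le_divide_eq)
  with n(1) show "J \<le> ratio_time J" by linarith
qed

lemma variance_ratio_le: "n \<ge> 1 \<Longrightarrow> N \<ge> 1 \<Longrightarrow>
    normalized_variance \<Omega> X (N * n) / normalized_variance \<Omega> X n \<le> real N"
  using variance_mult_le[of N n] variance_pos[of n]
  by (simp add: normalized_variance_def field_simps power2_eq_square)

text \<open>At \<open>ratio_time J\<close> the variance is \<open>K\<close> up to a relative error
  of order \<open>1 / J\<close>, where the rest is negligible by \<open>rest_bound\<close>. At
  \<open>N\<close> times that time component \<open>J\<close> alone still has nearly the square of
  \<open>N\<close> times \<open>K\<close>, by Bernoulli, because \<open>real n * \<theta> J\<close>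
  is at most \<open>2 / real J\<close>.\<close>

lemma variance_ratio_ge:
  assumes J: "J \<ge> 1" and N: "N \<ge> 1" and JN: "2 * real N / real J \<le> 1" and n: "n = ratio_time J"
  shows "real N * (1 - 2 * real N / real J) / (1 + 4 / real J) \<le>
    normalized_variance \<Omega> X (N * n) / normalized_variance \<Omega> X n"
proof -
  note b = ratio_time_bounds[OF J, folded n]
  have n1: "n \<ge> 1" using b(3) J by linarith
  \<comment> \<open>The variance that component \<open>J\<close> would have at time \<open>n\<close>
    if it were never resampled.\<close>
  define K where "K = (1 / 4 ^ J)\<^sup>2 * (p J * (real n)\<^sup>2)"
  have K: "K > 0" using p_pos[of J] n1 by (simp add: K_def)
  have "variance (partial_sum X n) \<le> (1 / 4 ^ J)\<^sup>2 * (p J * (real n)\<^sup>2) +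
      (1 / 4 ^ J)\<^sup>2 * (2 * real n * (p J / \<theta> J) / (real J)\<^sup>2 + 2 * (real n)\<^sup>2 * (p J)\<^sup>2 / 4 ^ J)"
    unfolding variance_split[of "\<lambda>j. if j = J then 0 else 1 / 4 ^ j" J n, OF refl]
    by (intro add_mono mult_left_mono comp_var_le_square rest_bound[OF J]) auto
  also have "\<dots> \<le> K * (1 + 4 / real J)"
  proof -
    have "2 * real n * (p J / \<theta> J) / (real J)\<^sup>2 \<le> p J * (real n)\<^sup>2 * (2 / real J)"
    proof -
      \<comment> \<open>The choice of the time makes \<open>real n * (real J * \<theta> J)\<close>
        at least one; multiplying by it turns the linear term into a quadratic one at the cost of
        one factor \<open>J\<close>.\<close>
      have "2 * real n * (p J / \<theta> J) / (real J)\<^sup>2 * 1 \<le> 2 * real n * (p J / \<theta> J) / (real J)\<^sup>2 * (real n * (real J * \<theta> J))"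
        using b(1) p_pos[of J] \<theta>_pos[of J] by (intro mult_left_mono) auto
      also have "\<dots> = p J * (real n)\<^sup>2 * (2 / real J)"
        using J \<theta>_pos[of J] by (simp add: power2_eq_square field_simps)
      finally show ?thesis by simp
    qed
    moreover have "2 * (real n)\<^sup>2 * (p J)\<^sup>2 / 4 ^ J \<le> p J * (real n)\<^sup>2 * (2 / real J)"
    proof -
      have "p J / 4 ^ J \<le> 1 / real J"
        using p_le_quarter[of J] nat_le_power_4(1)[of J] J p_pos[of J] by (intro frac_le) auto
      then have "2 * (real n)\<^sup>2 * p J * (p J / 4 ^ J) \<le> 2 * (real n)\<^sup>2 * p J * (1 / real J)"
        using p_pos[of J] by (intro mult_left_mono) auto
      then show ?thesis by (simp add: power2_eq_square mult_ac)
    qed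
    ultimately have "(1 / 4 ^ J)\<^sup>2 * (2 * real n * (p J / \<theta> J) / (real J)\<^sup>2 + 2 * (real n)\<^sup>2 * (p J)\<^sup>2 / 4 ^ J)
        \<le> (1 / 4 ^ J)\<^sup>2 * (p J * (real n)\<^sup>2 * (2 / real J) + p J * (real n)\<^sup>2 * (2 / real J))"
      by (intro mult_left_mono add_mono) auto
    also have "\<dots> = K * (4 / real J)" by (simp add: K_def)
    finally show ?thesis unfolding K_def[symmetric] by (simp add: distrib_left)
  qed
  finally have up: "variance (partial_sum X n) \<le> K * (1 + 4 / real J)" .
  have "1 - 2 * real N / real J \<le> 1 - real (N * n) * \<theta> J"
  proof -
    have "real n * \<theta> J \<le> 2 / real J" using b(2) J by (simp add: field_simps)
    then have "real N * (real n * \<theta> J) \<le> real N * (2 / real J)" by (intro mult_left_mono) auto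
    then show ?thesis by (simp add: mult_ac)
  qed
  also have "\<dots> \<le> (1 - \<theta> J) ^ (N * n)"
    using Bernoulli_inequality[of "- \<theta> J" "N * n"] \<theta>_less[of J] by simp
  finally have q: "1 - 2 * real N / real J \<le> (1 - \<theta> J) ^ (N * n)" .
  have "(real N)\<^sup>2 * K * (1 - 2 * real N / real J) = (1 / 4 ^ J)\<^sup>2 * (p J * (real (N * n))\<^sup>2 * (1 - 2 * real N / real J))"
    by (simp add: K_def power2_eq_square)
  also have "\<dots> \<le> (1 / 4 ^ J)\<^sup>2 * (p J * (real (N * n))\<^sup>2 * (1 - \<theta> J) ^ (N * n))"
    using q p_pos[of J] by (intro mult_left_mono) auto
  also have "\<dots> \<le> (1 / 4 ^ J)\<^sup>2 * comp_var J (N * n)"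
    by (intro mult_left_mono comp_var_ge_square) simp
  also have "\<dots> \<le> variance (partial_sum X (N * n))" by (rule comp_var_le_variance)
  finally have lo: "(real N)\<^sup>2 * K * (1 - 2 * real N / real J) \<le> variance (partial_sum X (N * n))" .
  have "real N * (1 - 2 * real N / real J) / (1 + 4 / real J) = ((real N)\<^sup>2 * K * (1 - 2 * real N / real J)) / (real N * (K * (1 + 4 / real J)))"
    using K N by (simp add: power2_eq_square)
  also have "\<dots> \<le> variance (partial_sum X (N * n)) / (real N * variance (partial_sum X n))"
    using lo up variance_pos[OF n1] N K JN
    by (intro frac_le mult_left_mono mult_nonneg_nonneg mult_pos_pos) auto
  also have "\<dots> = normalized_variance \<Omega> X (N * n) / normalized_variance \<Omega> X n"
    using N n1 by (simp add: normalized_variance_def)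
  finally show ?thesis .
qed

text \<open>The upper bound holds at every positive time. For the lower one, the ratio times exceed
  every bound and the ratios along them get above any number smaller than \<open>N\<close>.\<close>

lemma limsup_variance_ratio:
  assumes N: "N \<ge> 1"
  shows "limsup (\<lambda>n. ereal (normalized_variance \<Omega> X (N * n) / normalized_variance \<Omega> X n)) = ereal (real N)"
proof (rule antisym)
  show "limsup (\<lambda>n. ereal (normalized_variance \<Omega> X (N * n) / normalized_variance \<Omega> X n)) \<le> ereal (real N)"
    by (rule Limsup_bounded, rule eventually_mono[OF eventually_ge_at_top[of 1]])
       (simp add: variance_ratio_le[OF _ N])
  show "ereal (real N) \<le> limsup (\<lambda>n. ereal (normalized_variance \<Omega> X (N * n) / normalized_variance \<Omega> X n))" (is "_ \<le> limsup ?f")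
  proof (rule ccontr)
    assume "\<not> ereal (real N) \<le> limsup ?f"
    then have "limsup ?f < ereal (real N)" by simp
    then obtain r where r: "limsup ?f < ereal r" "ereal r < ereal (real N)" using ereal_dense2 by blast
    have "\<forall>\<^sub>F n in sequentially. ?f n < ereal r" using r(1) by (rule Limsup_lessD)
    then obtain m where m: "\<And>n. n \<ge> m \<Longrightarrow> ?f n < ereal r" unfolding eventually_sequentially by blast
    have "(\<lambda>J::nat. x * (1 - 2 * x / real J) / (1 + 4 / real J)) \<longlonglongrightarrow> x" for x :: real
      by real_asymp
    then have ev1: "\<forall>\<^sub>F J in sequentially. r < real N * (1 - 2 * real N / real J) / (1 + 4 / real J)"
      by (rule order_tendstoD(1)) (use r(2) in simp)
    have ev2: "\<forall>\<^sub>F J in sequentially. real J \<ge> 2 * real N"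
      using filterlim_real_sequentially unfolding filterlim_at_top by blast
    have "\<forall>\<^sub>F J in sequentially. r < real N * (1 - 2 * real N / real J) / (1 + 4 / real J) \<and> real J \<ge> 2 * real N \<and> J \<ge> 1 \<and> J \<ge> m"
      using ev1 ev2 eventually_ge_at_top[of 1] eventually_ge_at_top[of m] by eventually_elim blast
    then obtain J where J: "r < real N * (1 - 2 * real N / real J) / (1 + 4 / real J)" "real J \<ge> 2 * real N" "J \<ge> 1" "J \<ge> m"
      unfolding eventually_sequentially by blast
    have JN: "2 * real N / real J \<le> 1" using J by (simp add: divide_le_eq)
    have "r < normalized_variance \<Omega> X (N * ratio_time J) / normalized_variance \<Omega> X (ratio_time J)"
      by (rule less_le_trans[OF J(1) variance_ratio_ge[OF J(3) N JN refl]])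
    moreover have "ratio_time J \<ge> m" using ratio_time_bounds(3)[OF J(3)] J(4) by linarith
    ultimately show False using m[of "ratio_time J"] by simp
  qed
qed

section \<open>Spreading out of the normalized sums\<close>

lemma char_partial_sum:
  "(\<integral>\<omega>. iexp (s * partial_sum X n \<omega>) \<partial>\<Omega>) = (\<integral>\<omega>. iexp (s * wsum (\<lambda>j. 1 / 4 ^ j) n \<omega>) \<partial>\<Omega>)"
  by (rule integral_cong_AE) (use AE_partial_sum[of n] in auto)

lemma norm_char_partial_sum_le:
  "norm (\<integral>\<omega>. iexp (s * partial_sum X n \<omega>) \<partial>\<Omega>) \<le> norm (comp_char j n (s / 4 ^ j))"
  unfolding char_partial_sum using norm_char_wsum_le[of "\<lambda>j. 1 / 4 ^ j" s n j] by simp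

text \<open>The Gaussian exponent of one fixed component: half of the square of \<open>v\<close>
  times the asymptotic variance per step,
  \<open>(2 - \<theta> j) * p j / \<theta> j\<close>.\<close>

lemma decay_clt:
  "(\<lambda>n. real n * decay j (v / sqrt (real n))) \<longlonglongrightarrow> (2 - \<theta> j) * p j * v\<^sup>2 / (2 * \<theta> j)"
proof -
  have lim: "(\<lambda>n::nat. real n * (1 - cos (v / sqrt (real n)))) \<longlonglongrightarrow> v * v / 2"
    by real_asymp
  have lim0: "(\<lambda>n::nat. 1 - cos (v / sqrt (real n))) \<longlonglongrightarrow> 0"
    by real_asymp
  have main: "(\<lambda>n. \<theta> j * p j * (2 - \<theta> j) * (real n * (1 - cos (v / sqrt (real n)))) / ((\<theta> j)\<^sup>2 + 2 * (1 - \<theta> j) * (1 - cos (v / sqrt (real n)))))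
      \<longlonglongrightarrow> \<theta> j * p j * (2 - \<theta> j) * (v * v / 2) / ((\<theta> j)\<^sup>2 + 2 * (1 - \<theta> j) * 0)"
    using \<theta>_pos[of j] by (intro tendsto_divide tendsto_add tendsto_mult tendsto_const lim lim0) simp
  have "\<theta> j * p j * (2 - \<theta> j) * (v * v / 2) / ((\<theta> j)\<^sup>2 + 2 * (1 - \<theta> j) * 0) = (2 - \<theta> j) * p j * v\<^sup>2 / (2 * \<theta> j)"
    using \<theta>_pos[of j] by (simp add: field_simps power2_eq_square)
  from main[unfolded this] show ?thesis by (simp add: decay_def kappa_def mult_ac)
qed

text \<open>An upper bound for the modulus is all that is used later. The error term vanishes by the
  second bound of \<open>corr_err_le\<close>, as the argument is of order
  \<open>1 / sqrt n\<close>.\<close>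

lemma comp_char_clt_bound:
  "\<exists>U. (\<forall>n. norm (comp_char j n (v / sqrt (real n))) \<le> U n) \<and> U \<longlonglongrightarrow> exp (- ((2 - \<theta> j) * p j * v\<^sup>2 / (2 * \<theta> j)))"
proof (intro exI conjI allI)
  let ?d = "\<lambda>n. decay j (v / sqrt (real n))"
  let ?U = "\<lambda>n. (1 - ?d n) ^ n + (2 + real n * ?d n) * (p j * \<bar>v / sqrt (real n)\<bar> / \<theta> j)"
  show "norm (comp_char j n (v / sqrt (real n))) \<le> ?U n" for n
  proof -
    have "norm (comp_char j n (v / sqrt (real n))) \<le> norm (complex_of_real ((1 - ?d n) ^ n)) + norm (comp_char j n (v / sqrt (real n)) - complex_of_real ((1 - ?d n) ^ n))"
      by (rule norm_triangle_sub)
    also have "norm (complex_of_real ((1 - ?d n) ^ n)) = (1 - ?d n) ^ n"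
      unfolding norm_of_real using decay_bounds(2)[of j "v / sqrt (real n)"] by simp
    also have "norm (comp_char j n (v / sqrt (real n)) - complex_of_real ((1 - ?d n) ^ n)) \<le> (2 + real n * ?d n) * corr_err j (v / sqrt (real n))"
      by (rule comp_char_approx)
    also have "\<dots> \<le> (2 + real n * ?d n) * (p j * \<bar>v / sqrt (real n)\<bar> / \<theta> j)"
      using decay_bounds(1)[of j "v / sqrt (real n)"] by (intro mult_left_mono corr_err_le(2)) auto
    finally show ?thesis by simp
  qed
  have "(\<lambda>n::nat. v / sqrt (real n)) \<longlonglongrightarrow> 0" by real_asymp
  then have err: "(\<lambda>n. p j * \<bar>v / sqrt (real n)\<bar> / \<theta> j) \<longlonglongrightarrow> p j * \<bar>0\<bar> / \<theta> j"
    using \<theta>_pos[of j] by (intro tendsto_divide tendsto_mult tendsto_const tendsto_rabs) auto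
  have d0: "?d \<longlonglongrightarrow> 0"
  proof (rule Lim_transform_eventually)
    show "(\<lambda>n. (real n * ?d n) * inverse (real n)) \<longlonglongrightarrow> 0"
      using tendsto_mult[OF decay_clt[of j v] lim_inverse_n[where 'a=real]] by simp
    show "\<forall>\<^sub>F n in sequentially. (real n * ?d n) * inverse (real n) = ?d n"
      using eventually_gt_at_top[of 0] by eventually_elim simp
  qed
  have "?U \<longlonglongrightarrow> exp (- ((2 - \<theta> j) * p j * v\<^sup>2 / (2 * \<theta> j))) + (2 + (2 - \<theta> j) * p j * v\<^sup>2 / (2 * \<theta> j)) * (p j * \<bar>0\<bar> / \<theta> j)"
    by (intro tendsto_add tendsto_mult err tendsto_const decay_clt power_one_minus_tendsto_exp decay_bounds d0)
  then show "?U \<longlonglongrightarrow> exp (- ((2 - \<theta> j) * p j * v\<^sup>2 / (2 * \<theta> j)))" by simp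
qed

text \<open>The modulus is at most that of any single component. In the limit component
  \<open>j\<close> contributes at most \<open>exp (- (weight j * v\<^sup>2 / 2))\<close>, which is
  below the tolerance for a suitable \<open>j\<close>, chosen before \<open>n\<close>.\<close>

lemma char_normalized_tendsto_0:
  assumes v: "v \<noteq> 0"
  shows "(\<lambda>n. norm (\<integral>\<omega>. iexp (v * (partial_sum X n \<omega> / sqrt (real n))) \<partial>\<Omega>)) \<longlonglongrightarrow> 0"
proof (rule order_tendstoI)
  fix e :: real assume e: "e > 0"
  have "filterlim (\<lambda>j. weight j * v\<^sup>2 / 2) at_top sequentially"
  proof (rule filterlim_at_top_mono)
    show "filterlim (\<lambda>j. (v\<^sup>2 / 2) * real j) at_top sequentially"
      using v by (intro filterlim_tendsto_pos_mult_at_top[OF tendsto_const] filterlim_real_sequentially) auto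
    show "\<forall>\<^sub>F j in sequentially. (v\<^sup>2 / 2) * real j \<le> weight j * v\<^sup>2 / 2"
      using weight_ge by (intro always_eventually allI) (simp add: mult.commute mult_right_mono)
  qed
  then have "(\<lambda>j. exp (- (weight j * v\<^sup>2 / 2))) \<longlonglongrightarrow> 0"
    unfolding filterlim_uminus_at_top by (rule filterlim_compose[OF exp_at_bot])
  then have "\<forall>\<^sub>F j in sequentially. exp (- (weight j * v\<^sup>2 / 2)) < e" using e by (rule order_tendstoD(2))
  then obtain j where j: "exp (- (weight j * v\<^sup>2 / 2)) < e"
    unfolding eventually_sequentially by blast
  let ?w = "v / 4 ^ j"
  obtain U where U: "\<And>n. norm (comp_char j n (?w / sqrt (real n))) \<le> U n"
      "U \<longlonglongrightarrow> exp (- ((2 - \<theta> j) * p j * ?w\<^sup>2 / (2 * \<theta> j)))"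
    using comp_char_clt_bound[of j ?w] by blast
  have "weight j * v\<^sup>2 / 2 \<le> (2 - \<theta> j) * p j * ?w\<^sup>2 / (2 * \<theta> j)"
  proof -
    have "(2 - \<theta> j) * p j * ?w\<^sup>2 / (2 * \<theta> j) = (2 - \<theta> j) * ((p j / \<theta> j) * ((1 / 4 ^ j)\<^sup>2 * v\<^sup>2) / 2)"
      by (simp add: power_divide mult_ac)
    also have "\<dots> = (2 - \<theta> j) * (weight j * v\<^sup>2 / 2)" unfolding p_over_\<theta> square_inverse_power by simp
    also have "\<dots> \<ge> 1 * (weight j * v\<^sup>2 / 2)"
      using \<theta>_less[of j] weight_pos[of j] by (intro mult_right_mono) auto
    finally show ?thesis by simp
  qed
  then have "exp (- ((2 - \<theta> j) * p j * ?w\<^sup>2 / (2 * \<theta> j))) < e"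
    by (intro le_less_trans[OF _ j]) (simp only: exp_le_cancel_iff neg_le_iff_le)
  with U(2) have "\<forall>\<^sub>F n in sequentially. U n < e" by (rule order_tendstoD(2))
  then show "\<forall>\<^sub>F n in sequentially. norm (\<integral>\<omega>. iexp (v * (partial_sum X n \<omega> / sqrt (real n))) \<partial>\<Omega>) < e"
  proof eventually_elim
    fix n assume "U n < e"
    moreover have "norm (\<integral>\<omega>. iexp (v * (partial_sum X n \<omega> / sqrt (real n))) \<partial>\<Omega>) \<le> norm (comp_char j n (v / sqrt (real n) / 4 ^ j))"
      using norm_char_partial_sum_le[of "v / sqrt (real n)" n j] by simp
    moreover have "norm (comp_char j n (v / sqrt (real n) / 4 ^ j)) \<le> U n" using U(1)[of n] by (simp add: mult.commute)
    ultimately show "norm (\<integral>\<omega>. iexp (v * (partial_sum X n \<omega> / sqrt (real n))) \<partial>\<Omega>) < e" by linarith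
  qed
next
  fix a :: real assume "a < 0"
  then show "\<forall>\<^sub>F n in sequentially. a < norm (\<integral>\<omega>. iexp (v * (partial_sum X n \<omega> / sqrt (real n))) \<partial>\<Omega>)"
    by (intro always_eventually allI less_le_trans[OF _ norm_ge_zero])
qed

lemma concentration_tendsto_0:
  assumes c: "c > 0"
  shows "(\<lambda>n. SUP r::real. prob {\<omega> \<in> space \<Omega>. r - c < partial_sum X n \<omega> / sqrt (real n) \<and> partial_sum X n \<omega> / sqrt (real n) < r + c}) \<longlonglongrightarrow> 0"
    (is "(\<lambda>n. SUP r. ?P n r) \<longlonglongrightarrow> 0")
proof (rule tendsto_sandwich)
  let ?N = std_normal_distribution
  let ?Y = "\<lambda>n \<omega>. partial_sum X n \<omega> / sqrt (real n)"
  let ?\<phi> = "\<lambda>n u. norm (\<integral>\<omega>. iexp (u / c * ?Y n \<omega>) \<partial>\<Omega>)"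
  interpret N: real_distribution ?N by (rule real_dist_normal_dist)
  have Ym: "?Y n \<in> borel_measurable \<Omega>" for n by measurable
  have le: "?P n r \<le> exp (1 / 2) * (\<integral>u. ?\<phi> n u \<partial>?N)" for n r
    by (rule concentration_le[OF Ym c])
  show "\<forall>\<^sub>F n in sequentially. (SUP r. ?P n r) \<le> exp (1 / 2) * (\<integral>u. ?\<phi> n u \<partial>?N)"
    by (intro always_eventually allI cSUP_least le) simp
  show "\<forall>\<^sub>F n in sequentially. 0 \<le> (SUP r. ?P n r)"
  proof (intro always_eventually allI)
    fix n
    have "bdd_above (range (?P n))" by (rule bdd_aboveI[of _ 1]) auto
    then show "0 \<le> (SUP r. ?P n r)" by (rule cSUP_upper2[where x=0]) simp_all
  qed
  have meas: "?\<phi> n \<in> borel_measurable borel" for n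
  proof -
    have rd: "real_distribution (distr \<Omega> borel (?Y n))" by (rule real_distribution_distr[OF Ym])
    have [measurable]: "char (distr \<Omega> borel (?Y n)) \<in> borel_measurable borel"
      by (rule real_distribution.char_measurable[OF rd])
    have "(\<integral>\<omega>. iexp (u / c * ?Y n \<omega>) \<partial>\<Omega>) = char (distr \<Omega> borel (?Y n)) (u / c)" for u
      unfolding char_def by (rule integral_distr[symmetric, OF Ym]) measurable
    then have "?\<phi> n = (\<lambda>u. norm (char (distr \<Omega> borel (?Y n)) (u / c)))" by (simp only:)
    also have "\<dots> \<in> borel_measurable borel" by measurable
    finally show ?thesis .
  qed
  have "(\<lambda>n. \<integral>u. ?\<phi> n u \<partial>?N) \<longlonglongrightarrow> (\<integral>u. 0 \<partial>?N)"
  proof (rule integral_dominated_convergence[where w="\<lambda>_. 1"])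
    \<comment> \<open>At frequency zero the characteristic function is constantly one, so that point
      is discarded as a null set.\<close>
    have "AE u in ?N. u \<noteq> 0"
      using AE_lborel_singleton[of 0] by (subst AE_density) auto
    then show "AE u in ?N. (\<lambda>n. ?\<phi> n u) \<longlonglongrightarrow> 0"
      by eventually_elim (use c in \<open>intro char_normalized_tendsto_0; simp\<close>)
    show "AE u in ?N. norm (?\<phi> n u) \<le> 1" for n
    proof (rule AE_I2)
      fix u
      have "?\<phi> n u \<le> (\<integral>\<omega>. norm (iexp (u / c * ?Y n \<omega>)) \<partial>\<Omega>)" by (rule integral_norm_bound)
      also have "\<dots> = 1" by (simp only: norm_exp_i_times) simp
      finally show "norm (?\<phi> n u) \<le> 1" by simp
    qed
  qed (use meas in auto)
  then show "(\<lambda>n. exp (1 / 2) * (\<integral>u. ?\<phi> n u \<partial>?N)) \<longlonglongrightarrow> 0"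
    by (auto intro: tendsto_mult_right_zero)
qed (rule tendsto_const)

end

section \<open>The main theorem\<close>

text \<open>For large \<open>n\<close> the constant \<open>W\<close> itself is below
  \<open>g n / e\<close> since \<open>g\<close> tends to infinity; for the finitely many other
  \<open>n\<close> the linear term is made small through \<open>x\<close>. No rate of growth of
  \<open>g\<close> enters.\<close>

lemma exists_small_parameter:
  fixes g :: "nat \<Rightarrow> real"
  assumes g_pos: "\<And>n. n \<ge> 1 \<Longrightarrow> g n > 0" and g_lim: "filterlim g at_top sequentially" and e: "e > 0"
  shows "\<exists>x>0. \<forall>n\<ge>1. min (real n * x) W \<le> g n / e"
proof -
  have "\<forall>\<^sub>F n in sequentially. W * e \<le> g n" using g_lim unfolding filterlim_at_top by blast
  then obtain m where m: "\<And>n. n \<ge> m \<Longrightarrow> W * e \<le> g n" unfolding eventually_sequentially by blast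
  \<comment> \<open>The range reaches up to \<open>Suc m\<close> so that the minimum is over a
    nonempty set even for \<open>m = 0\<close>.\<close>
  define d where "d = Min (g ` {1..Suc m})"
  have d: "d > 0" "\<And>n. n \<in> {1..Suc m} \<Longrightarrow> d \<le> g n"
    using g_pos by (auto simp: d_def Min_gr_iff)
  have "min (real n * (d / (e * real (Suc m)))) W \<le> g n / e" if "n \<ge> 1" for n
  proof (cases "n \<le> m")
    case True
    have "real n * (d / (e * real (Suc m))) \<le> real (Suc m) * (d / (e * real (Suc m)))"
      using True d e by (intro mult_right_mono) auto
    also have "\<dots> = d / e" by simp
    also have "\<dots> \<le> g n / e" using d(2)[of n] True that e by (intro divide_right_mono) auto
    finally show ?thesis by simp
  next
    case False
    then have "W \<le> g n / e" using m[of n] e by (simp add: le_divide_eq)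
    then show ?thesis by simp
  qed
  moreover have "d / (e * real (Suc m)) > 0" using d e by simp
  ultimately show ?thesis by blast
qed

text \<open>The growth condition and the tail condition are both upper bounds on \<open>p\<close>,
  so a recursion taking minima satisfies both; afterwards \<open>\<theta>\<close> is determined by
  the prescribed saturation level.\<close>

lemma exists_reversible_example:
  fixes g :: "nat \<Rightarrow> real"
  assumes g_pos: "\<And>n. n \<ge> 1 \<Longrightarrow> g n > 0" and g_lim: "filterlim g at_top sequentially"
  shows "\<exists>p \<theta>. reversible_example p \<theta> g"
proof -
  have "\<forall>j. \<exists>x>0. \<forall>n\<ge>1. min (real n * x) (16 ^ j * weight j) \<le> g n / 2 ^ (j + 3)"
    by (intro allI exists_small_parameter g_pos g_lim zero_less_power) simp_all
  then obtain ps where ps: "\<And>j. ps j > 0" "\<And>j n. n \<ge> 1 \<Longrightarrow> min (real n * ps j) (16 ^ j * weight j) \<le> g n / 2 ^ (j + 3)"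
    by metis
  \<comment> \<open>The first entry of the minimum is the demand of \<open>g\<close>. The second
    makes each value quadratically small in its predecessor and yields the geometric bound on
    \<open>p\<close> and the tail condition.\<close>
  define p where "p = rec_nat (min (ps 0) (1 / 4)) (\<lambda>j x. min (ps (Suc j)) (x\<^sup>2 / 16 ^ Suc j))"
  have p0: "p 0 = min (ps 0) (1 / 4)" and pSuc: "p (Suc j) = min (ps (Suc j)) ((p j)\<^sup>2 / 16 ^ Suc j)" for j
    by (simp_all add: p_def)
  have pos: "p j > 0" for j by (induction j) (use ps(1) in \<open>simp_all add: p0 pSuc\<close>)
  have le_ps: "p j \<le> ps j" for j by (cases j) (simp_all add: p0 pSuc)
  have p_next: "p (Suc j) \<le> (p j)\<^sup>2 / 16 ^ Suc j" for j by (simp add: pSuc)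
  have le: "p j \<le> 1 / 4 ^ (j + 1)" for j
  proof (induction j)
    case (Suc j)
    have "1 / 4 ^ (j + 1) \<le> (1 :: real)" using one_le_power[of "4::real" "j + 1"] by (simp only: divide_le_eq_1) simp
    then have "p j \<le> 1" using Suc by linarith
    then have "(p j)\<^sup>2 / 16 ^ Suc j \<le> 1 / 4 ^ Suc (Suc j)"
      using pos[of j]
      by (intro frac_le) (auto simp: power_le_one intro!: mult_mono power_mono)
    with p_next[of j] show ?case by simp
  qed (simp add: p0)
  have le1: "p j \<le> 1" for j
  proof -
    have "1 / 4 ^ (j + 1) \<le> (1 :: real)" using one_le_power[of "4::real" "j + 1"] by (simp only: divide_le_eq_1) simp
    then show ?thesis using le[of j] by linarith
  qed
  have quarter: "p (Suc j) \<le> p j / 4" for j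
  proof -
    have "p (Suc j) \<le> (p j * p j) / 16 ^ Suc j" using p_next[of j] by (simp add: power2_eq_square)
    also have "\<dots> \<le> (p j * 1) / 4"
    proof (rule frac_le)
      have "1 \<le> (16::real) ^ j" by simp
      then show "4 \<le> (16::real) ^ Suc j" unfolding power_Suc by linarith
    qed (use pos[of j] le1[of j] in auto)
    finally show ?thesis by simp
  qed
  \<comment> \<open>The step from \<open>j\<close> to its successor supplies the square, with room
    since \<open>16 ^ Suc j\<close> equals \<open>4 ^ (2 * Suc j)\<close>; each further step
    supplies one more factor \<open>1 / 4\<close>.\<close>
  have tail: "p (j + 1 + k) \<le> (p j)\<^sup>2 / 4 ^ (j + 1 + k + j)" for j k
  proof (induction k)
    case 0
    have "(16::real) ^ Suc j = 4 ^ (2 * Suc j)" by (simp add: power_mult)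
    then have "(4::real) ^ (j + 1 + 0 + j) \<le> 16 ^ Suc j" by (simp only:) (intro power_increasing; simp)
    then have "(p j)\<^sup>2 / 16 ^ Suc j \<le> (p j)\<^sup>2 / 4 ^ (j + 1 + 0 + j)" by (intro divide_left_mono) auto
    then show ?case using p_next[of j] by simp
  next
    case (Suc k)
    have "p (j + 1 + Suc k) \<le> p (j + 1 + k) / 4" using quarter[of "j + 1 + k"] by simp
    also have "\<dots> \<le> ((p j)\<^sup>2 / 4 ^ (j + 1 + k + j)) / 4" using Suc by simp
    finally show ?case by (simp add: mult.commute)
  qed
  define \<theta> where "\<theta> j = p j / (16 ^ j * weight j)" for j
  have W: "1 \<le> 16 ^ j * weight j" for j
    using mult_mono[OF one_le_power[of "16::real" j] weight_ge_1[of j]] by simp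
  have "reversible_example p \<theta> g"
  proof unfold_locales
    show "0 < p j" "p j \<le> 1 / 4 ^ (j + 1)" for j by (rule pos, rule le)
    show "0 < \<theta> j" for j using pos[of j] weight_pos[of j] by (simp add: \<theta>_def)
    show "\<theta> j < 1" for j
    proof -
      have "1 \<le> (4::real) ^ j" by simp
      then have "1 < (4::real) ^ (j + 1)" unfolding power_add power_one_right by linarith
      then have "1 / 4 ^ (j + 1) < (1 :: real)" by (simp only: divide_less_eq_1) simp
      then have "p j < 16 ^ j * weight j" using le[of j] W[of j] by linarith
      then show ?thesis using weight_pos[of j] by (simp add: \<theta>_def divide_less_eq)
    qed
    show "\<theta> j = p j / (16 ^ j * weight j)" for j by (rule \<theta>_def)
    show "p i \<le> (p j)\<^sup>2 / 4 ^ (i + j)" if "i > j" for i j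
      using tail[of j "i - j - 1"] that by simp
    show "min (real n * p j) (16 ^ j * weight j) \<le> g n / 2 ^ (j + 3)" if "n \<ge> 1" for n j
    proof -
      have "min (real n * p j) (16 ^ j * weight j) \<le> min (real n * ps j) (16 ^ j * weight j)"
        by (intro min.mono mult_left_mono le_ps) auto
      then show ?thesis using ps(2)[OF that, of j] by linarith
    qed
    show "g n > 0" if "n \<ge> 1" for n by (rule g_pos[OF that])
  qed
  then show ?thesis by blast
qed

text \<open>With \<open>x = \<theta> J\<close> and \<open>c = 1 - cos (t * \<theta> J)\<close> both
  numerator and denominator are of second order; dividing by \<open>x\<^sup>2\<close> exposes the
  quotient \<open>c / x\<^sup>2\<close>, which converges.\<close>

lemma kappa_rescale:
  fixes x c :: real
  assumes "x \<noteq> 0"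
  shows "(2 - x) * c / (x\<^sup>2 + 2 * (1 - x) * c) = (2 - x) * (c / x\<^sup>2) / (1 + 2 * (1 - x) * (c / x\<^sup>2))"
proof -
  have nz: "x\<^sup>2 \<noteq> 0" using assms by simp
  have num: "x\<^sup>2 * ((2 - x) * (c / x\<^sup>2)) = (2 - x) * c" using nz by simp
  have den: "x\<^sup>2 * (1 + 2 * (1 - x) * (c / x\<^sup>2)) = x\<^sup>2 + 2 * (1 - x) * c" using nz by (simp add: distrib_left)
  show ?thesis
    using mult_divide_mult_cancel_left[OF nz, of "(2 - x) * (c / x\<^sup>2)" "1 + 2 * (1 - x) * (c / x\<^sup>2)"]
    by (simp only: num den)
qed

section \<open>Compound Poisson limit along a sequence of times\<close>

context reversible_example
begin

text \<open>
  Component \<open>J\<close> starts nonzero blocks at rate \<open>\<theta> J * p J\<close>, hence about a Poisson(1) number of them up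
  to this time; the block lengths are geometric with mean \<open>1 / \<theta> J\<close>, and with the random signs they
  become Laplace variables after division by the scale below.
\<close>

definition limit_time :: "nat \<Rightarrow> nat" where
  "limit_time J = nat \<lceil>1 / (\<theta> J * p J)\<rceil>"

definition limit_scale :: "nat \<Rightarrow> real" where
  "limit_scale J = (1 / 4 ^ J) / \<theta> J"

lemma \<theta>p_bounds: "0 < \<theta> j * p j" "\<theta> j * p j \<le> 1 / 4 ^ j"
proof -
  show "0 < \<theta> j * p j" using \<theta>_pos[of j] p_pos[of j] by simp
  have "\<theta> j * p j \<le> 1 * (1 / 4 ^ j)"
    by (rule mult_mono[OF less_imp_le[OF \<theta>_less] p_le']) (use p_pos[of j] in auto)
  then show "\<theta> j * p j \<le> 1 / 4 ^ j" by simp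
qed

lemma \<theta>p_le_1: "\<theta> j * p j \<le> 1"
proof -
  have "1 / 4 ^ j \<le> (1::real)" by simp
  then show ?thesis using \<theta>p_bounds(2)[of j] by linarith
qed

lemma limit_time_bounds:
  "1 \<le> real (limit_time J) * (\<theta> J * p J)" "real (limit_time J) * (\<theta> J * p J) \<le> 1 + \<theta> J * p J"
proof -
  let ?x = "1 / (\<theta> J * p J)"
  note b = \<theta>p_bounds(1)[of J]
  have n: "?x \<le> real (limit_time J)" "real (limit_time J) \<le> ?x + 1"
    using b by (auto simp: limit_time_def)
  from n(1) b show "1 \<le> real (limit_time J) * (\<theta> J * p J)" by (simp add: divide_le_eq)
  have "real (limit_time J) * (\<theta> J * p J) \<le> (?x + 1) * (\<theta> J * p J)" using n(2) b by (intro mult_right_mono) auto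
  also have "\<dots> = 1 + \<theta> J * p J" using \<theta>_pos[of J] p_pos[of J] by (simp add: distrib_right)
  finally show "real (limit_time J) * (\<theta> J * p J) \<le> 1 + \<theta> J * p J" .
qed

lemma limit_time_pos: "limit_time J > 0"
  using limit_time_bounds(1)[of J] by (cases "limit_time J = 0") auto

text \<open>\<open>\<theta> J * p J\<close> shrinks at least by a factor \<open>4\<close> and is at
  most \<open>1\<close>, so its reciprocal grows by at least \<open>1\<close>, which is enough to
  separate the rounded values.\<close>

lemma strict_mono_limit_time: "strict_mono limit_time"
proof (rule strict_mono_Suc_iff[THEN iffD2], rule allI)
  fix J
  have p': "p (Suc J) \<le> p J / 4"
  proof -
    have "p (Suc J) \<le> (p J * p J) / 4 ^ (Suc J + J)" using p_tail[of J "Suc J"] by (simp add: power2_eq_square)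
    also have "\<dots> \<le> (p J * 1) / 4"
      using p_pos[of J] p_le_quarter[of J] one_le_power[of "4::real" "J + J"]
      by (intro frac_le mult_left_mono) auto
    finally show ?thesis by simp
  qed
  have \<theta>': "\<theta> (Suc J) \<le> \<theta> J"
    unfolding \<theta>_eq
    using p' p_pos[of J] p_pos[of "Suc J"] weight_pos[of J] weight_mono[of J "Suc J"]
    by (intro frac_le mult_mono) auto
  have "\<theta> (Suc J) * p (Suc J) \<le> \<theta> J * (p J / 4)"
    using p' \<theta>' \<theta>_pos[of J] p_pos[of "Suc J"] by (intro mult_mono) auto
  then have "1 / (\<theta> J * (p J / 4)) \<le> 1 / (\<theta> (Suc J) * p (Suc J))"
    using \<theta>p_bounds(1)[of "Suc J"] \<theta>p_bounds(1)[of J] by (intro divide_left_mono) auto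
  moreover have "1 / (\<theta> J * (p J / 4)) = 4 * (1 / (\<theta> J * p J))" by simp
  moreover have "1 \<le> 1 / (\<theta> J * p J)" using \<theta>p_le_1[of J] \<theta>p_bounds(1)[of J] by (simp add: le_divide_eq)
  moreover have "x + 1 \<le> z" if "y \<le> z" "y = 4 * x" "1 \<le> x" for x y z :: real using that by linarith
  ultimately have "1 / (\<theta> J * p J) + 1 \<le> 1 / (\<theta> (Suc J) * p (Suc J))" by blast
  then have "\<lceil>1 / (\<theta> J * p J) + 1\<rceil> \<le> \<lceil>1 / (\<theta> (Suc J) * p (Suc J))\<rceil>" by (rule ceiling_mono)
  moreover have "0 \<le> \<lceil>1 / (\<theta> J * p J)\<rceil>" using \<theta>p_bounds(1)[of J] by (simp add: less_le_trans[of "-1" 0])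
  ultimately show "limit_time J < limit_time (Suc J)" unfolding limit_time_def by linarith
qed

lemma limit_scale_pos: "limit_scale J > 0"
  using \<theta>_pos[of J] by (simp add: limit_scale_def)

text \<open>The scale equals \<open>4 ^ J * weight J / p J\<close>: the small code weight of
  component \<open>J\<close> is outweighed by its block length.\<close>

lemma limit_scale_at_top: "filterlim limit_scale at_top sequentially"
proof (rule filterlim_at_top_mono[OF filterlim_real_sequentially], intro always_eventually allI)
  fix J
  have "real J \<le> 4 ^ J" by (rule nat_le_power_4)
  also have "\<dots> = (16 ^ J * 1) / (4 ^ J * 1)" by (simp flip: power_divide)
  also have "\<dots> \<le> (16 ^ J * weight J) / (4 ^ J * p J)"
    using weight_ge_1[of J] p_pos[of J] p_le_quarter[of J] by (intro frac_le mult_left_mono) auto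
  also have "\<dots> = limit_scale J" using p_pos[of J] by (simp add: limit_scale_def \<theta>_eq)
  finally show "real J \<le> limit_scale J" .
qed

lemma \<theta>_tendsto_0: "\<theta> \<longlonglongrightarrow> 0"
proof (rule tendsto_sandwich[OF _ _ tendsto_const])
  show "\<forall>\<^sub>F j in sequentially. 0 \<le> \<theta> j" using \<theta>_pos by (simp add: less_imp_le)
  show "\<forall>\<^sub>F j in sequentially. \<theta> j \<le> (1 / 4) ^ j"
    using order_trans[OF \<theta>_le_p p_le'] by (simp add: power_divide)
  show "(\<lambda>j. (1 / 4 :: real) ^ j) \<longlonglongrightarrow> 0" by (rule LIMSEQ_realpow_zero) auto
qed

lemma p_tendsto_0: "p \<longlonglongrightarrow> 0"
proof (rule tendsto_sandwich[OF _ _ tendsto_const])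
  show "\<forall>\<^sub>F j in sequentially. 0 \<le> p j" using p_pos by (simp add: less_imp_le)
  show "\<forall>\<^sub>F j in sequentially. p j \<le> (1 / 4) ^ j" using p_le' by (simp add: power_divide)
  show "(\<lambda>j. (1 / 4 :: real) ^ j) \<longlonglongrightarrow> 0" by (rule LIMSEQ_realpow_zero) auto
qed

text \<open>One minus the limit is \<open>1 / (1 + t\<^sup>2)\<close>: geometric blocks with a
  random sign, divided by their mean length, converge to the Laplace law.\<close>

lemma kappa_limit: "(\<lambda>J. kappa J (t * \<theta> J)) \<longlonglongrightarrow> t\<^sup>2 / (1 + t\<^sup>2)"
proof -
  let ?\<phi> = "\<lambda>x::real. (1 - cos (t * x)) / x\<^sup>2"
  have "(?\<phi> \<longlongrightarrow> t * t / 2) (at_right 0)" by real_asymp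
  moreover have "filterlim \<theta> (at_right 0) sequentially"
    by (rule tendsto_imp_filterlim_at_right[OF \<theta>_tendsto_0]) (simp add: \<theta>_pos)
  ultimately have lim: "(\<lambda>J. ?\<phi> (\<theta> J)) \<longlonglongrightarrow> t * t / 2" by (rule filterlim_compose)
  have pos: "1 + t * t > 0" by (simp add: add_pos_nonneg)
  have main: "(\<lambda>J. (2 - \<theta> J) * ?\<phi> (\<theta> J) / (1 + 2 * (1 - \<theta> J) * ?\<phi> (\<theta> J))) \<longlonglongrightarrow>
      (2 - 0) * (t * t / 2) / (1 + 2 * (1 - 0) * (t * t / 2))"
    using pos by (intro tendsto_divide tendsto_mult tendsto_add tendsto_diff tendsto_const lim \<theta>_tendsto_0) simp
  have eq: "kappa J (t * \<theta> J) = (2 - \<theta> J) * ?\<phi> (\<theta> J) / (1 + 2 * (1 - \<theta> J) * ?\<phi> (\<theta> J))" for J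
    unfolding kappa_def by (rule kappa_rescale) (use \<theta>_pos[of J] in simp)
  have "(2 - 0) * (t * t / 2) / (1 + 2 * (1 - 0) * (t * t / 2)) = t\<^sup>2 / (1 + t\<^sup>2)"
    by (simp add: power2_eq_square)
  with main show ?thesis by (simp only: eq)
qed

lemma limit_time_\<theta>p: "(\<lambda>J. real (limit_time J) * (\<theta> J * p J)) \<longlonglongrightarrow> 1"
proof (rule tendsto_sandwich[OF _ _ tendsto_const])
  show "(\<lambda>J. 1 + \<theta> J * p J) \<longlonglongrightarrow> 1"
    using tendsto_add[OF tendsto_const[of 1] tendsto_mult[OF \<theta>_tendsto_0 p_tendsto_0]] by simp
qed (use limit_time_bounds in auto)

text \<open>The expected number of nonzero blocks tends to one, so the total decay tends to the
  limit of \<open>kappa\<close>. The error of \<open>comp_char_approx\<close> is at most a bounded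
  factor times \<open>2 * p J\<close> and vanishes.\<close>

lemma comp_char_limit:
  "(\<lambda>J. comp_char J (limit_time J) (t * \<theta> J)) \<longlonglongrightarrow> complex_of_real (exp (1 / (1 + t\<^sup>2) - 1))"
proof -
  let ?d = "\<lambda>J. decay J (t * \<theta> J)" and ?m = limit_time
  have "(\<lambda>J. real (?m J) * (\<theta> J * p J) * kappa J (t * \<theta> J)) \<longlonglongrightarrow> 1 * (t\<^sup>2 / (1 + t\<^sup>2))"
    by (rule tendsto_mult[OF limit_time_\<theta>p kappa_limit])
  then have md: "(\<lambda>J. real (?m J) * ?d J) \<longlonglongrightarrow> t\<^sup>2 / (1 + t\<^sup>2)"
    by (simp add: decay_def mult_ac)
  have "(\<lambda>J. \<theta> J * (p J * kappa J (t * \<theta> J))) \<longlonglongrightarrow> 0 * (0 * (t\<^sup>2 / (1 + t\<^sup>2)))"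
    by (intro tendsto_mult \<theta>_tendsto_0 p_tendsto_0 kappa_limit)
  then have d0: "?d \<longlonglongrightarrow> 0" by (simp add: decay_def)
  have "(\<lambda>J. (1 - ?d J) ^ ?m J) \<longlonglongrightarrow> exp (- (t\<^sup>2 / (1 + t\<^sup>2)))"
    by (rule power_one_minus_tendsto_exp[OF decay_bounds(1,2) d0 md])
  moreover have "- (t\<^sup>2 / (1 + t\<^sup>2)) = 1 / (1 + t\<^sup>2) - 1"
    using add_pos_nonneg[of 1 "t\<^sup>2"] by (simp add: field_simps)
  ultimately have pw: "(\<lambda>J. complex_of_real ((1 - ?d J) ^ ?m J)) \<longlonglongrightarrow> complex_of_real (exp (1 / (1 + t\<^sup>2) - 1))"
    by (intro tendsto_of_real) simp
  have "(\<lambda>J. comp_char J (?m J) (t * \<theta> J) - complex_of_real ((1 - ?d J) ^ ?m J)) \<longlonglongrightarrow> 0"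
  proof (rule Lim_null_comparison)
    show "\<forall>\<^sub>F J in sequentially. norm (comp_char J (?m J) (t * \<theta> J) - complex_of_real ((1 - ?d J) ^ ?m J)) \<le> (2 + real (?m J) * ?d J) * (2 * p J)"
    proof (intro always_eventually allI)
      fix J
      have "(2 + real (?m J) * ?d J) * corr_err J (t * \<theta> J) \<le> (2 + real (?m J) * ?d J) * (2 * p J)"
        using decay_bounds(1)[of J "t * \<theta> J"] by (intro mult_left_mono corr_err_le(1)) auto
      then show "norm (comp_char J (?m J) (t * \<theta> J) - complex_of_real ((1 - ?d J) ^ ?m J)) \<le> (2 + real (?m J) * ?d J) * (2 * p J)"
        using comp_char_approx[of J "?m J" "t * \<theta> J"] by linarith
    qed
    have "(\<lambda>J. (2 + real (?m J) * ?d J) * (2 * p J)) \<longlonglongrightarrow> (2 + t\<^sup>2 / (1 + t\<^sup>2)) * (2 * 0)"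
      by (intro tendsto_mult tendsto_add tendsto_const md p_tendsto_0)
    then show "(\<lambda>J. (2 + real (?m J) * ?d J) * (2 * p J)) \<longlonglongrightarrow> 0" by simp
  qed
  from tendsto_add[OF this pw] show ?thesis by simp
qed

text \<open>The other components enter as an added phase, and changing a phase moves a unit complex
  number by at most the change. What remains is the first absolute moment of the rest, bounded by
  its second moment and \<open>rest_bound\<close>, relative to the scale.\<close>

lemma char_approx:
  assumes J: "J \<ge> 1"
  shows "norm ((\<integral>\<omega>. iexp (t * (partial_sum X (limit_time J) \<omega> / limit_scale J)) \<partial>\<Omega>) - comp_char J (limit_time J) (t * \<theta> J))
    \<le> \<bar>t\<bar> * sqrt (4 / (real J)\<^sup>2 + 8 / 4 ^ J)"
proof -
  let ?a = "\<lambda>j::nat. 1 / 4 ^ j :: real" and ?m = "limit_time J" and ?b = "limit_scale J"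
  let ?W = "wsum (?a(J := 0)) ?m" and ?s = "t / limit_scale J"
  have a: "\<bar>?a i\<bar> \<le> 1 / 4 ^ i" "\<bar>(?a(J := 0)) i\<bar> \<le> 1 / 4 ^ i" for i by simp_all
  have W: "\<bar>?W \<omega>\<bar> \<le> 2 * real ?m" for \<omega> by (rule wsum_bounds(3)[OF a(2)])
  have sa: "?s * ?a J = t * \<theta> J" by (simp add: limit_scale_def)
  have intW: "integrable \<Omega> (\<lambda>\<omega>. \<bar>?W \<omega>\<bar>)" "integrable \<Omega> (\<lambda>\<omega>. \<bar>?W \<omega>\<bar>\<^sup>2)"
    by (rule integrable_bounded[of _ "2 * real ?m"], use W in simp_all)
       (rule integrable_bounded[of _ "(2 * real ?m)\<^sup>2"], use square_le_square[OF W] in simp_all)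
  have int1: "integrable \<Omega> (\<lambda>\<omega>. iexp (?s * wsum ?a ?m \<omega>))" by (rule integrable_bounded[of _ 1]) auto
  have int2: "integrable \<Omega> (\<lambda>\<omega>. iexp (t * \<theta> J * comp_sum J ?m \<omega>))" by (rule integrable_iexp_comp_sum)
  have pt: "norm (iexp (?s * wsum ?a ?m \<omega>) - iexp (t * \<theta> J * comp_sum J ?m \<omega>)) \<le> \<bar>?s\<bar> * \<bar>?W \<omega>\<bar>" for \<omega>
  proof -
    have "?s * wsum ?a ?m \<omega> = t * \<theta> J * comp_sum J ?m \<omega> + ?s * ?W \<omega>"
      unfolding wsum_split[OF a(1), of ?m \<omega> J] distrib_left sa[symmetric] by simp
    then have "iexp (?s * wsum ?a ?m \<omega>) = iexp (t * \<theta> J * comp_sum J ?m \<omega>) * iexp (?s * ?W \<omega>)"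
      by (simp only: of_real_add distrib_left exp_add)
    then have "iexp (?s * wsum ?a ?m \<omega>) - iexp (t * \<theta> J * comp_sum J ?m \<omega>) = - (iexp (t * \<theta> J * comp_sum J ?m \<omega>) * (1 - iexp (?s * ?W \<omega>)))"
      by (simp only: right_diff_distrib mult_1_right minus_diff_eq)
    then have "norm (iexp (?s * wsum ?a ?m \<omega>) - iexp (t * \<theta> J * comp_sum J ?m \<omega>)) = norm (1 - iexp (?s * ?W \<omega>))"
      by (simp only: norm_minus_cancel norm_mult norm_exp_i_times mult_1)
    also have "\<dots> \<le> \<bar>?s * ?W \<omega>\<bar>" by (rule norm_iexp_minus_one_le)
    finally show ?thesis by (simp only: abs_mult)
  qed
  have "norm ((\<integral>\<omega>. iexp (?s * partial_sum X ?m \<omega>) \<partial>\<Omega>) - comp_char J ?m (t * \<theta> J)) =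
      norm (\<integral>\<omega>. iexp (?s * wsum ?a ?m \<omega>) - iexp (t * \<theta> J * comp_sum J ?m \<omega>) \<partial>\<Omega>)"
    unfolding char_partial_sum comp_char_def
    by (rule arg_cong[where f=norm], rule Bochner_Integration.integral_diff[OF int1 int2, symmetric])
  also have "\<dots> \<le> (\<integral>\<omega>. norm (iexp (?s * wsum ?a ?m \<omega>) - iexp (t * \<theta> J * comp_sum J ?m \<omega>)) \<partial>\<Omega>)"
    by (rule integral_norm_bound)
  also have "\<dots> \<le> (\<integral>\<omega>. \<bar>?s\<bar> * \<bar>?W \<omega>\<bar> \<partial>\<Omega>)"
    by (rule integral_mono[OF integrable_norm[OF Bochner_Integration.integrable_diff[OF int1 int2]] _ pt])
       (use intW in simp)
  also have "\<dots> = \<bar>?s\<bar> * expectation (\<lambda>\<omega>. \<bar>?W \<omega>\<bar>)" by simp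
  also have "\<dots> \<le> \<bar>?s\<bar> * sqrt (expectation (\<lambda>\<omega>. (?W \<omega>)\<^sup>2))"
  \<comment> \<open>The first absolute moment is bounded by the root of the second because the
    variance of the absolute value is nonnegative.\<close>
  proof (intro mult_left_mono real_le_rsqrt)
    show "(expectation (\<lambda>\<omega>. \<bar>?W \<omega>\<bar>))\<^sup>2 \<le> expectation (\<lambda>\<omega>. (?W \<omega>)\<^sup>2)"
      using variance_eq[OF intW] variance_positive[of "\<lambda>\<omega>. \<bar>?W \<omega>\<bar>"] by simp
  qed simp
  also have "\<dots> \<le> \<bar>?s\<bar> * (?b * sqrt (4 / (real J)\<^sup>2 + 8 / 4 ^ J))"
  proof (intro mult_left_mono)
    \<comment> \<open>The expected number of nonzero blocks of component \<open>J\<close> up to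
      rounding; it is at most \<open>2\<close>, which produces the constants \<open>4\<close> and
      \<open>8\<close>.\<close>
    let ?x = "real ?m * (\<theta> J * p J)"
    have x: "0 \<le> ?x" "?x \<le> 2" using limit_time_bounds[of J] \<theta>p_le_1[of J] by linarith+
    have "expectation (\<lambda>\<omega>. (?W \<omega>)\<^sup>2) \<le>
        (1 / 4 ^ J)\<^sup>2 * (2 * real ?m * (p J / \<theta> J) / (real J)\<^sup>2 + 2 * (real ?m)\<^sup>2 * (p J)\<^sup>2 / 4 ^ J)"
      by (rule rest_bound[OF J]) simp
    also have "\<dots> = ?b\<^sup>2 * (2 * ?x / (real J)\<^sup>2 + 2 * ?x\<^sup>2 / 4 ^ J)"
    proof -
      have e1: "2 * real ?m * (p J / \<theta> J) / (real J)\<^sup>2 = (2 * ?x / (real J)\<^sup>2) / (\<theta> J)\<^sup>2"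
        using \<theta>_pos[of J] by (simp add: power2_eq_square mult_ac)
      have e2: "2 * (real ?m)\<^sup>2 * (p J)\<^sup>2 / 4 ^ J = (2 * ?x\<^sup>2 / 4 ^ J) / (\<theta> J)\<^sup>2"
        using \<theta>_pos[of J] by (simp add: power_mult_distrib)
      have b2: "?b\<^sup>2 = (1 / 4 ^ J)\<^sup>2 / (\<theta> J)\<^sup>2" by (simp only: limit_scale_def power_divide)
      have "A * (u / T + v / T) = A / T * (u + v)" for A T u v :: real
        by (simp add: distrib_left add_divide_distrib)
      then show ?thesis by (simp only: e1 e2 b2)
    qed
    also have "\<dots> \<le> ?b\<^sup>2 * (2 * 2 / (real J)\<^sup>2 + 2 * 2\<^sup>2 / 4 ^ J)"
      using x by (intro mult_left_mono add_mono divide_right_mono power_mono) auto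
    finally have "sqrt (expectation (\<lambda>\<omega>. (?W \<omega>)\<^sup>2)) \<le> sqrt (?b\<^sup>2 * (4 / (real J)\<^sup>2 + 8 / 4 ^ J))"
      by (intro real_sqrt_le_mono) simp
    then show "sqrt (expectation (\<lambda>\<omega>. (?W \<omega>)\<^sup>2)) \<le> ?b * sqrt (4 / (real J)\<^sup>2 + 8 / 4 ^ J)"
      using limit_scale_pos[of J] by (simp only: real_sqrt_mult real_sqrt_abs abs_of_pos)
  qed simp
  also have "\<dots> = \<bar>t\<bar> * sqrt (4 / (real J)\<^sup>2 + 8 / 4 ^ J)"
    using limit_scale_pos[of J] by simp
  finally show ?thesis by simp
qed

lemma weak_conv_P1sL:
  "weak_conv_m (\<lambda>J. distr \<Omega> borel (\<lambda>\<omega>. partial_sum X (limit_time J) \<omega> / limit_scale J)) mu_P1sL"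
proof (rule levy_continuity)
  have Ym: "(\<lambda>\<omega>. partial_sum X (limit_time J) \<omega> / limit_scale J) \<in> borel_measurable \<Omega>" for J
    by measurable
  show "real_distribution (distr \<Omega> borel (\<lambda>\<omega>. partial_sum X (limit_time J) \<omega> / limit_scale J))" for J
    by (rule real_distribution_distr[OF Ym])
  show "real_distribution mu_P1sL" by (rule real_distribution_P1sL)
  fix t
  let ?\<phi> = "\<lambda>J. \<integral>\<omega>. iexp (t * (partial_sum X (limit_time J) \<omega> / limit_scale J)) \<partial>\<Omega>"
  have char: "char (distr \<Omega> borel (\<lambda>\<omega>. partial_sum X (limit_time J) \<omega> / limit_scale J)) t = ?\<phi> J" for J
    unfolding char_def by (rule integral_distr[OF Ym]) measurable
  have "(\<lambda>J. ?\<phi> J - comp_char J (limit_time J) (t * \<theta> J)) \<longlonglongrightarrow> 0"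
  proof (rule Lim_null_comparison)
    show "\<forall>\<^sub>F J in sequentially. norm (?\<phi> J - comp_char J (limit_time J) (t * \<theta> J)) \<le> \<bar>t\<bar> * sqrt (4 / (real J)\<^sup>2 + 8 / 4 ^ J)"
      by (rule eventually_mono[OF eventually_ge_at_top[of 1]]) (rule char_approx)
    have "(\<lambda>J::nat. sqrt (4 / (real J)\<^sup>2 + 8 / 4 ^ J)) \<longlonglongrightarrow> 0" by real_asymp
    then show "(\<lambda>J::nat. \<bar>t\<bar> * sqrt (4 / (real J)\<^sup>2 + 8 / 4 ^ J)) \<longlonglongrightarrow> 0"
      by (rule tendsto_mult_right_zero)
  qed
  from tendsto_add[OF this comp_char_limit[of t]]
  show "(\<lambda>J. char (distr \<Omega> borel (\<lambda>\<omega>. partial_sum X (limit_time J) \<omega> / limit_scale J)) t) \<longlonglongrightarrow> char mu_P1sL t"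
    by (simp only: char char_P1sL diff_add_cancel add_0)
qed

end

theorem theorem4p4:
  fixes g :: "nat \<Rightarrow> real"
  assumes g_pos: "\<And>n. n \<ge> 1 \<Longrightarrow> g n > 0"
    and g_lim: "filterlim g at_top sequentially"
  shows "\<exists>(M :: (int \<Rightarrow> real) measure) (X :: int \<Rightarrow> (int \<Rightarrow> real) \<Rightarrow> real) (S :: real set).
    stationary_markov_chain M X S \<and> irreducible_chain M X S \<and> aperiodic_chain M X S \<and>
    reversible_process M X \<and>
    \<comment> \<open>(i)\<close>
    (\<exists>C>0. measure M {\<omega> \<in> space M. \<bar>X 0 \<omega>\<bar> \<le> C} = 1) \<and>
    \<comment> \<open>(ii)\<close>
    (\<forall>n\<ge>1. alpha_mixing M X n \<le> beta_mixing M X n) \<and>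
    beta_mixing M X \<in> O(\<lambda>n. g n * (1 / real n)) \<and>
    \<comment> \<open>(iii)\<close>
    integrable M (\<lambda>\<omega>. (X 0 \<omega>)\<^sup>2) \<and> prob_space.expectation M (X 0) = 0 \<and>
    filterlim (\<lambda>n. prob_space.variance M (partial_sum X n) / real n) at_top sequentially \<and>
    (\<forall>c>0. (\<lambda>n. SUP r::real. measure M {\<omega> \<in> space M.
        r - c < partial_sum X n \<omega> / sqrt (real n) \<and>
        partial_sum X n \<omega> / sqrt (real n) < r + c}) \<longlonglongrightarrow> 0) \<and>
    (\<exists>(J :: nat \<Rightarrow> nat) (b :: nat \<Rightarrow> real).
        strict_mono_on {1..} J \<and> (\<forall>n\<ge>1. J n > 0) \<and>
        (\<forall>n\<ge>1. b n > 0) \<and> filterlim b at_top sequentially \<and>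
        weak_conv_m (\<lambda>n. distr M borel (\<lambda>\<omega>. partial_sum X (J n) \<omega> / b n)) mu_P1sL) \<and>
    \<comment> \<open>(iv)\<close>
    (\<forall>n\<ge>1. normalized_variance M X n \<le> g n) \<and>
    (\<forall>N\<ge>1. limsup (\<lambda>n. ereal (normalized_variance M X (N * n) / normalized_variance M X n)) =
              ereal (real N))"
proof -
  obtain p \<theta> where "reversible_example p \<theta> g"
    using exists_reversible_example[OF g_pos g_lim] by blast
  then interpret reversible_example p \<theta> g .
  show ?thesis
  proof (intro exI[of _ \<Omega>] exI[of _ X] exI[of _ state_space] conjI allI impI)
    show "\<exists>C>0. prob {\<omega> \<in> space \<Omega>. \<bar>X 0 \<omega>\<bar> \<le> C} = 1"
      by (rule exI[of _ 2]) (use prob_X_bounded in simp)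
    show "\<exists>(J :: nat \<Rightarrow> nat) (b :: nat \<Rightarrow> real).
        strict_mono_on {1..} J \<and> (\<forall>n\<ge>1. J n > 0) \<and> (\<forall>n\<ge>1. b n > 0) \<and> filterlim b at_top sequentially \<and>
        weak_conv_m (\<lambda>n. distr \<Omega> borel (\<lambda>\<omega>. partial_sum X (J n) \<omega> / b n)) mu_P1sL"
      using strict_mono_limit_time limit_time_pos limit_scale_pos limit_scale_at_top weak_conv_P1sL
      by (intro exI[of _ limit_time] exI[of _ limit_scale]) (auto intro: monotone_on_subset)
    show "normalized_variance \<Omega> X n \<le> g n" if "n \<ge> 1" for n
      unfolding normalized_variance_def by (rule variance_le[OF that])
  qed (assumption | rule markov_chain_X irreducible_X aperiodic_X reversible_X alpha_mixing_le_beta_mixing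
      beta_mixing_bigo integrable_X_square expectation_X variance_at_top concentration_tendsto_0 limsup_variance_ratio)+
qed

end
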